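(* Let $G$ be a countably infinite group with the fixed-point property for cones and let $p \in \ell^\infty(G,\mathcal{K})$ be a projection of subexponentially growing dimension. Then there is a $G$-invariant lower semi-continuous trace $\tau$ on $\ell^\infty(G,\mathcal{K})$ with $\tau(p)=1$, and there is a lower semi-continuous trace $\tau'$ on the Roe algebra $\ell^\infty(G,\mathcal{K}) \rtimes G$ with $\tau'(p)=1$.
   Context: $\mathcal{K}$ is the $C^*$-algebra of compact operators on a separable infinite dimensional Hilbert space with standard trace $\mathrm{Tr}$, and $\ell^\infty(G,\mathcal{K})$ is the $C^*$-algebra of bounded functions $G \to \mathcal{K}$, with $G$ acting by left-translation; $\ell^\infty(G,\mathcal{K}) \rtimes G$ is the reduced crossed product. Traces on a $C^*$-algebra $\mathcal{A}$ here are additive, (positively) homogeneous maps $\tau \colon \mathcal{A}^+ \to [0,\infty]$ with $\tau(x^*x)=\tau(xx^* )$ for all $x \in \mathcal{A}$ (not necessarily densely finite); $\tau$ is lower semi-continuous if $\tau(a) = \sup_{\varepsilon>0}\tau((a-\varepsilon)_+)$ for all $a \in \mathcal{A}^+$. A proper length function on $G$ is a map $\ell \colon G \to \mathbb{N}_0$ with $\ell(t)=0$ iff $t = e$, $\ell(st) \le \ell(s)+\ell(t)$ for all $s,t \in G$, and $W_n := \{t \in G : \ell(t) \le n\}$ finite for all $n \ge 0$. For a projection $p \in \ell^\infty(G,\mathcal{K})$ put $\alpha_n = \max_{t \in W_n}\mathrm{Tr}(p(t))$. The projection $p$ (non-zero, so that $\alpha_n > 0$ for all large $n$) has subexponentially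 growing dimension if, with respect to some proper length function on $G$, $\liminf_{n\to\infty} \alpha_{n+m}/\alpha_n = 1$ for all $m \ge 0$. Fixed-point property for cones (Monod): let $V$ be a real Hausdorff locally convex topological vector space on which $G$ acts by continuous linear maps, leaving invariant a convex cone $C \subseteq V$. The cone $C$ is proper if $C \cap (-C) = \{0\}$, and weakly complete if every net in $C$ that is Cauchy for the weak topology converges weakly to an element of $C$. The dual $V^*$ is preordered by $\varphi \le \psi$ iff $\varphi(c) \le \psi(c)$ for all $c \in C$. The action is of cobounded type if there is a positive $\varphi \in V^*$ such that every $\psi \in V^*$ satisfies $\psi \le \sum_{j=1}^n t_j.\varphi$ for some $n \ge 1$ and $t_1,\dots,t_n \in G$; it is locally bounded if some non-zero $c \in C$ has bounded $G$-orbit (a set $M$ is bounded if for each open neighborhood $U$ of $0$ there is $r>0$ with $M \subseteq rU$). $G$ has the fixed-point property for cones if every such action on a proper weakly complete cone that is of cobounded type and locally bounded has a non-zero fixed point in $C$. *)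

theory Defs
  imports "HOL-Analysis.Analysis"
begin

text \<open>
  Groups are types of class \<open>group_add\<close>; this class is not commutative. The product
  \<open>s t\<close> is written \<open>s + t\<close>, the inverse \<open>- s\<close> and the neutral element \<open>0\<close>.
\<close>

section \<open>Complex Hilbert spaces\<close>

text \<open>
  Built on top of \<open>real_inner\<close>, so that norm, topology and bounded operators (\<open>blinfun\<close>) are those
  of the library. The complex inner product is linear in the first argument.
\<close>

class complex_hilbert_space = real_inner + complete_space +
  fixes scaleC :: "complex \<Rightarrow> 'a \<Rightarrow> 'a"
    and cinner :: "'a \<Rightarrow> 'a \<Rightarrow> complex"
  assumes scaleC_add_right: "scaleC c (x + y) = scaleC c x + scaleC c y"
    and scaleC_add_left: "scaleC (c + d) x = scaleC c x + scaleC d x"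
    and scaleC_scaleC: "scaleC c (scaleC d x) = scaleC (c * d) x"
    and scaleC_of_real: "scaleC (complex_of_real r) x = r *\<^sub>R x"
    and cinner_commute: "cinner y x = cnj (cinner x y)"
    and cinner_add_left: "cinner (x + y) z = cinner x z + cinner y z"
    and cinner_scaleC_left: "cinner (scaleC c x) y = c * cinner x y"
    and Re_cinner: "Re (cinner x y) = inner x y"
begin

subclass banach ..

end

lemma cinner_self: "cinner x x = complex_of_real ((norm x)\<^sup>2)"
  for x :: "'a::complex_hilbert_space"
proof -
  have "Im (cinner x x) = 0"
    using arg_cong[OF cinner_commute[of x x], of Im] by simp
  then show ?thesis
    by (simp add: complex_eq_iff Re_cinner dot_square_norm)
qed

lemma norm_scaleC: "norm (scaleC c x) = cmod c * norm x"
  for x :: "'a::complex_hilbert_space"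
proof -
  have "cinner (scaleC c x) (scaleC c x) = c * cnj (c * cinner x x)"
    by (metis cinner_commute cinner_scaleC_left)
  also have "\<dots> = complex_of_real ((cmod c * norm x)\<^sup>2)"
    by (simp add: cinner_self power_mult_distrib complex_norm_square del: of_real_power)
  finally have "(norm (scaleC c x))\<^sup>2 = (cmod c * norm x)\<^sup>2"
    by (simp only: cinner_self of_real_eq_iff)
  then show ?thesis
    by (simp add: power2_eq_iff_nonneg)
qed

lemma cmod_cinner_le: "cmod (cinner x y) \<le> norm x * norm y"
  for x :: "'a::complex_hilbert_space"
proof (cases "cinner x y = 0")
  case False
  define c where "c = cnj (cinner x y) / cmod (cinner x y)"
  have c: "cmod c = 1"
    using False by (simp add: c_def norm_divide)
  have "c * cinner x y = complex_of_real (cmod (cinner x y))"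
    using False complex_norm_square[of "cinner x y"]
    by (simp add: c_def field_simps power2_eq_square)
  then have "cmod (cinner x y) = inner (scaleC c x) y"
    by (metis Re_cinner Re_complex_of_real cinner_scaleC_left)
  also have "\<dots> \<le> norm (scaleC c x) * norm y"
    by (rule norm_cauchy_schwarz)
  finally show ?thesis
    by (simp add: norm_scaleC c)
qed simp


section \<open>The Hilbert space of square summable families\<close>

definition square_summable :: "('g \<Rightarrow> 'h::real_normed_vector) \<Rightarrow> bool" where
  "square_summable f \<longleftrightarrow> (\<lambda>t. (norm (f t))\<^sup>2) summable_on UNIV"

lemma square_summable_zero: "square_summable (\<lambda>_. 0)"
  by (simp add: square_summable_def)

lemma square_summable_add:
  assumes "square_summable f" "square_summable g"
  shows "square_summable (\<lambda>t. f t + g t)"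
  unfolding square_summable_def
proof (rule summable_on_comparison_test)
  show "(\<lambda>t. 2 * (norm (f t))\<^sup>2 + 2 * (norm (g t))\<^sup>2) summable_on UNIV"
    using assms unfolding square_summable_def
    by (intro summable_on_add summable_on_cmult_right)
  fix t
  have "(norm (f t + g t))\<^sup>2 \<le> (norm (f t) + norm (g t))\<^sup>2"
    by (intro power_mono norm_triangle_ineq norm_ge_zero)
  also have "\<dots> \<le> 2 * (norm (f t))\<^sup>2 + 2 * (norm (g t))\<^sup>2"
    using sum_squares_bound[of "norm (f t)" "norm (g t)"]
    by (simp add: power2_sum)
  finally show "(norm (f t + g t))\<^sup>2 \<le> 2 * (norm (f t))\<^sup>2 + 2 * (norm (g t))\<^sup>2" .
qed auto

lemma square_summable_bounded:
  assumes "square_summable f" "\<And>t. norm (g t) \<le> C * norm (f t)"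
  shows "square_summable g"
  unfolding square_summable_def
proof (rule summable_on_comparison_test)
  show "(\<lambda>t. C\<^sup>2 * (norm (f t))\<^sup>2) summable_on UNIV"
    using assms(1) unfolding square_summable_def by (intro summable_on_cmult_right)
  fix t
  show "(norm (g t))\<^sup>2 \<le> C\<^sup>2 * (norm (f t))\<^sup>2"
    using power_mono[OF assms(2)[of t], of 2] by (simp add: power_mult_distrib)
qed auto

lemma square_summable_scaleR: "square_summable f \<Longrightarrow> square_summable (\<lambda>t. r *\<^sub>R f t)"
  by (rule square_summable_bounded) auto

lemma square_summable_mult:
  assumes "square_summable f" "square_summable g"
  shows "(\<lambda>t. norm (f t) * norm (g t)) summable_on UNIV"
proof (rule summable_on_comparison_test)
  show "(\<lambda>t. (norm (f t))\<^sup>2 + (norm (g t))\<^sup>2) summable_on UNIV"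
    using assms unfolding square_summable_def by (intro summable_on_add)
  fix t
  show "norm (f t) * norm (g t) \<le> (norm (f t))\<^sup>2 + (norm (g t))\<^sup>2"
    using sum_squares_bound[of "norm (f t)" "norm (g t)"]
      mult_nonneg_nonneg[OF norm_ge_zero[of "f t"] norm_ge_zero[of "g t"]]
    by linarith
qed auto

lemma square_summable_inner:
  fixes f g :: "'g \<Rightarrow> 'h::real_inner"
  assumes "square_summable f" "square_summable g"
  shows "(\<lambda>t. inner (f t) (g t)) summable_on UNIV"
  by (rule Infinite_Sum.abs_summable_summable, rule Infinite_Sum.abs_summable_on_comparison_test'[OF square_summable_mult[OF assms]])
    (simp add: Cauchy_Schwarz_ineq2)

lemma square_summable_cinner:
  fixes f g :: "'g \<Rightarrow> 'h::complex_hilbert_space"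
  assumes "square_summable f" "square_summable g"
  shows "(\<lambda>t. cinner (f t) (g t)) summable_on UNIV"
  by (rule Infinite_Sum.abs_summable_summable, rule Infinite_Sum.abs_summable_on_comparison_test'[OF square_summable_mult[OF assms]])
    (simp add: cmod_cinner_le)

text \<open>\<open>('g, 'h) ell2\<close> is the Hilbert space \<open>\<ell>\<^sup>2(G, H)\<close>.\<close>

typedef (overloaded) ('g, 'h) ell2 = "{f :: 'g \<Rightarrow> 'h::complex_hilbert_space. square_summable f}"
  morphisms ell2_apply Ell2
  using square_summable_zero by blast

setup_lifting type_definition_ell2

lemma square_summable_ell2 [simp]: "square_summable (ell2_apply x)"
  using ell2_apply by blast

lemma ell2_eqI: "(\<And>t. ell2_apply x t = ell2_apply y t) \<Longrightarrow> x = y"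
  by (simp add: ell2_apply_inject[symmetric] ext)

instantiation ell2 :: (type, complex_hilbert_space) real_inner
begin

lift_definition zero_ell2 :: "('a, 'b) ell2" is "\<lambda>_. 0"
  by (rule square_summable_zero)

lift_definition plus_ell2 :: "('a, 'b) ell2 \<Rightarrow> ('a, 'b) ell2 \<Rightarrow> ('a, 'b) ell2"
  is "\<lambda>f g t. f t + g t"
  by (rule square_summable_add)

lift_definition uminus_ell2 :: "('a, 'b) ell2 \<Rightarrow> ('a, 'b) ell2" is "\<lambda>f t. - f t"
  by (erule square_summable_bounded[where C = 1]) simp

lift_definition minus_ell2 :: "('a, 'b) ell2 \<Rightarrow> ('a, 'b) ell2 \<Rightarrow> ('a, 'b) ell2"
  is "\<lambda>f g t. f t - g t"
proof -
  fix f g :: "'a \<Rightarrow> 'b"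
  assume "square_summable f" "square_summable g"
  then have "square_summable f" "square_summable (\<lambda>t. - g t)"
    by (auto elim: square_summable_bounded[where C = 1])
  from square_summable_add[OF this] show "square_summable (\<lambda>t. f t - g t)"
    by simp
qed

lift_definition scaleR_ell2 :: "real \<Rightarrow> ('a, 'b) ell2 \<Rightarrow> ('a, 'b) ell2" is "\<lambda>r f t. r *\<^sub>R f t"
  by (rule square_summable_scaleR)

lift_definition inner_ell2 :: "('a, 'b) ell2 \<Rightarrow> ('a, 'b) ell2 \<Rightarrow> real"
  is "\<lambda>f g. \<Sum>\<^sub>\<infinity>t. inner (f t) (g t)" .

definition norm_ell2 :: "('a, 'b) ell2 \<Rightarrow> real" where
  "norm_ell2 x = sqrt (inner x x)"

definition dist_ell2 :: "('a, 'b) ell2 \<Rightarrow> ('a, 'b) ell2 \<Rightarrow> real" where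
  "dist_ell2 x y = norm (x - y)"

definition sgn_ell2 :: "('a, 'b) ell2 \<Rightarrow> ('a, 'b) ell2" where
  "sgn_ell2 x = inverse (norm x) *\<^sub>R x"

definition uniformity_ell2 :: "(('a, 'b) ell2 \<times> ('a, 'b) ell2) filter" where
  "uniformity_ell2 = (INF e\<in>{0 <..}. principal {(x, y). dist x y < e})"

definition open_ell2 :: "('a, 'b) ell2 set \<Rightarrow> bool" where
  "open_ell2 U \<longleftrightarrow> (\<forall>x\<in>U. eventually (\<lambda>(x', y). x' = x \<longrightarrow> y \<in> U) uniformity)"

lemma inner_ell2_self: "inner x x = (\<Sum>\<^sub>\<infinity>t. (norm (ell2_apply x t))\<^sup>2)" for x :: "('a, 'b) ell2"
  by (simp add: inner_ell2.rep_eq dot_square_norm)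

instance
proof
  fix x y z :: "('a, 'b) ell2" and r s :: real
  show "x + y + z = x + (y + z)" by transfer (simp add: add.assoc)
  show "x + y = y + x" by transfer (simp add: add.commute)
  show "0 + x = x" by transfer simp
  show "- x + x = 0" by transfer simp
  show "x - y = x + - y" by transfer simp
  show "r *\<^sub>R (x + y) = r *\<^sub>R x + r *\<^sub>R y" by transfer (simp add: scaleR_add_right)
  show "(r + s) *\<^sub>R x = r *\<^sub>R x + s *\<^sub>R x" by transfer (simp add: scaleR_add_left)
  show "r *\<^sub>R s *\<^sub>R x = (r * s) *\<^sub>R x" by transfer simp
  show "1 *\<^sub>R x = x" by transfer simp
  show "sgn x = inverse (norm x) *\<^sub>R x" by (rule sgn_ell2_def)
  show "dist x y = norm (x - y)" by (rule dist_ell2_def)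
  show "(uniformity :: (('a, 'b) ell2 \<times> ('a, 'b) ell2) filter)
      = (INF e\<in>{0 <..}. principal {(x, y). dist x y < e})"
    by (rule uniformity_ell2_def)
  show "open U \<longleftrightarrow> (\<forall>x\<in>U. eventually (\<lambda>(x', y). x' = x \<longrightarrow> y \<in> U) uniformity)"
    for U :: "('a, 'b) ell2 set"
    by (rule open_ell2_def)
  show "inner x y = inner y x" by transfer (simp add: inner_commute)
  show "inner (x + y) z = inner x z + inner y z"
    by transfer (simp add: inner_add_left infsum_add square_summable_inner)
  show "inner (r *\<^sub>R x) y = r * inner x y"
    by transfer (simp add: infsum_cmult_right')
  show "0 \<le> inner x x"
    by transfer (simp add: infsum_nonneg)
  show "inner x x = 0 \<longleftrightarrow> x = 0"
  proof
    assume "inner x x = 0"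
    then have "(norm (ell2_apply x t))\<^sup>2 = 0" for t
      using square_summable_ell2[of x]
      by (intro nonneg_infsum_le_0D[where A = UNIV and f = "\<lambda>t. (norm (ell2_apply x t))\<^sup>2"])
        (auto simp: inner_ell2_self square_summable_def)
    then show "x = 0"
      by (intro ell2_eqI) (simp add: zero_ell2.rep_eq)
  next
    show "x = 0 \<Longrightarrow> inner x x = 0"
      by transfer simp
  qed
  show "norm x = sqrt (inner x x)" by (rule norm_ell2_def)
qed

end

lemma norm_ell2_square: "(norm x)\<^sup>2 = (\<Sum>\<^sub>\<infinity>t. (norm (ell2_apply x t))\<^sup>2)"
  by (simp add: dot_square_norm[symmetric] inner_ell2_self)

lemma sum_le_norm_ell2:
  assumes "finite F"
  shows "(\<Sum>t\<in>F. (norm (ell2_apply x t))\<^sup>2) \<le> (norm x)\<^sup>2"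
  unfolding norm_ell2_square using assms square_summable_ell2[of x]
  by (intro finite_sum_le_infsum) (auto simp: square_summable_def)

lemma norm_ell2_apply_le: "norm (ell2_apply x t) \<le> norm x"
  using sum_le_norm_ell2[of "{t}" x] by (simp add: power2_le_iff_abs_le)

lemma square_summable_bdd:
  assumes "\<And>F. finite F \<Longrightarrow> (\<Sum>t\<in>F. (norm (f t))\<^sup>2) \<le> C"
  shows "square_summable f"
  unfolding square_summable_def using assms
  by (intro nonneg_bdd_above_summable_on bdd_aboveI2[where M = C]) auto

lemma norm_ell2_le:
  assumes "\<And>F. finite F \<Longrightarrow> (\<Sum>t\<in>F. (norm (ell2_apply x t))\<^sup>2) \<le> C\<^sup>2" "C \<ge> 0"
  shows "norm x \<le> C"
proof -
  have "(norm x)\<^sup>2 \<le> C\<^sup>2"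
    unfolding norm_ell2_square using square_summable_ell2[of x] assms(1)
    by (intro infsum_le_finite_sums) (auto simp: square_summable_def)
  then show ?thesis
    using assms(2) by (rule power2_le_imp_le)
qed

instance ell2 :: (type, complex_hilbert_space) complete_space
proof
  fix X :: "nat \<Rightarrow> ('a, 'b) ell2"
  assume X: "Cauchy X"
  have "Cauchy (\<lambda>n. ell2_apply (X n) t)" for t
  proof (rule CauchyI)
    fix e :: real
    assume "e > 0"
    then obtain M where M: "\<And>m n. m \<ge> M \<Longrightarrow> n \<ge> M \<Longrightarrow> norm (X m - X n) < e"
      using CauchyD[OF X] by blast
    have "norm (ell2_apply (X m) t - ell2_apply (X n) t) < e" if "m \<ge> M" "n \<ge> M" for m n
      using norm_ell2_apply_le[of "X m - X n" t] M[OF that] by (simp add: minus_ell2.rep_eq)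
    then show "\<exists>M. \<forall>m\<ge>M. \<forall>n\<ge>M. norm (ell2_apply (X m) t - ell2_apply (X n) t) < e"
      by blast
  qed
  then have "\<exists>l. (\<lambda>n. ell2_apply (X n) t) \<longlonglongrightarrow> l" for t
    by (simp add: Cauchy_convergent_iff convergent_def)
  then obtain L where L: "\<And>t. (\<lambda>n. ell2_apply (X n) t) \<longlonglongrightarrow> L t"
    by metis
  have bound: "\<exists>M. \<forall>m\<ge>M. \<forall>F. finite F \<longrightarrow> (\<Sum>t\<in>F. (norm (ell2_apply (X m) t - L t))\<^sup>2) \<le> e\<^sup>2"
    if e: "e > 0" for e
  proof -
    obtain M where M: "\<And>m n. m \<ge> M \<Longrightarrow> n \<ge> M \<Longrightarrow> norm (X m - X n) < e"
      using CauchyD[OF X e] by blast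
    have "(\<Sum>t\<in>F. (norm (ell2_apply (X m) t - L t))\<^sup>2) \<le> e\<^sup>2" if "m \<ge> M" "finite F" for m F
    proof (rule LIMSEQ_le_const2)
      show "(\<lambda>n. \<Sum>t\<in>F. (norm (ell2_apply (X m) t - ell2_apply (X n) t))\<^sup>2)
          \<longlonglongrightarrow> (\<Sum>t\<in>F. (norm (ell2_apply (X m) t - L t))\<^sup>2)"
        by (intro tendsto_intros L)
      have "(\<Sum>t\<in>F. (norm (ell2_apply (X m) t - ell2_apply (X n) t))\<^sup>2) \<le> e\<^sup>2" if "n \<ge> M" for n
      proof -
        have "(norm (X m - X n))\<^sup>2 \<le> e\<^sup>2"
          using M[OF \<open>m \<ge> M\<close> that] by (intro power_mono) auto
        then show ?thesis
          using sum_le_norm_ell2[OF \<open>finite F\<close>, of "X m - X n"] by (simp add: minus_ell2.rep_eq)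
      qed
      then show "\<exists>N. \<forall>n\<ge>N. (\<Sum>t\<in>F. (norm (ell2_apply (X m) t - ell2_apply (X n) t))\<^sup>2) \<le> e\<^sup>2"
        by blast
    qed
    then show ?thesis by blast
  qed
  obtain M where "\<And>F. finite F \<Longrightarrow> (\<Sum>t\<in>F. (norm (ell2_apply (X M) t - L t))\<^sup>2) \<le> 1\<^sup>2"
    using bound[of 1] by auto
  then have "square_summable (\<lambda>t. ell2_apply (X M) t - L t)"
    by (rule square_summable_bdd)
  then have "square_summable (\<lambda>t. L t - ell2_apply (X M) t)"
    by (rule square_summable_bounded[where C = 1]) (simp add: norm_minus_commute)
  from square_summable_add[OF square_summable_ell2[of "X M"] this]
  have sL: "square_summable L" by simp
  have "X \<longlonglongrightarrow> Ell2 L"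
  proof (rule LIMSEQ_I)
    fix r :: real
    assume "r > 0"
    then obtain M where M: "\<And>m F. m \<ge> M \<Longrightarrow> finite F \<Longrightarrow>
        (\<Sum>t\<in>F. (norm (ell2_apply (X m) t - L t))\<^sup>2) \<le> (r / 2)\<^sup>2"
      using bound[of "r / 2"] by auto
    have "norm (X m - Ell2 L) \<le> r / 2" if "m \<ge> M" for m
      using M[OF that] \<open>r > 0\<close> sL
      by (intro norm_ell2_le) (simp_all add: minus_ell2.rep_eq Ell2_inverse)
    then show "\<exists>M. \<forall>m\<ge>M. norm (X m - Ell2 L) < r"
      using \<open>r > 0\<close> by (intro exI[of _ M] allI impI) (rule le_less_trans[of _ "r / 2"], auto)
  qed
  then show "convergent X"
    by (auto simp: convergent_def)
qed

instantiation ell2 :: (type, complex_hilbert_space) complex_hilbert_space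
begin

lift_definition scaleC_ell2 :: "complex \<Rightarrow> ('a, 'b) ell2 \<Rightarrow> ('a, 'b) ell2" is "\<lambda>c f t. scaleC c (f t)"
  by (rule square_summable_bounded, assumption) (rule eq_refl[OF norm_scaleC])

lift_definition cinner_ell2 :: "('a, 'b) ell2 \<Rightarrow> ('a, 'b) ell2 \<Rightarrow> complex"
  is "\<lambda>f g. \<Sum>\<^sub>\<infinity>t. cinner (f t) (g t)" .

instance
proof
  fix x y z :: "('a, 'b) ell2" and c d :: complex and r :: real
  show "scaleC c (x + y) = scaleC c x + scaleC c y" by transfer (simp add: scaleC_add_right)
  show "scaleC (c + d) x = scaleC c x + scaleC d x" by transfer (simp add: scaleC_add_left)
  show "scaleC c (scaleC d x) = scaleC (c * d) x" by transfer (simp add: scaleC_scaleC)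
  show "scaleC (complex_of_real r) x = r *\<^sub>R x" by transfer (simp add: scaleC_of_real)
  show "cinner y x = cnj (cinner x y)"
    by transfer (simp only: infsum_cnj[symmetric] cinner_commute[symmetric])
  show "cinner (x + y) z = cinner x z + cinner y z"
    by transfer (simp add: cinner_add_left infsum_add square_summable_cinner)
  show "cinner (scaleC c x) y = c * cinner x y"
    by transfer (simp add: cinner_scaleC_left infsum_cmult_right')
  show "Re (cinner x y) = inner x y"
    by transfer (simp add: infsum_Re[symmetric] square_summable_cinner Re_cinner)
qed

end


section \<open>Operators\<close>

definition clinear_op :: "('h::complex_hilbert_space \<Rightarrow>\<^sub>L 'h) \<Rightarrow> bool" where
  "clinear_op T \<longleftrightarrow> (\<forall>c x. blinfun_apply T (scaleC c x) = scaleC c (blinfun_apply T x))"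

definition adjoint_op :: "('h::complex_hilbert_space \<Rightarrow>\<^sub>L 'h) \<Rightarrow> ('h \<Rightarrow>\<^sub>L 'h)" where
  "adjoint_op T =
    (THE S. \<forall>x y. cinner (blinfun_apply S x) y = cinner x (blinfun_apply T y))"

definition positive_op :: "('h::complex_hilbert_space \<Rightarrow>\<^sub>L 'h) \<Rightarrow> bool" where
  "positive_op T \<longleftrightarrow> clinear_op T \<and> (\<forall>x. cinner (blinfun_apply T x) x \<in> \<real>\<^sub>\<ge>\<^sub>0)"

text \<open>
  The positive part \<open>b\<^sub>+\<close> of a self-adjoint operator \<open>b\<close>, from the unique decomposition
  \<open>b = b\<^sub>+ - b\<^sub>-\<close> with \<open>b\<^sub>+\<close> and \<open>b\<^sub>-\<close> positive and \<open>b\<^sub>+ b\<^sub>- = 0\<close>.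
\<close>

definition positive_part :: "('h::complex_hilbert_space \<Rightarrow>\<^sub>L 'h) \<Rightarrow> ('h \<Rightarrow>\<^sub>L 'h)" where
  "positive_part b =
    (THE c. positive_op c \<and> (\<exists>d. positive_op d \<and> b = c - d \<and> c o\<^sub>L d = 0))"

definition compact_ops :: "('h::complex_hilbert_space \<Rightarrow>\<^sub>L 'h) set" where
  "compact_ops = {T. clinear_op T \<and> compact (closure (blinfun_apply T ` cball 0 1))}"

text \<open>The real span of all complex multiples of elements of \<open>B\<close> is the complex span of \<open>B\<close>.\<close>

definition orthonormal_basis :: "'h::complex_hilbert_space set \<Rightarrow> bool" where
  "orthonormal_basis B \<longleftrightarrow>
    (\<forall>x\<in>B. \<forall>y\<in>B. cinner x y = (if x = y then 1 else 0)) \<and>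
    closure (span {scaleC c x |c x. x \<in> B}) = UNIV"

text \<open>The standard trace of a positive operator; the value does not depend on the basis.\<close>

definition Tr :: "('h::complex_hilbert_space \<Rightarrow>\<^sub>L 'h) \<Rightarrow> ennreal" where
  "Tr T = (\<Sum>\<^sub>\<infinity>e\<in>(SOME B. orthonormal_basis B). ennreal (Re (cinner (blinfun_apply T e) e)))"


section \<open>Traces\<close>

text \<open>
  \<open>A\<close> is a \<open>C\<^sup>*\<close>-algebra of operators on a Hilbert space. Only the values of \<open>\<tau>\<close> on the
  positive cone of \<open>A\<close> matter. In \<open>lower_semicontinuous\<close>, \<open>id_blinfun\<close> is the unit of the algebra
  of all bounded operators; for \<open>a\<close> in the positive cone, the positive part of \<open>a - \<epsilon>\<close> is again
  in that cone.
\<close>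

definition positive_cone :: "('h::complex_hilbert_space \<Rightarrow>\<^sub>L 'h) set \<Rightarrow> ('h \<Rightarrow>\<^sub>L 'h) set" where
  "positive_cone A = {a \<in> A. positive_op a}"

definition trace_on ::
    "('h::complex_hilbert_space \<Rightarrow>\<^sub>L 'h) set \<Rightarrow> (('h \<Rightarrow>\<^sub>L 'h) \<Rightarrow> ennreal) \<Rightarrow> bool" where
  "trace_on A \<tau> \<longleftrightarrow>
    (\<forall>a\<in>positive_cone A. \<forall>b\<in>positive_cone A. \<tau> (a + b) = \<tau> a + \<tau> b) \<and>
    (\<forall>a\<in>positive_cone A. \<forall>r\<ge>0. \<tau> (r *\<^sub>R a) = ennreal r * \<tau> a) \<and>
    (\<forall>x\<in>A. \<tau> (adjoint_op x o\<^sub>L x) = \<tau> (x o\<^sub>L adjoint_op x))"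

definition lower_semicontinuous ::
    "('h::complex_hilbert_space \<Rightarrow>\<^sub>L 'h) set \<Rightarrow> (('h \<Rightarrow>\<^sub>L 'h) \<Rightarrow> ennreal) \<Rightarrow> bool" where
  "lower_semicontinuous A \<tau> \<longleftrightarrow>
    (\<forall>a\<in>positive_cone A. \<tau> a = (SUP \<epsilon>\<in>{0<..}. \<tau> (positive_part (a - \<epsilon> *\<^sub>R id_blinfun))))"


section \<open>Reduced crossed products\<close>

definition diag_op ::
    "('g \<Rightarrow> ('h::complex_hilbert_space \<Rightarrow>\<^sub>L 'h)) \<Rightarrow> ('g, 'h) ell2 \<Rightarrow>\<^sub>L ('g, 'h) ell2" where
  "diag_op a = Blinfun (\<lambda>\<xi>. Ell2 (\<lambda>t. blinfun_apply (a t) (ell2_apply \<xi> t)))"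

definition shift_op ::
    "'g::group_add \<Rightarrow> ('g, 'h::complex_hilbert_space) ell2 \<Rightarrow>\<^sub>L ('g, 'h) ell2" where
  "shift_op s = Blinfun (\<lambda>\<xi>. Ell2 (\<lambda>t. ell2_apply \<xi> (- s + t)))"

lemma diag_op_apply:
  fixes a :: "'g \<Rightarrow> ('h::complex_hilbert_space \<Rightarrow>\<^sub>L 'h)"
  assumes "bounded (range a)"
  shows "ell2_apply (blinfun_apply (diag_op a) \<xi>) t = blinfun_apply (a t) (ell2_apply \<xi> t)"
proof -
  obtain C where C: "C > 0" "\<And>t. norm (a t) \<le> C"
    using assms by (auto simp: bounded_pos)
  have le: "norm (blinfun_apply (a t) x) \<le> C * norm x" for t x
    by (rule order.trans[OF norm_blinfun mult_right_mono[OF C(2)]]) simp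
  have sq: "square_summable (\<lambda>t. blinfun_apply (a t) (ell2_apply \<xi> t))" for \<xi>
    using le by (rule square_summable_bounded[OF square_summable_ell2])
  have "bounded_linear (\<lambda>\<xi>. Ell2 (\<lambda>t. blinfun_apply (a t) (ell2_apply \<xi> t)))"
  proof (rule bounded_linear_intro[where K = C])
    show "norm (Ell2 (\<lambda>t. blinfun_apply (a t) (ell2_apply \<xi> t))) \<le> norm \<xi> * C" for \<xi>
    proof (rule norm_ell2_le)
      fix F :: "'g set"
      assume F: "finite F"
      have "(norm (blinfun_apply (a t) (ell2_apply \<xi> t)))\<^sup>2 \<le> C\<^sup>2 * (norm (ell2_apply \<xi> t))\<^sup>2" for t
        using power_mono[OF le, of t "ell2_apply \<xi> t" 2] by (simp add: power_mult_distrib)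
      then have "(\<Sum>t\<in>F. (norm (blinfun_apply (a t) (ell2_apply \<xi> t)))\<^sup>2)
          \<le> C\<^sup>2 * (\<Sum>t\<in>F. (norm (ell2_apply \<xi> t))\<^sup>2)"
        by (simp add: sum_distrib_left sum_mono)
      also have "\<dots> \<le> C\<^sup>2 * (norm \<xi>)\<^sup>2"
        by (intro mult_left_mono sum_le_norm_ell2 F) simp
      finally show "(\<Sum>t\<in>F. (norm (ell2_apply (Ell2 (\<lambda>t. blinfun_apply (a t) (ell2_apply \<xi> t))) t))\<^sup>2)
          \<le> (norm \<xi> * C)\<^sup>2"
        by (simp add: Ell2_inverse sq power_mult_distrib mult.commute)
    qed (use C in simp)
  qed (auto intro!: ell2_eqI simp: Ell2_inverse sq square_summable_add square_summable_scaleR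
      plus_ell2.rep_eq scaleR_ell2.rep_eq blinfun.add_right blinfun.scaleR_right)
  then show ?thesis
    by (simp add: diag_op_def bounded_linear_Blinfun_apply Ell2_inverse sq)
qed

lemma shift_op_apply:
  fixes \<xi> :: "('g::group_add, 'h::complex_hilbert_space) ell2"
  shows "ell2_apply (blinfun_apply (shift_op s) \<xi>) t = ell2_apply \<xi> (- s + t)"
proof -
  have bij: "bij_betw (\<lambda>t. - s + t) UNIV UNIV"
    by (rule bij_betwI[where g = "\<lambda>t. s + t"]) (auto simp: add.assoc[symmetric])
  have sq: "square_summable (\<lambda>t. ell2_apply \<xi> (- s + t))" for \<xi> :: "('g, 'h) ell2"
    using square_summable_ell2[of \<xi>]
      summable_on_reindex_bij_betw[OF bij, of "\<lambda>t. (norm (ell2_apply \<xi> t))\<^sup>2"]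
    by (simp add: square_summable_def)
  have nrm: "norm (Ell2 (\<lambda>t. ell2_apply \<xi> (- s + t))) = norm \<xi>" for \<xi> :: "('g, 'h) ell2"
  proof -
    have "(norm (Ell2 (\<lambda>t. ell2_apply \<xi> (- s + t))))\<^sup>2 = (norm \<xi>)\<^sup>2"
      using infsum_reindex_bij_betw[OF bij, of "\<lambda>t. (norm (ell2_apply \<xi> t))\<^sup>2"]
      by (simp add: norm_ell2_square Ell2_inverse sq)
    then show ?thesis by simp
  qed
  have "bounded_linear (\<lambda>\<xi> :: ('g, 'h) ell2. Ell2 (\<lambda>t. ell2_apply \<xi> (- s + t)))"
    by (rule bounded_linear_intro[where K = 1])
      (auto intro!: ell2_eqI simp: Ell2_inverse sq square_summable_add square_summable_scaleR nrm
        plus_ell2.rep_eq scaleR_ell2.rep_eq)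
  then show ?thesis
    by (simp add: shift_op_def bounded_linear_Blinfun_apply Ell2_inverse sq)
qed

text \<open>
  \<open>A\<close> is a \<open>C\<^sup>*\<close>-algebra on which \<open>G\<close> acts by \<open>\<alpha>\<close>, and \<open>\<rho>\<close> is a faithful representation of \<open>A\<close>
  on a Hilbert space \<open>H\<close>. The regular representation on \<open>\<ell>\<^sup>2(G, H)\<close> is given by
  \<open>(\<pi>(a)\<xi>)(t) = \<rho>(\<alpha>\<^bsub>t\<^sup>-\<^sup>1\<^esub>(a)) \<xi>(t)\<close> and \<open>(\<lambda>\<^sub>s\<xi>)(t) = \<xi>(s\<^sup>-\<^sup>1t)\<close>, and the reduced crossed product is
  the norm closure of the set of all finite sums of elements \<open>\<pi>(a)\<lambda>\<^sub>s\<close>.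
\<close>

definition regular_rep ::
    "('a \<Rightarrow> ('h::complex_hilbert_space \<Rightarrow>\<^sub>L 'h)) \<Rightarrow> ('g::group_add \<Rightarrow> 'a \<Rightarrow> 'a) \<Rightarrow>
      'a \<Rightarrow> ('g, 'h) ell2 \<Rightarrow>\<^sub>L ('g, 'h) ell2" where
  "regular_rep \<rho> \<alpha> a = diag_op (\<lambda>t. \<rho> (\<alpha> (- t) a))"

definition reduced_crossed_product ::
    "'a set \<Rightarrow> ('a \<Rightarrow> ('h::complex_hilbert_space \<Rightarrow>\<^sub>L 'h)) \<Rightarrow> ('g::group_add \<Rightarrow> 'a \<Rightarrow> 'a) \<Rightarrow>
      (('g, 'h) ell2 \<Rightarrow>\<^sub>L ('g, 'h) ell2) set" where
  "reduced_crossed_product A \<rho> \<alpha> =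
    closure {\<Sum>s\<in>F. regular_rep \<rho> \<alpha> (a s) o\<^sub>L shift_op s |F a. finite F \<and> (\<forall>s\<in>F. a s \<in> A)}"


section \<open>The algebra \<open>\<ell>\<^sup>\<infinity>(G, K)\<close> and the Roe algebra\<close>

definition linf_compact :: "('g \<Rightarrow> ('h::complex_hilbert_space \<Rightarrow>\<^sub>L 'h)) set" where
  "linf_compact = {a. range a \<subseteq> compact_ops \<and> bounded (range a)}"

definition left_translate :: "'g::group_add \<Rightarrow> ('g \<Rightarrow> 'b) \<Rightarrow> 'g \<Rightarrow> 'b" where
  "left_translate s a = (\<lambda>t. a (- s + t))"

text \<open>
  The map \<open>diag_op\<close> is a faithful representation of \<open>\<ell>\<^sup>\<infinity>(G, K)\<close> on \<open>\<ell>\<^sup>2(G, H)\<close>. Traces on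
  \<open>\<ell>\<^sup>\<infinity>(G, K)\<close> are traces on its image under this representation, and the copy of
  \<open>\<ell>\<^sup>\<infinity>(G, K)\<close> inside the Roe algebra is its image under \<open>roe_embedding\<close>.
\<close>

definition linf_algebra ::
    "(('g, 'h::complex_hilbert_space) ell2 \<Rightarrow>\<^sub>L ('g, 'h) ell2) set" where
  "linf_algebra = diag_op ` linf_compact"

definition invariant_on_linf ::
    "((('g::group_add, 'h::complex_hilbert_space) ell2 \<Rightarrow>\<^sub>L ('g, 'h) ell2) \<Rightarrow> ennreal) \<Rightarrow> bool" where
  "invariant_on_linf \<tau> \<longleftrightarrow>
    (\<forall>s. \<forall>a\<in>linf_compact. positive_op (diag_op a) \<longrightarrow>
      \<tau> (diag_op (left_translate s a)) = \<tau> (diag_op a))"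

definition roe_algebra ::
    "(('g::group_add, ('g, 'h::complex_hilbert_space) ell2) ell2 \<Rightarrow>\<^sub>L ('g, ('g, 'h) ell2) ell2) set"
  where "roe_algebra = reduced_crossed_product linf_compact diag_op left_translate"

definition roe_embedding ::
    "('g::group_add \<Rightarrow> ('h::complex_hilbert_space \<Rightarrow>\<^sub>L 'h)) \<Rightarrow>
      ('g, ('g, 'h) ell2) ell2 \<Rightarrow>\<^sub>L ('g, ('g, 'h) ell2) ell2" where
  "roe_embedding = regular_rep diag_op left_translate"

definition linf_projection :: "('g \<Rightarrow> ('h::complex_hilbert_space \<Rightarrow>\<^sub>L 'h)) \<Rightarrow> bool" where
  "linf_projection p \<longleftrightarrow>
    p \<in> linf_compact \<and> (\<forall>t. p t o\<^sub>L p t = p t \<and> adjoint_op (p t) = p t)"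


section \<open>Subexponentially growing dimension\<close>

definition proper_length_function :: "('g::group_add \<Rightarrow> nat) \<Rightarrow> bool" where
  "proper_length_function l \<longleftrightarrow>
    (\<forall>t. l t = 0 \<longleftrightarrow> t = 0) \<and>
    (\<forall>s t. l (s + t) \<le> l s + l t) \<and>
    (\<forall>n. finite {t. l t \<le> n})"

definition max_dim ::
    "('g \<Rightarrow> nat) \<Rightarrow> ('g \<Rightarrow> ('h::complex_hilbert_space \<Rightarrow>\<^sub>L 'h)) \<Rightarrow> nat \<Rightarrow> ennreal" where
  "max_dim l p n = Max ((\<lambda>t. Tr (p t)) ` {t. l t \<le> n})"

text \<open>
  Compact projections have finite trace, so \<open>max_dim l p\<close> is finite, and it is positive for all
  large arguments. Hence the quotients below are quotients of positive real numbers for large \<open>n\<close>.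
\<close>

definition subexponentially_growing_dimension ::
    "('g::group_add \<Rightarrow> ('h::complex_hilbert_space \<Rightarrow>\<^sub>L 'h)) \<Rightarrow> bool" where
  "subexponentially_growing_dimension p \<longleftrightarrow>
    p \<noteq> (\<lambda>_. 0) \<and>
    (\<exists>l. proper_length_function l \<and>
      (\<forall>m. liminf (\<lambda>n. max_dim l p (n + m) / max_dim l p n) = 1))"


section \<open>The fixed-point property for cones\<close>

text \<open>
  A real Hausdorff locally convex space is given by a topology \<open>T\<close>, whose underlying set \<open>topspace T\<close>
  is the vector space, together with the vector space operations.
\<close>

locale locally_convex_space =
  fixes T :: "'v topology"
    and add :: "'v \<Rightarrow> 'v \<Rightarrow> 'v"
    and zero :: 'v
    and scale :: "real \<Rightarrow> 'v \<Rightarrow> 'v"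
  assumes add_closed: "\<lbrakk>x \<in> topspace T; y \<in> topspace T\<rbrakk> \<Longrightarrow> add x y \<in> topspace T"
    and zero_closed: "zero \<in> topspace T"
    and scale_closed: "x \<in> topspace T \<Longrightarrow> scale r x \<in> topspace T"
    and add_assoc: "\<lbrakk>x \<in> topspace T; y \<in> topspace T; z \<in> topspace T\<rbrakk>
      \<Longrightarrow> add (add x y) z = add x (add y z)"
    and add_commute: "\<lbrakk>x \<in> topspace T; y \<in> topspace T\<rbrakk> \<Longrightarrow> add x y = add y x"
    and add_zero: "x \<in> topspace T \<Longrightarrow> add x zero = x"
    and add_neg: "x \<in> topspace T \<Longrightarrow> add x (scale (- 1) x) = zero"
    and scale_add_right: "\<lbrakk>x \<in> topspace T; y \<in> topspace T\<rbrakk>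
      \<Longrightarrow> scale r (add x y) = add (scale r x) (scale r y)"
    and scale_add_left: "x \<in> topspace T \<Longrightarrow> scale (r + s) x = add (scale r x) (scale s x)"
    and scale_scale: "x \<in> topspace T \<Longrightarrow> scale r (scale s x) = scale (r * s) x"
    and scale_one: "x \<in> topspace T \<Longrightarrow> scale 1 x = x"
    and continuous_add: "continuous_map (prod_topology T T) T (\<lambda>(x, y). add x y)"
    and continuous_scale: "continuous_map (prod_topology euclideanreal T) T (\<lambda>(r, x). scale r x)"
    and Hausdorff: "Hausdorff_space T"
    and locally_convex: "\<lbrakk>openin T U; zero \<in> U\<rbrakk> \<Longrightarrow>
      \<exists>W. openin T W \<and> zero \<in> W \<and> W \<subseteq> U \<and>
        (\<forall>x\<in>W. \<forall>y\<in>W. \<forall>r. 0 \<le> r \<and> r \<le> 1 \<longrightarrow> add (scale (1 - r) x) (scale r y) \<in> W)"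
begin

definition linear_map :: "('v \<Rightarrow> 'v) \<Rightarrow> bool" where
  "linear_map f \<longleftrightarrow>
    (\<forall>x\<in>topspace T. \<forall>y\<in>topspace T. f (add x y) = add (f x) (f y)) \<and>
    (\<forall>r. \<forall>x\<in>topspace T. f (scale r x) = scale r (f x))"

text \<open>The continuous linear functionals. Their values outside the space are irrelevant.\<close>

definition dual :: "('v \<Rightarrow> real) set" where
  "dual = {\<phi>. continuous_map T euclideanreal \<phi> \<and>
    (\<forall>x\<in>topspace T. \<forall>y\<in>topspace T. \<phi> (add x y) = \<phi> x + \<phi> y) \<and>
    (\<forall>r. \<forall>x\<in>topspace T. \<phi> (scale r x) = r * \<phi> x)}"

definition bounded_set :: "'v set \<Rightarrow> bool" where
  "bounded_set M \<longleftrightarrow> (\<forall>U. openin T U \<and> zero \<in> U \<longrightarrow> (\<exists>r>0. M \<subseteq> scale r ` U))"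

definition convex_cone :: "'v set \<Rightarrow> bool" where
  "convex_cone C \<longleftrightarrow> C \<subseteq> topspace T \<and> zero \<in> C \<and>
    (\<forall>x\<in>C. \<forall>y\<in>C. add x y \<in> C) \<and> (\<forall>r\<ge>0. \<forall>x\<in>C. scale r x \<in> C)"

definition proper_cone :: "'v set \<Rightarrow> bool" where
  "proper_cone C \<longleftrightarrow> C \<inter> scale (- 1) ` C = {zero}"

text \<open>
  Nets in \<open>C\<close> are represented by the filters they generate: a net is Cauchy or convergent for the
  weak topology if and only if the filter of its tails is, and every proper filter containing \<open>C\<close>
  is the filter of tails of a net in \<open>C\<close>.
\<close>

definition weakly_Cauchy :: "'v filter \<Rightarrow> bool" where
  "weakly_Cauchy F \<longleftrightarrow>
    (\<forall>\<phi>\<in>dual. \<forall>e>0. \<forall>\<^sub>F (x, y) in F \<times>\<^sub>F F. \<bar>\<phi> x - \<phi> y\<bar> < e)"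

definition weakly_complete :: "'v set \<Rightarrow> bool" where
  "weakly_complete C \<longleftrightarrow>
    (\<forall>F. F \<noteq> bot \<and> F \<le> principal C \<and> weakly_Cauchy F \<longrightarrow>
      (\<exists>c\<in>C. \<forall>\<phi>\<in>dual. (\<phi> \<longlongrightarrow> \<phi> c) F))"

definition linear_action :: "('g::group_add \<Rightarrow> 'v \<Rightarrow> 'v) \<Rightarrow> bool" where
  "linear_action act \<longleftrightarrow>
    (\<forall>t. continuous_map T T (act t) \<and> linear_map (act t)) \<and>
    (\<forall>x\<in>topspace T. act 0 x = x) \<and>
    (\<forall>s t. \<forall>x\<in>topspace T. act (s + t) x = act s (act t x))"

text \<open>The action on the dual is \<open>(t.\<phi>)(x) = \<phi>(t\<^sup>-\<^sup>1.x)\<close>.\<close>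

definition cobounded_type :: "('g::group_add \<Rightarrow> 'v \<Rightarrow> 'v) \<Rightarrow> 'v set \<Rightarrow> bool" where
  "cobounded_type act C \<longleftrightarrow>
    (\<exists>\<phi>\<in>dual. (\<forall>c\<in>C. 0 \<le> \<phi> c) \<and>
      (\<forall>\<psi>\<in>dual. \<exists>ts. ts \<noteq> [] \<and> (\<forall>c\<in>C. \<psi> c \<le> (\<Sum>t\<leftarrow>ts. \<phi> (act (- t) c)))))"

definition locally_bounded :: "('g::group_add \<Rightarrow> 'v \<Rightarrow> 'v) \<Rightarrow> 'v set \<Rightarrow> bool" where
  "locally_bounded act C \<longleftrightarrow> (\<exists>c\<in>C. c \<noteq> zero \<and> bounded_set (range (\<lambda>t. act t c)))"

end

text \<open>
  The quantification over all spaces \<open>V\<close> needs a type that contains their elements, since HOL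
  has no quantification over types. The property \<open>fixed_point_property_for_cones TYPE('g) TYPE('v)\<close>
  is about all spaces whose underlying set is a subset of \<open>'v\<close>, with arbitrary operations and an
  arbitrary topology; up to isomorphism these are all spaces of cardinality at most that of \<open>'v\<close>.
  By Monod's theorem, the fixed-point property for cones follows from its instances for spaces of
  linear functionals on spaces of real functions on \<open>G\<close>, so \<open>('g \<Rightarrow> real) \<Rightarrow> real\<close> is large enough:
  for this choice of \<open>'v\<close> the property is equivalent to the one for all spaces.
\<close>

definition fixed_point_property_for_cones :: "'g::group_add itself \<Rightarrow> 'v itself \<Rightarrow> bool" where
  "fixed_point_property_for_cones _ _ \<longleftrightarrow>
    (\<forall>(T :: 'v topology) add zero scale (act :: 'g \<Rightarrow> 'v \<Rightarrow> 'v) C.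
      locally_convex_space T add zero scale \<and>
      locally_convex_space.linear_action T add scale act \<and>
      locally_convex_space.convex_cone T add zero scale C \<and>
      (\<forall>t. act t ` C \<subseteq> C) \<and>
      locally_convex_space.proper_cone zero scale C \<and>
      locally_convex_space.weakly_complete T add scale C \<and>
      locally_convex_space.cobounded_type T add scale act C \<and>
      locally_convex_space.locally_bounded T zero scale act C
      \<longrightarrow> (\<exists>c\<in>C. c \<noteq> zero \<and> (\<forall>t. act t c = c)))"

end

theory Submission
  imports Defs
begin

text \<open>
  Let \<open>f(t)\<close> be the dimension of \<open>p(t)\<close>, and let \<open>E\<close> be the space of all functions on \<open>G\<close> that are
  dominated by finite sums of left translates of \<open>f\<close>. Choose \<open>t\<^sub>k\<close> with
  \<open>f(t\<^sub>k) = \<alpha>\<^bsub>n\<^sub>k\<^esub>\<close> along a sequence with \<open>\<alpha>\<^bsub>n\<^sub>k+m\<^esub>/\<alpha>\<^bsub>n\<^sub>k\<^esub> \<rightarrow> 1\<close> for all \<open>m\<close>. A cluster point of the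
  functionals \<open>h \<mapsto> h(t\<^sub>k)/f(t\<^sub>k)\<close> has bounded orbit in the cone of positive functionals on \<open>E\<close>, so the
  fixed-point property yields an invariant positive functional \<open>c\<close> on \<open>E\<close> with \<open>c(f) = 1\<close>. By Riesz
  decomposition \<open>c\<close> extends additively to all functions \<open>G \<rightarrow> [0,\<infinity>]\<close>.

  The trace is \<open>\<tau>(a) = sup\<^bsub>\<epsilon>>0\<^esub> c(t \<mapsto> Tr((a(t) - \<epsilon>)\<^sub>+))\<close>, and on the Roe algebra it is composed with the
  conditional expectation. The variational formula \<open>Tr((A - \<epsilon>)\<^sub>+) = sup\<^bsub>S\<^esub> \<Sum>\<^bsub>e\<in>S\<^esub> (\<langle>Ae,e\<rangle> - \<epsilon>)\<close>, over
  finite orthonormal sets \<open>S\<close>, gives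
  \<open>Tr((A+B-2\<epsilon>)\<^sub>+) \<le> Tr((A-\<epsilon>)\<^sub>+) + Tr((B-\<epsilon>)\<^sub>+) \<le> Tr((A+B-\<epsilon>)\<^sub>+)\<close>, hence additivity, and lower
  semicontinuity only needs \<open>a - \<epsilon> \<le> (a - \<epsilon>)\<^sub>+ \<le> a\<close>. The trace property on the crossed product reduces
  to single matrix entries because its elements are norm limits of operators of finite propagation.
\<close>

section \<open>Orthogonal projections and square roots\<close>

text \<open>Already a |-> c(t |-> Tr(a(t))) is additive and invariant, but \<open>c\<close> comes
  from a fixed-point argument and nothing makes it respect increasing limits. So lower
  semicontinuity is unclear, and so is the trace property on the crossed product, where the diagonal
  of x^*x is an infinite sum over propagations. The cut at \<epsilon> cures both: it exhausts a from
  below by construction, and it swallows the tail of such a sum once the tail is below \<epsilon>,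
  so that finite additivity and invariance suffice.

  Counting elements of finite orthonormal sets replaces functional calculus for the cut-off trace;
  only square roots and positive parts have to be constructed, and these over the real inner
  product.

  The limit 1 of the growth ratios makes the cluster point at most 1 on every translate of f. This
  uniformity over G gives local boundedness, while the choice of E makes evaluation at f the
  functional that cobounded type asks for.\<close>

lemma nearest_point_in_closed_subspace:
  fixes M :: "'a::{real_inner, banach} set"
  assumes M: "subspace M" "closed M"
  shows "\<exists>u\<in>M. \<forall>y\<in>M. inner (x - u) y = 0"
proof -
  define d where "d = (INF y\<in>M. (norm (x - y))\<^sup>2)"
  have bdd: "bdd_below ((\<lambda>y. (norm (x - y))\<^sup>2) ` M)"
    by (intro bdd_belowI2[where m = 0]) simp
  have ne: "M \<noteq> {}"
    using subspace_0[OF M(1)] by blast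
  have d_le: "d \<le> (norm (x - y))\<^sup>2" if "y \<in> M" for y
    unfolding d_def using bdd that by (rule cINF_lower)
  have "\<exists>y\<in>M. (norm (x - y))\<^sup>2 < d + 1 / Suc n" for n
    unfolding d_def using cINF_less_iff[OF ne bdd] by (metis less_add_same_cancel1 of_nat_0_less_iff zero_less_Suc zero_less_divide_1_iff)
  then obtain y where y: "\<And>n. y n \<in> M" "\<And>n. (norm (x - y n))\<^sup>2 < d + 1 / Suc n"
    by metis
  \<comment> \<open>Parallelogram law: the midpoint lies in M, so its squared distance to x is at
    least d, which leaves only twice the excesses 1/(m+1) and 1/(n+1).\<close>
  have par: "(norm (y m - y n))\<^sup>2 \<le> 2 / Suc m + 2 / Suc n" for m n
  proof -
    have "(1/2) *\<^sub>R (y m + y n) \<in> M"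
      using y(1) M(1) by (simp add: subspace_add subspace_scale)
    from d_le[OF this] have "4 * d \<le> 4 * (norm (x - (1/2) *\<^sub>R (y m + y n)))\<^sup>2"
      by simp
    also have "\<dots> + (norm (y m - y n))\<^sup>2 = 2 * (norm (x - y m))\<^sup>2 + 2 * (norm (x - y n))\<^sup>2"
      unfolding power2_norm_eq_inner by (simp add: inner_simps inner_commute algebra_simps)
    finally show ?thesis
      using y(2)[of m] y(2)[of n] by simp
  qed
  have "Cauchy y"
  proof (rule CauchyI)
    fix e :: real
    assume e: "e > 0"
    obtain K where K: "inverse (real (Suc K)) < e\<^sup>2 / 4"
      using reals_Archimedean[of "e\<^sup>2 / 4"] e by auto
    have "norm (y m - y n) < e" if "m \<ge> K" "n \<ge> K" for m n
    proof -
      have "2 / real (Suc m) \<le> 2 / real (Suc K)" "2 / real (Suc n) \<le> 2 / real (Suc K)"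
        using that by (auto intro!: divide_left_mono)
      then have "(norm (y m - y n))\<^sup>2 < e\<^sup>2"
        using par[of m n] K by (simp add: inverse_eq_divide)
      then show ?thesis
        using e by (simp add: power2_less_imp_less)
    qed
    then show "\<exists>K. \<forall>m\<ge>K. \<forall>n\<ge>K. norm (y m - y n) < e" by blast
  qed
  then obtain u where u: "y \<longlonglongrightarrow> u"
    by (auto simp: Cauchy_convergent_iff convergent_def)
  have uM: "u \<in> M"
    using closed_sequentially[OF M(2) y(1) u] .
  have "(norm (x - u))\<^sup>2 \<le> d"
  proof (rule LIMSEQ_le)
    show "(\<lambda>n. (norm (x - y n))\<^sup>2) \<longlonglongrightarrow> (norm (x - u))\<^sup>2"
      by (intro tendsto_intros u)
    show "(\<lambda>n. d + 1 / Suc n) \<longlonglongrightarrow> d"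
      using tendsto_add[OF tendsto_const[of d] LIMSEQ_inverse_real_of_nat]
      by (simp add: inverse_eq_divide)
  qed (use y(2) less_imp_le in blast)
  then have min: "(norm (x - u))\<^sup>2 \<le> (norm (x - u - y))\<^sup>2" if "y \<in> M" for y
    using d_le[of "u + y"] subspace_add[OF M(1) uM that]
    by (simp add: diff_diff_eq del: norm_le_square) (metis order.trans power_mono_iff norm_ge_zero power2_le_imp_le)
  have "inner (x - u) w = 0" if w: "w \<in> M" for w
  proof (cases "w = 0")
    case False
    \<comment> \<open>The minimiser of the quadratic s |-> |x - u - s w|^2; a nonzero inner product
      would push it below the minimal distance.\<close>
    define s where "s = inner (x - u) w / (norm w)\<^sup>2"
    have "(norm (x - u))\<^sup>2 \<le> (norm (x - u - s *\<^sub>R w))\<^sup>2"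
      using w M(1) by (intro min) (simp add: subspace_scale)
    also have "\<dots> = (norm (x - u))\<^sup>2 - 2 * s * inner (x - u) w + s\<^sup>2 * (norm w)\<^sup>2"
      unfolding power2_norm_eq_inner
      by (simp add: inner_diff_left inner_diff_right inner_commute algebra_simps power2_eq_square)
    also have "\<dots> = (norm (x - u))\<^sup>2 - (inner (x - u) w)\<^sup>2 / (norm w)\<^sup>2"
      using False by (simp add: s_def power2_eq_square)
    finally have "(inner (x - u) w)\<^sup>2 / (norm w)\<^sup>2 \<le> 0" by simp
    then show ?thesis
      using False by (simp add: divide_le_0_iff)
  qed simp
  then show ?thesis
    using uM by blast
qed

lemma subspace_closure:
  fixes M :: "'a::real_normed_vector set"
  assumes M: "subspace M"
  shows "subspace (closure M)"
proof (rule subspaceI)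
  show "0 \<in> closure M"
    using subspace_0[OF M] closure_subset by blast
next
  fix x y assume "x \<in> closure M" "y \<in> closure M"
  then obtain f g where f: "\<And>n. f n \<in> M" "f \<longlonglongrightarrow> x" and g: "\<And>n. g n \<in> M" "g \<longlonglongrightarrow> y"
    by (auto simp: closure_sequential)
  then show "x + y \<in> closure M"
    unfolding closure_sequential using M
    by (intro exI[of _ "\<lambda>n. f n + g n"]) (auto intro: subspace_add tendsto_add)
next
  fix c :: real and x assume "x \<in> closure M"
  then obtain f where f: "\<And>n. f n \<in> M" "f \<longlonglongrightarrow> x"
    by (auto simp: closure_sequential)
  then show "c *\<^sub>R x \<in> closure M"
    unfolding closure_sequential using M
    by (intro exI[of _ "\<lambda>n. c *\<^sub>R f n"]) (auto intro: subspace_scale tendsto_scaleR)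
qed

lemma Riesz_representation:
  fixes f :: "'a::{real_inner, banach} \<Rightarrow> real"
  assumes f: "bounded_linear f"
  obtains z where "\<And>x. f x = inner z x"
proof (cases "\<forall>x. f x = 0")
  case True
  then show thesis using that[of 0] by simp
next
  case False
  then obtain x where x: "f x \<noteq> 0" by blast
  interpret f: bounded_linear f by fact
  have "subspace {x. f x = 0}"
    by (auto simp: subspace_def f.add f.scaleR f.zero)
  moreover have "closed {x. f x = 0}"
    by (intro closed_Collect_eq continuous_on_const)
      (simp add: f.continuous_on continuous_on_id)
  ultimately have "\<exists>u\<in>{x. f x = 0}. \<forall>y\<in>{x. f x = 0}. inner (x - u) y = 0"
    by (rule nearest_point_in_closed_subspace)
  then obtain u where u: "f u = 0" "\<And>y. f y = 0 \<Longrightarrow> inner (x - u) y = 0"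
    by auto
  define w where "w = x - u"
  have w: "f w = f x" "w \<noteq> 0"
    using u(1) x by (auto simp: w_def f.diff)
  have "f y = inner ((f w / (norm w)\<^sup>2) *\<^sub>R w) y" for y
  proof -
    have "f (y - (f y / f w) *\<^sub>R w) = 0"
      using w x by (simp add: f.diff f.scaleR)
    from u(2)[OF this] have "inner w y = f y / f w * (norm w)\<^sup>2"
      by (simp add: w_def[symmetric] inner_diff_right dot_square_norm)
    then show ?thesis
      using w x by (simp add: field_simps)
  qed
  then show thesis using that by blast
qed

text \<open>Over a real inner product a nonnegative form does not force symmetry, so both are
  demanded. Complex linearity is kept apart and recovered from commutation with multiplication by
  i.\<close>

definition psd :: "('a::real_inner \<Rightarrow>\<^sub>L 'a) \<Rightarrow> bool" where
  "psd a \<longleftrightarrow> (\<forall>x y. inner (a x) y = inner x (a y)) \<and> (\<forall>x. 0 \<le> inner (a x) x)"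

lemma blinfun_compose_assoc: "(a o\<^sub>L b) o\<^sub>L c = a o\<^sub>L (b o\<^sub>L c)"
  by (rule blinfun_eqI) simp

lemma psd_sym: "psd a \<Longrightarrow> inner (a x) y = inner x (a y)"
  and psd_nonneg: "psd a \<Longrightarrow> 0 \<le> inner (a x) x"
  by (auto simp: psd_def)

lemma psd_add: "psd a \<Longrightarrow> psd b \<Longrightarrow> psd (a + b)"
  by (auto simp: psd_def blinfun.add_left inner_add_left inner_add_right)

lemma psd_scaleR: "psd a \<Longrightarrow> 0 \<le> r \<Longrightarrow> psd (r *\<^sub>R a)"
  by (auto simp: psd_def blinfun.scaleR_left)

lemma psd_Cauchy_Schwarz:
  assumes a: "psd a"
  shows "(inner (a x) y)\<^sup>2 \<le> inner (a x) x * inner (a y) y"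
proof -
  let ?p = "inner (a x) x" and ?q = "inner (a x) y" and ?r = "inner (a y) y"
  have q: "inner (a y) x = ?q"
    using psd_sym[OF a, of y x] by (simp add: inner_commute)
  have form: "0 \<le> s\<^sup>2 * ?p + 2 * s * t * ?q + t\<^sup>2 * ?r" for s t
    using psd_nonneg[OF a, of "s *\<^sub>R x + t *\<^sub>R y"] q
    by (simp add: blinfun.add_right blinfun.scaleR_right inner_add_left inner_add_right
        power2_eq_square algebra_simps)
  show ?thesis
  proof (cases "?r = 0")
    case True
    have "?q = 0"
    proof (rule ccontr)
      assume q: "?q \<noteq> 0"
      \<comment> \<open>With \<open>?r\<close> equal to 0 the form is affine in t; this t gives it
        the value -1 at (1, t).\<close>
      define t where "t = - (?p + 1) / (2 * ?q)"
      have "2 * t * ?q = - (?p + 1)" using q by (simp add: t_def)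
      then show False
        using form[of 1 t] psd_nonneg[OF a, of x] True by simp
    qed
    then show ?thesis using True by simp
  next
    case False
    then have "?r > 0" using psd_nonneg[OF a, of y] by simp
    moreover have "0 \<le> ?r * (?p * ?r - ?q\<^sup>2)"
      using form[of ?r "- ?q"] by (simp add: power2_eq_square algebra_simps)
    ultimately show ?thesis
      by (simp add: zero_le_mult_iff)
  qed
qed

text \<open>Cauchy-Schwarz for the form of a at x and a x. The bound is asked for on the range of a
  only, because for a negative part nothing is known elsewhere.\<close>

lemma norm_psd_apply_le:
  assumes a: "psd a" and le: "\<And>y. inner (a (a y)) (a y) \<le> C * (norm (a y))\<^sup>2"
  shows "(norm (a x))\<^sup>2 \<le> C * inner (a x) x"
proof (cases "a x = 0")
  case False
  have "((norm (a x))\<^sup>2)\<^sup>2 = (inner (a x) (a x))\<^sup>2"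
    by (simp add: dot_square_norm)
  also have "\<dots> \<le> inner (a x) x * inner (a (a x)) (a x)"
    by (rule psd_Cauchy_Schwarz[OF a])
  also have "\<dots> \<le> inner (a x) x * (C * (norm (a x))\<^sup>2)"
    using le psd_nonneg[OF a] by (intro mult_left_mono)
  finally have "(norm (a x))\<^sup>2 * (norm (a x))\<^sup>2 \<le> (C * inner (a x) x) * (norm (a x))\<^sup>2"
    by (simp add: power2_eq_square algebra_simps)
  then show ?thesis
    using False by (subst (asm) mult_le_cancel_right) auto
qed simp

lemma psd_apply_eq_0: "psd a \<Longrightarrow> inner (a x) x = 0 \<Longrightarrow> a x = 0"
  using psd_Cauchy_Schwarz[of a x "a x"] by simp

text \<open>The square root is \<open>1 - u\<close>, where \<open>u\<close> is the limit of the iteration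
  \<open>u \<mapsto> (k + u\<^sup>2)/2\<close> with \<open>k = 1 - a\<close>; the scalar iteration for \<open>k = 1\<close> dominates it in norm.\<close>

lemma psd_sqrt_contraction:
  fixes a :: "'a::{real_inner, banach} \<Rightarrow>\<^sub>L 'a"
  assumes a: "psd a" and le: "\<And>x. inner (a x) x \<le> (norm x)\<^sup>2"
  obtains s where "psd s" "s o\<^sub>L s = a" "\<And>k. k o\<^sub>L a = a o\<^sub>L k \<Longrightarrow> k o\<^sub>L s = s o\<^sub>L k"
proof -
  interpret comp: bounded_bilinear "(o\<^sub>L) :: ('a \<Rightarrow>\<^sub>L 'a) \<Rightarrow> ('a \<Rightarrow>\<^sub>L 'a) \<Rightarrow> _"
    by (rule bounded_bilinear_blinfun_compose)
  define k where "k = id_blinfun - a"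
  have k: "psd k"
    using a le by (auto simp: psd_def k_def blinfun.diff_left inner_diff_left inner_diff_right
        dot_square_norm)
  have "norm (k x) \<le> 1 * norm x" for x
  proof (rule power2_le_imp_le)
    have 1: "inner (k y) y \<le> (norm y)\<^sup>2" for y
      using psd_nonneg[OF a, of y]
      by (simp add: k_def blinfun.diff_left inner_diff_left dot_square_norm)
    have "(norm (k x))\<^sup>2 \<le> 1 * inner (k x) x"
      by (rule norm_psd_apply_le[OF k]) (use 1 in simp)
    then show "(norm (k x))\<^sup>2 \<le> (1 * norm x)\<^sup>2"
      using 1[of x] by (simp only: mult_1)
  qed simp
  then have nk: "norm k \<le> 1"
    by (intro norm_blinfun_bound) auto
  define u where "u = rec_nat 0 (\<lambda>_ w. (1/2) *\<^sub>R (k + (w o\<^sub>L w)))"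
  define v :: "nat \<Rightarrow> real" where "v = rec_nat 0 (\<lambda>_ w. (1 + w\<^sup>2) / 2)"
  have u0: "u 0 = 0" and uS: "\<And>n. u (Suc n) = (1/2) *\<^sub>R (k + (u n o\<^sub>L u n))"
    and v0: "v 0 = 0" and vS: "\<And>n. v (Suc n) = (1 + (v n)\<^sup>2) / 2"
    by (simp_all add: u_def v_def)
  have v: "0 \<le> v n \<and> v n \<le> 1" for n
    by (induction n) (auto simp: v0 vS power_le_one)
  have v_mono: "v n \<le> v (Suc n)" for n
    using sum_squares_bound[of "v n" 1] by (simp add: vS)
  have nu: "norm (u n) \<le> v n" for n
  proof (induction n)
    case (Suc n)
    have "norm (u (Suc n)) \<le> (norm k + norm (u n o\<^sub>L u n)) / 2"
      using norm_triangle_ineq[of k "u n o\<^sub>L u n"] by (simp add: uS)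
    also have "norm (u n o\<^sub>L u n) \<le> norm (u n) * norm (u n)"
      by (rule norm_blinfun_compose)
    also have "\<dots> \<le> v n * v n"
      using Suc v by (intro mult_mono) auto
    finally show ?case
      using nk by (simp add: vS power2_eq_square)
  qed (simp add: u0 v0)
  have comm: "j o\<^sub>L u n = u n o\<^sub>L j" if "j o\<^sub>L k = k o\<^sub>L j" for j n
  proof (induction n)
    case (Suc n)
    have "j o\<^sub>L (u n o\<^sub>L u n) = (u n o\<^sub>L u n) o\<^sub>L j"
      using Suc by (metis blinfun_compose_assoc)
    then show ?case
      using that by (simp add: uS comp.scaleR_left comp.scaleR_right comp.add_left comp.add_right)
  qed (simp add: u0)
  have uk: "u m o\<^sub>L u n = u n o\<^sub>L u m" for m n
    by (intro comm[of "u m"] comm[of k, symmetric]) simp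
  have diff: "norm (u (Suc n) - u n) \<le> v (Suc n) - v n" for n
  proof (induction n)
    case 0
    then show ?case using nk by (simp add: u0 v0 uS vS)
  next
    case (Suc n)
    \<comment> \<open>The iterates commute, so the difference of their squares factors, exactly as
      for the scalar iteration.\<close>
    have "u (Suc (Suc n)) - u (Suc n) = (1/2) *\<^sub>R ((u (Suc n) - u n) o\<^sub>L (u (Suc n) + u n))"
    proof -
      have "(u (Suc n) - u n) o\<^sub>L (u (Suc n) + u n) =
          (u (Suc n) o\<^sub>L u (Suc n)) - (u n o\<^sub>L u n)"
        using uk[of "Suc n" n] by (simp only: comp.add_right comp.diff_left) simp
      then show ?thesis
        by (simp only: uS[of "Suc n"] uS[of n] flip: scaleR_diff_right) simp
    qed
    then have "norm (u (Suc (Suc n)) - u (Suc n)) \<le>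
        (norm (u (Suc n) - u n) * norm (u (Suc n) + u n)) / 2"
      using norm_blinfun_compose[of "u (Suc n) - u n" "u (Suc n) + u n"] by simp
    also have "\<dots> \<le> ((v (Suc n) - v n) * (v (Suc n) + v n)) / 2"
      using Suc nu[of n] nu[of "Suc n"] v_mono[of n] norm_triangle_ineq[of "u (Suc n)" "u n"]
      by (intro divide_right_mono mult_mono) auto
    also have "\<dots> = v (Suc (Suc n)) - v (Suc n)"
      by (simp add: vS[of "Suc n"] vS[of n] power2_eq_square field_simps)
    finally show ?case .
  qed
  have "summable (\<lambda>n. v (Suc n) - v n)"
  proof -
    have "convergent v"
    proof (rule Bseq_mono_convergent)
      show "Bseq v" using v by (intro BseqI'[of v 1]) auto
      show "\<forall>m n. m \<le> n \<longrightarrow> v m \<le> v n"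
        using lift_Suc_mono_le[of v] v_mono by blast
    qed
    then show ?thesis
      by (auto simp: convergent_def intro: telescope_summable)
  qed
  then have "summable (\<lambda>n. u (Suc n) - u n)"
    by (rule summable_comparison_test'[where N = 0]) (rule diff)
  then have "(\<lambda>n. \<Sum>i<n. u (Suc i) - u i) \<longlonglongrightarrow> (\<Sum>i. u (Suc i) - u i)"
    by (rule summable_LIMSEQ)
  then obtain w where w: "u \<longlonglongrightarrow> w"
    by (auto simp: sum_lessThan_telescope u0)
  have id_comp: "id_blinfun o\<^sub>L j = j" "j o\<^sub>L id_blinfun = j" for j :: "'a \<Rightarrow>\<^sub>L 'a"
    by (auto intro: blinfun_eqI)
  show thesis
  proof (rule that[of "id_blinfun - w"])
    have "(\<lambda>n. u (Suc n)) \<longlonglongrightarrow> (1/2) *\<^sub>R (k + (w o\<^sub>L w))"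
      unfolding uS by (intro tendsto_intros comp.tendsto w)
    \<comment> \<open>This fixed-point equation gives (1 - w)^2 = 1 - 2w + w^2 = 1 - k = a.\<close>
    then have "w = (1/2) *\<^sub>R (k + (w o\<^sub>L w))"
      using LIMSEQ_Suc[OF w] LIMSEQ_unique by blast
    then have "2 *\<^sub>R w = 2 *\<^sub>R ((1/2) *\<^sub>R (k + (w o\<^sub>L w)))"
      by (rule arg_cong)
    then have "w o\<^sub>L w = 2 *\<^sub>R w - k"
      by simp
    then have ww: "w (w x) = 2 *\<^sub>R w x - k x" for x
      by (metis blinfun_apply_blinfun_compose blinfun.diff_left blinfun.scaleR_left)
    show "(id_blinfun - w) o\<^sub>L (id_blinfun - w) = a"
      by (rule blinfun_eqI) (simp add: blinfun.diff_left blinfun.diff_right ww k_def scaleR_2)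

    have "inner (w x) y = inner x (w y)" for x y
    proof -
      have "inner (u n x) y = inner x (u n y)" for n x y
      proof (induction n arbitrary: x y)
        case (Suc n)
        then show ?case
          using psd_sym[OF k]
          by (simp add: uS blinfun.scaleR_left blinfun.add_left inner_add_left inner_add_right)
      qed (simp add: u0)
      then have "(\<lambda>n. inner (u n x) y) \<longlonglongrightarrow> inner x (w y)"
        by (auto intro!: tendsto_intros w)
      moreover have "(\<lambda>n. inner (u n x) y) \<longlonglongrightarrow> inner (w x) y"
        by (intro tendsto_intros w)
      ultimately show ?thesis by (rule LIMSEQ_unique[rotated])
    qed
    moreover have "0 \<le> inner ((id_blinfun - w) x) x" for x
    proof -
      have "norm w \<le> 1"
        using nu v by (intro LIMSEQ_le_const2[OF tendsto_norm[OF w]]) (meson order.trans)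
      then have "norm (w x) \<le> norm x"
        using norm_blinfun[of w x] mult_right_mono[of "norm w" 1 "norm x"] by simp
      then have "inner (w x) x \<le> norm x * norm x"
        using norm_cauchy_schwarz[of "w x" x] mult_right_mono[of "norm (w x)" "norm x" "norm x"]
        by simp
      then show ?thesis
        by (simp add: blinfun.diff_left inner_diff_left dot_square_norm power2_eq_square)
    qed
    ultimately show "psd (id_blinfun - w)"
      by (simp add: psd_def blinfun.diff_left inner_diff_left inner_diff_right)
    fix j assume "j o\<^sub>L a = a o\<^sub>L j"
    then have "j o\<^sub>L k = k o\<^sub>L j"
      by (simp add: k_def comp.diff_left comp.diff_right id_comp)
    then have "(\<lambda>n. j o\<^sub>L u n) = (\<lambda>n. u n o\<^sub>L j)"
      using comm by blast
    moreover have "(\<lambda>n. u n o\<^sub>L j) \<longlonglongrightarrow> (w o\<^sub>L j)"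
      by (intro comp.tendsto w tendsto_const)
    moreover have "(\<lambda>n. j o\<^sub>L u n) \<longlonglongrightarrow> (j o\<^sub>L w)"
      by (intro comp.tendsto w tendsto_const)
    ultimately have "j o\<^sub>L w = w o\<^sub>L j" using LIMSEQ_unique by metis
    then show "j o\<^sub>L (id_blinfun - w) = (id_blinfun - w) o\<^sub>L j"
      by (simp add: comp.diff_left comp.diff_right id_comp)
  qed
qed

lemma psd_sqrt:
  fixes a :: "'a::{real_inner, banach} \<Rightarrow>\<^sub>L 'a"
  assumes a: "psd a"
  obtains s where "psd s" "s o\<^sub>L s = a" "\<And>k. k o\<^sub>L a = a o\<^sub>L k \<Longrightarrow> k o\<^sub>L s = s o\<^sub>L k"
proof -
  interpret comp: bounded_bilinear "(o\<^sub>L) :: ('a \<Rightarrow>\<^sub>L 'a) \<Rightarrow> ('a \<Rightarrow>\<^sub>L 'a) \<Rightarrow> _"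
    by (rule bounded_bilinear_blinfun_compose)
  \<comment> \<open>The summand 1 keeps N positive when a = 0.\<close>
  define N where "N = norm a + 1"
  have N: "N > 0" by (simp add: N_def add_nonneg_pos)
  have "inner (((1/N) *\<^sub>R a) x) x \<le> (norm x)\<^sup>2" for x
  proof -
    have "inner (a x) x \<le> norm (a x) * norm x" by (rule norm_cauchy_schwarz)
    also have "\<dots> \<le> (N * norm x) * norm x"
      using norm_blinfun[of a x] by (intro mult_right_mono) (auto simp: N_def algebra_simps intro: order.trans)
    finally show ?thesis
      using N by (simp add: blinfun.scaleR_left field_simps power2_eq_square)
  qed
  with psd_scaleR[OF a] N obtain s where s: "psd s" "s o\<^sub>L s = (1/N) *\<^sub>R a"
    "\<And>k. k o\<^sub>L ((1/N) *\<^sub>R a) = ((1/N) *\<^sub>R a) o\<^sub>L k \<Longrightarrow> k o\<^sub>L s = s o\<^sub>L k"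
    using psd_sqrt_contraction[of "(1/N) *\<^sub>R a"] by (metis less_eq_real_def zero_le_divide_1_iff)
  show thesis
  proof (rule that[of "sqrt N *\<^sub>R s"])
    show "psd (sqrt N *\<^sub>R s)" using s(1) N by (intro psd_scaleR) auto
    show "sqrt N *\<^sub>R s o\<^sub>L sqrt N *\<^sub>R s = a"
      using s(2) N by (simp add: comp.scaleR_left comp.scaleR_right)
    fix k assume "k o\<^sub>L a = a o\<^sub>L k"
    then show "k o\<^sub>L (sqrt N *\<^sub>R s) = (sqrt N *\<^sub>R s) o\<^sub>L k"
      using s(3)[of k] by (simp add: comp.scaleR_left comp.scaleR_right)
  qed
qed

text \<open>Commuting roots satisfy (s + t)(s - t) = 0. At y = (s - t) x the two nonnegative forms
  add up to 0, so s and t both kill y, and then y is orthogonal to itself.\<close>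

lemma psd_sqrt_unique:
  fixes s t :: "'a::{real_inner, banach} \<Rightarrow>\<^sub>L 'a"
  assumes s: "psd s" and t: "psd t" and eq: "s o\<^sub>L s = t o\<^sub>L t"
    and comm: "s o\<^sub>L t = t o\<^sub>L s"
  shows "s = t"
proof (rule blinfun_eqI)
  fix x
  define y where "y = s x - t x"
  have app: "s (s z) = t (t z)" "s (t z) = t (s z)" for z
    using eq comm by (metis blinfun_apply_blinfun_compose)+
  have "s y + t y = 0"
    by (simp add: y_def blinfun.diff_right app)
  then have "inner (s y) y + inner (t y) y = 0"
    by (metis inner_add_left inner_zero_left)
  then have "s y = 0" "t y = 0"
    using psd_nonneg[OF s, of y] psd_nonneg[OF t, of y]
    by (auto intro!: psd_apply_eq_0 s t)
  then have "inner (y) (s x - t x) = 0"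
    by (simp add: inner_diff_right flip: psd_sym[OF s] psd_sym[OF t])
  then show "s x = t x" by (simp add: y_def)
qed

text \<open>With s the square root of b^2, the parts are (s + b)/2 and (s - b)/2. The clause on
  commuting k later transfers complex linearity, and the clause on c' and d' is what the definite
  description in \<open>positive_part\<close> needs.\<close>

lemma positive_part_exists:
  fixes b :: "'a::{real_inner, banach} \<Rightarrow>\<^sub>L 'a"
  assumes b: "\<And>x y. inner (b x) y = inner x (b y)"
  shows "\<exists>c d. psd c \<and> psd d \<and> b = c - d \<and> c o\<^sub>L d = 0 \<and>
    (\<forall>k. k o\<^sub>L b = b o\<^sub>L k \<longrightarrow> k o\<^sub>L c = c o\<^sub>L k \<and> k o\<^sub>L d = d o\<^sub>L k) \<and>
    (\<forall>c' d'. psd c' \<longrightarrow> psd d' \<longrightarrow> b = c' - d' \<longrightarrow> c' o\<^sub>L d' = 0 \<longrightarrow> c' = c)"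
proof -
  interpret comp: bounded_bilinear "(o\<^sub>L) :: ('a \<Rightarrow>\<^sub>L 'a) \<Rightarrow> ('a \<Rightarrow>\<^sub>L 'a) \<Rightarrow> _"
    by (rule bounded_bilinear_blinfun_compose)
  have "psd (b o\<^sub>L b)" by (simp add: psd_def b flip: b) (metis b inner_ge_zero)
  then obtain s where s: "psd s" "s o\<^sub>L s = b o\<^sub>L b"
    "\<And>k. k o\<^sub>L (b o\<^sub>L b) = (b o\<^sub>L b) o\<^sub>L k \<Longrightarrow> k o\<^sub>L s = s o\<^sub>L k"
    using psd_sqrt by blast
  have sb: "s (b x) = b (s x)" and ss: "s (s x) = b (b x)" for x
    using s(2) s(3)[of b] by (metis blinfun_apply_blinfun_compose blinfun_compose_assoc)+
  have pos: "psd (s + r *\<^sub>R b)" if r: "r * r = 1" for r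
  proof -
    define c where "c = s + r *\<^sub>R b"
    have c: "c x = s x + r *\<^sub>R b x" for x
      by (simp add: c_def blinfun.add_left blinfun.scaleR_left)
    have sym: "inner (c x) y = inner x (c y)" for x y
      by (simp add: c inner_add_left inner_add_right b psd_sym[OF s(1)])
    \<comment> \<open>On its range c acts as 2s, so its form is nonnegative there.\<close>
    have cc: "c (c x) = 2 *\<^sub>R s (c x)" for x
    proof -
      have "c (c x) = (s (s x) + r *\<^sub>R s (b x)) + (r *\<^sub>R b (s x) + (r * r) *\<^sub>R b (b x))"
        by (simp only: c blinfun.add_right blinfun.scaleR_right scaleR_add_right scaleR_scaleR)
          (simp add: blinfun.add_right)
      also have "\<dots> = 2 *\<^sub>R s (s x) + 2 *\<^sub>R (r *\<^sub>R s (b x))"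
        unfolding r sb[symmetric] ss[symmetric] scaleR_2 by simp
      finally show ?thesis
        by (simp only: c blinfun.add_right blinfun.scaleR_right scaleR_add_right)
    qed
    have "0 \<le> inner (c x) x" for x
    proof -
      \<comment> \<open>x is split along the closed range of c; the remainder is orthogonal to the
        range and therefore killed by the symmetric operator c.\<close>
      let ?M = "closure (range (blinfun_apply c))"
      have "subspace ?M"
        by (intro subspace_closure linear_subspace_image subspace_UNIV)
          (simp add: blinfun.bounded_linear_right bounded_linear.linear)
      then have "\<exists>u\<in>?M. \<forall>y\<in>?M. inner (x - u) y = 0"
        by (rule nearest_point_in_closed_subspace[OF _ closed_closure])
      then obtain u where u: "u \<in> ?M" "\<And>y. y \<in> ?M \<Longrightarrow> inner (x - u) y = 0"
        by blast
      have "inner (c (x - u)) y = 0" for y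
        using u(2)[of "c y"] closure_subset[of "range (blinfun_apply c)"] by (auto simp: sym)
      then have "c (x - u) = 0"
        by (metis inner_eq_zero_iff)
      then have cx: "c x = c u" by (simp add: blinfun.diff_right)
      have "inner (c x) x = inner (c u) u"
        by (metis cx inner_commute sym)
      moreover have "u \<in> {y. 0 \<le> inner (c y) y}"
      proof -
        have "range (blinfun_apply c) \<subseteq> {y. 0 \<le> inner (c y) y}"
          using psd_nonneg[OF s(1)] cc by auto
        moreover have "closed {y. 0 \<le> inner (c y) y}"
          by (intro closed_Collect_le continuous_intros)
        ultimately show ?thesis
          using u(1) closure_minimal by blast
      qed
      ultimately show ?thesis by simp
    qed
    with sym show ?thesis by (simp add: psd_def c_def)
  qed
  define c where "c = (1/2) *\<^sub>R (s + 1 *\<^sub>R b)"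
  define d where "d = (1/2) *\<^sub>R (s + (-1) *\<^sub>R b)"
  show ?thesis
  proof (rule exI[of _ c], rule exI[of _ d], intro conjI allI impI)
    show "psd c" "psd d"
      unfolding c_def d_def by (intro psd_scaleR pos; simp)+
    show "b = c - d"
      by (simp add: c_def d_def algebra_simps flip: scaleR_add_left)
    show "c o\<^sub>L d = 0"
      by (rule blinfun_eqI) (simp add: c_def d_def blinfun.scaleR_left blinfun.add_left
          blinfun.add_right blinfun.scaleR_right blinfun.diff_left blinfun.diff_right sb ss)
    fix k assume k: "k o\<^sub>L b = b o\<^sub>L k"
    then have ks: "k o\<^sub>L s = s o\<^sub>L k"
      by (intro s(3)) (metis blinfun_compose_assoc)
    show "k o\<^sub>L c = c o\<^sub>L k" "k o\<^sub>L d = d o\<^sub>L k"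
      using k ks by (simp_all add: c_def d_def comp.scaleR_left comp.scaleR_right comp.add_left
          comp.add_right comp.diff_left comp.diff_right)
  next
    fix c' d' assume *: "psd c'" "psd d'" "b = c' - d'" "c' o\<^sub>L d' = 0"
    have cd: "c' (d' x) = 0" for x
      using *(4) by (metis blinfun_apply_blinfun_compose blinfun.zero_left)
    \<comment> \<open>Adjoint of the relation c' d' = 0; together they give (c' + d')^2 =
      b^2.\<close>
    have dc: "d' (c' x) = 0" for x
    proof -
      have "inner (d' (c' x)) y = 0" for y
        by (simp add: psd_sym[OF *(2)] psd_sym[OF *(1)] cd)
      then show ?thesis by (metis inner_eq_zero_iff)
    qed
    have sq: "(c' + d') o\<^sub>L (c' + d') = b o\<^sub>L b"
      by (rule blinfun_eqI) (simp add: *(3) blinfun.add_left blinfun.add_right blinfun.diff_left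
          blinfun.diff_right cd dc)
    have "s = c' + d'"
    proof (rule psd_sqrt_unique)
      show "s o\<^sub>L (c' + d') = (c' + d') o\<^sub>L s"
        unfolding sq[symmetric] by (intro s(3)[symmetric]) (simp only: sq[symmetric] blinfun_compose_assoc)
      show "s o\<^sub>L s = (c' + d') o\<^sub>L (c' + d')"
        by (simp only: sq s(2))
    qed (intro s(1) psd_add *(1,2))+
    then show "c' = c"
      by (simp add: c_def *(3) flip: scaleR_2)
  qed
qed

section \<open>Orthonormal families\<close>

lemma cinner_add_right: "cinner x (y + z) = cinner x y + cinner x z"
  for x :: "'a::complex_hilbert_space"
  by (metis cinner_add_left cinner_commute complex_cnj_add)

lemma cinner_scaleC_right: "cinner x (scaleC c y) = cnj c * cinner x y"
  for x :: "'a::complex_hilbert_space"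
  by (metis cinner_scaleC_left cinner_commute complex_cnj_mult)

interpretation cinner: bounded_bilinear "cinner :: 'a::complex_hilbert_space \<Rightarrow> 'a \<Rightarrow> complex"
proof
  fix x y z :: 'a and r :: real
  show "cinner (r *\<^sub>R x) y = r *\<^sub>R cinner x y" "cinner x (r *\<^sub>R y) = r *\<^sub>R cinner x y"
    unfolding scaleC_of_real[symmetric]
    by (simp_all add: cinner_scaleC_left cinner_scaleC_right scaleR_conv_of_real)
  show "\<exists>K. \<forall>a b :: 'a. cmod (cinner a b) \<le> norm a * norm b * K"
    by (rule exI[of _ 1]) (simp add: cmod_cinner_le)
qed (rule cinner_add_left cinner_add_right)+

interpretation scaleC: bounded_bilinear "scaleC :: complex \<Rightarrow> 'a::complex_hilbert_space \<Rightarrow> 'a"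
proof
  fix a :: complex and b :: 'a and r :: real
  show "scaleC (r *\<^sub>R a) b = r *\<^sub>R scaleC a b" "scaleC a (r *\<^sub>R b) = r *\<^sub>R scaleC a b"
    unfolding scaleC_of_real[symmetric] scaleR_conv_of_real
    by (simp_all add: scaleC_scaleC mult.commute)
  show "\<exists>K. \<forall>a (b :: 'a). norm (scaleC a b) \<le> norm a * norm b * K"
    by (rule exI[of _ 1]) (simp add: norm_scaleC)
qed (rule scaleC_add_left scaleC_add_right)+

lemma scaleC_one [simp]: "scaleC 1 x = x" for x :: "'a::complex_hilbert_space"
  using scaleC_of_real[of 1 x] by simp

definition orthonormal :: "'h::complex_hilbert_space set \<Rightarrow> bool" where
  "orthonormal S \<longleftrightarrow> (\<forall>x\<in>S. \<forall>y\<in>S. cinner x y = (if x = y then 1 else 0))"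

text \<open>Orthogonal projection onto the span of a finite orthonormal U. The equation
  \<open>ortho_proj U v = v\<close> is how membership of v in that span is expressed
  throughout.\<close>

definition ortho_proj :: "'h::complex_hilbert_space set \<Rightarrow> 'h \<Rightarrow> 'h" where
  "ortho_proj U v = (\<Sum>u\<in>U. scaleC (cinner v u) u)"

lemma orthonormalD: "orthonormal S \<Longrightarrow> x \<in> S \<Longrightarrow> y \<in> S \<Longrightarrow> cinner x y = (if x = y then 1 else 0)"
  by (auto simp: orthonormal_def)

lemma orthonormal_norm: "orthonormal S \<Longrightarrow> x \<in> S \<Longrightarrow> norm x = 1"
  using orthonormalD[of S x x] by (simp add: cinner_self abs_square_eq_1 flip: of_real_power)

lemma orthonormal_subset: "orthonormal S \<Longrightarrow> T \<subseteq> S \<Longrightarrow> orthonormal T"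
  unfolding orthonormal_def by blast

lemma orthonormal_empty: "orthonormal {}"
  by (simp add: orthonormal_def)

lemma cinner_ortho_proj:
  assumes "finite U" "orthonormal U" "u \<in> U"
  shows "cinner (ortho_proj U v) u = cinner v u"
proof -
  have "cinner (ortho_proj U v) u = (\<Sum>w\<in>U. cinner v w * (if w = u then 1 else 0))"
    unfolding ortho_proj_def cinner.sum_left cinner_scaleC_left
    using assms by (intro sum.cong) (auto simp: orthonormalD)
  also have "\<dots> = cinner v u"
    using assms by (simp add: if_distrib[of "(*) _"] sum.delta cong: if_cong)
  finally show ?thesis .
qed

text \<open>Pythagoras; Bessel's inequality and the finite Parseval identity are read off from
  it.\<close>

lemma norm_diff_ortho_proj:
  assumes U: "finite U" "orthonormal U"
  shows "(norm (v - ortho_proj U v))\<^sup>2 = (norm v)\<^sup>2 - (\<Sum>u\<in>U. (cmod (cinner v u))\<^sup>2)"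
proof -
  have 1: "cinner x (ortho_proj U v) = (\<Sum>u\<in>U. cnj (cinner v u) * cinner x u)" for x
    unfolding ortho_proj_def by (simp add: cinner.sum_right cinner_scaleC_right)
  have 2: "cinner v (ortho_proj U v) = complex_of_real (\<Sum>u\<in>U. (cmod (cinner v u))\<^sup>2)"
    unfolding 1 of_real_sum
    by (intro sum.cong) (simp_all add: complex_norm_square mult.commute del: of_real_power)
  have 3: "cinner (ortho_proj U v) (ortho_proj U v) = cinner v (ortho_proj U v)"
    unfolding 1 using U by (intro sum.cong) (simp_all add: cinner_ortho_proj)
  have 4: "cinner (ortho_proj U v) v = complex_of_real (\<Sum>u\<in>U. (cmod (cinner v u))\<^sup>2)"
    using 2 by (subst cinner_commute) simp
  have "complex_of_real ((norm (v - ortho_proj U v))\<^sup>2) =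
      complex_of_real ((norm v)\<^sup>2 - (\<Sum>u\<in>U. (cmod (cinner v u))\<^sup>2))"
    unfolding cinner_self[symmetric] of_real_diff
    by (simp add: cinner.diff_left cinner.diff_right 2 3 4 del: of_real_sum)
  then show ?thesis by (simp only: of_real_eq_iff)
qed

lemma Bessel_inequality:
  "finite U \<Longrightarrow> orthonormal U \<Longrightarrow> (\<Sum>u\<in>U. (cmod (cinner v u))\<^sup>2) \<le> (norm v)\<^sup>2"
  using norm_diff_ortho_proj[of U v] zero_le_power2[of "norm (v - ortho_proj U v)"] by linarith

lemma Parseval_finite:
  "finite U \<Longrightarrow> orthonormal U \<Longrightarrow> ortho_proj U v = v \<Longrightarrow>
    (norm v)\<^sup>2 = (\<Sum>u\<in>U. (cmod (cinner v u))\<^sup>2)"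
  using norm_diff_ortho_proj[of U v] by simp

lemma ortho_proj_superset:
  assumes "finite W" "orthonormal W" "U \<subseteq> W" "ortho_proj U v = v"
  shows "ortho_proj W v = v"
proof -
  have "cinner v w = 0" if "w \<in> W - U" for w
  proof -
    have "cinner (ortho_proj U v) w = 0"
      unfolding ortho_proj_def cinner.sum_left cinner_scaleC_left
    proof (intro sum.neutral ballI)
      fix u assume "u \<in> U"
      then have "cinner u w = 0"
        using assms(2,3) that orthonormalD[of W u w] by auto
      then show "cinner v u * cinner u w = 0" by simp
    qed
    then show ?thesis by (simp add: assms(4))
  qed
  then have "ortho_proj W v = ortho_proj U v"
    unfolding ortho_proj_def using assms(1,3) by (intro sum.mono_neutral_right) (auto simp: scaleC.zero_left)
  then show ?thesis by (simp add: assms(4))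
qed

section \<open>Gram-Schmidt orthogonalisation and orthonormal bases\<close>

lemma orthonormal_insert:
  assumes "orthonormal U" "norm w = 1" "\<And>u. u \<in> U \<Longrightarrow> cinner w u = 0"
  shows "orthonormal (insert w U)"
proof -
  have "cinner u w = 0" if "u \<in> U" for u
    using assms(3)[OF that] by (subst cinner_commute) simp
  moreover have "cinner w w = 1" using assms(2) by (simp add: cinner_self)
  ultimately show ?thesis
    using assms(1,3) by (auto simp: orthonormal_def)
qed

lemma orthonormal_extend:
  assumes U: "finite U" "orthonormal U" and v: "ortho_proj U v \<noteq> v"
  defines "w \<equiv> (1 / norm (v - ortho_proj U v)) *\<^sub>R (v - ortho_proj U v)"
  shows "w \<notin> U" "orthonormal (insert w U)" "ortho_proj (insert w U) v = v"
proof -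
  define z where "z = v - ortho_proj U v"
  have z: "z \<noteq> 0" using v by (simp add: z_def)
  have w: "w = (1 / norm z) *\<^sub>R z" by (simp add: w_def z_def)
  have zu: "cinner z u = 0" if "u \<in> U" for u
    using cinner_ortho_proj[OF U that] by (simp add: z_def cinner.diff_left)
  have wu: "cinner w u = 0" if "u \<in> U" for u
    using zu[OF that] by (simp add: w cinner.scaleR_left)
  have nw: "norm w = 1" using z by (simp add: w)
  show wU: "w \<notin> U" using wu[of w] nw by (auto simp: cinner_self)
  show "orthonormal (insert w U)"
    using U nw wu by (intro orthonormal_insert)
  have "cinner v z = cinner z z + cinner (ortho_proj U v) z"
    by (simp add: z_def cinner.diff_left)
  also have "cinner (ortho_proj U v) z = 0"
    unfolding ortho_proj_def cinner.sum_left cinner_scaleC_left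
    by (intro sum.neutral ballI) (metis zu cinner_commute complex_cnj_zero mult_zero_right)
  finally have vz: "cinner v z = complex_of_real ((norm z)\<^sup>2)"
    by (simp add: cinner_self)
  have "scaleC (cinner v w) w = (norm z * (1 / norm z)) *\<^sub>R z"
    using z unfolding w
    by (simp add: cinner.scaleR_right vz scaleC.scaleR_right scaleC_of_real scaleR_conv_of_real
        power2_eq_square flip: of_real_mult of_real_divide)
  also have "\<dots> = z" using z by simp
  finally have "ortho_proj (insert w U) v = z + ortho_proj U v"
    using wU U(1) by (simp add: ortho_proj_def)
  then show "ortho_proj (insert w U) v = v" by (simp add: z_def)
qed

text \<open>Each vector of A enlarges the orthonormal set by at most one element. The count matters
  because every element of an orthonormal set costs one \<epsilon> in the cut-off trace.\<close>

lemma Gram_Schmidt: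
  assumes U: "finite U" "orthonormal U" and A: "finite A"
  obtains W where "finite W" "orthonormal W" "U \<subseteq> W" "card W \<le> card U + card A"
    "\<And>v. v \<in> A \<Longrightarrow> ortho_proj W v = v"
proof -
  have "\<exists>W. finite W \<and> orthonormal W \<and> U \<subseteq> W \<and> card W \<le> card U + card A \<and>
      (\<forall>v\<in>A. ortho_proj W v = v)"
    using A
  proof (induction A rule: finite_induct)
    case empty
    then show ?case using U by auto
  next
    case (insert a A)
    then obtain W where W: "finite W" "orthonormal W" "U \<subseteq> W" "card W \<le> card U + card A"
      "\<And>v. v \<in> A \<Longrightarrow> ortho_proj W v = v"
      by blast
    show ?case
    proof (cases "ortho_proj W a = a")
      case True
      then show ?thesis using W insert by (intro exI[of _ W]) auto
    next
      case False
      note ext = orthonormal_extend[OF W(1,2) False]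
      let ?W = "Set.insert ((1 / norm (a - ortho_proj W a)) *\<^sub>R (a - ortho_proj W a)) W"
      have "ortho_proj ?W v = v" if "v \<in> A" for v
        using ext(2) W(1) W(5)[OF that] by (intro ortho_proj_superset[of ?W W]) auto
      then show ?thesis
        using W ext insert by (intro exI[of _ ?W]) auto
    qed
  qed
  then show thesis using that by blast
qed

text \<open>\<open>Tr\<close> picks its basis by \<open>SOME\<close>, so existence must be known
  before any value can be computed. A maximal orthonormal set works: a vector outside its closed
  span would yield a unit vector orthogonal to it.\<close>

lemma orthonormal_basis_exists: "\<exists>B :: 'h::complex_hilbert_space set. orthonormal_basis B"
proof -
  have "\<exists>B\<in>{S :: 'h set. orthonormal S}. \<forall>X\<in>{S. orthonormal S}. B \<subseteq> X \<longrightarrow> X = B"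
  proof (rule subset_Zorn')
    fix C :: "'h set set"
    assume C: "subset.chain {S. orthonormal S} C"
    have "cinner x y = (if x = y then 1 else 0)" if xy: "x \<in> \<Union>C" "y \<in> \<Union>C" for x y
    proof -
      obtain X Y where XY: "X \<in> C" "x \<in> X" "Y \<in> C" "y \<in> Y" using xy by blast
      then have "X \<subseteq> Y \<or> Y \<subseteq> X"
        using C by (auto simp: subset.chain_def)
      then obtain Z where "Z \<in> C" "x \<in> Z" "y \<in> Z" using XY by blast
      moreover from this have "orthonormal Z"
        using C by (auto simp: subset.chain_def)
      ultimately show ?thesis by (simp add: orthonormalD)
    qed
    then show "\<Union>C \<in> {S. orthonormal S}"
      by (auto simp: orthonormal_def)
  qed
  then obtain B :: "'h set" where B: "orthonormal B" "\<And>X. orthonormal X \<Longrightarrow> B \<subseteq> X \<Longrightarrow> X = B"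
    by auto
  let ?M = "closure (span {scaleC c x |c x. x \<in> B})"
  have "v \<in> ?M" for v
  proof (rule ccontr)
    assume v: "v \<notin> ?M"
    have "\<exists>u\<in>?M. \<forall>y\<in>?M. inner (v - u) y = 0"
      by (intro nearest_point_in_closed_subspace subspace_closure subspace_span closed_closure)
    then obtain u where u: "u \<in> ?M" "\<And>y. y \<in> ?M \<Longrightarrow> inner (v - u) y = 0" by blast
    define z where "z = v - u"
    have z: "z \<noteq> 0" using v u(1) by (auto simp: z_def)
    have zc: "Re (cinner z (scaleC c b)) = 0" if "b \<in> B" for b c
    proof -
      have "scaleC c b \<in> ?M"
        using that by (intro subsetD[OF closure_subset] span_base) blast
      then show ?thesis using u(2) by (simp add: Re_cinner z_def)
    qed
    \<comment> \<open>Only real parts are known to vanish; the multiples b and i b give both parts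
      of the complex product.\<close>
    have zb: "cinner z b = 0" if "b \<in> B" for b
      using zc[OF that, of 1] zc[OF that, of \<i>] by (simp add: cinner_scaleC_right complex_eq_iff)
    define w where "w = (1 / norm z) *\<^sub>R z"
    have w: "norm w = 1" "\<And>b. b \<in> B \<Longrightarrow> cinner w b = 0"
      using z zb by (simp_all add: w_def cinner.scaleR_left)
    have "insert w B = B"
      by (intro B(2) orthonormal_insert B(1) w) auto
    then show False using w(2)[of w] w(1) by (auto simp: cinner_self)
  qed
  then show ?thesis
    using B(1) by (intro exI[of _ B]) (auto simp: orthonormal_basis_def orthonormal_def)
qed

lemma Parseval:
  assumes B: "orthonormal_basis B"
  shows "((\<lambda>b. (cmod (cinner v b))\<^sup>2) has_sum (norm v)\<^sup>2) B"
proof -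
  let ?f = "\<lambda>b. (cmod (cinner v b))\<^sup>2"
  have oB: "orthonormal B" using B by (simp add: orthonormal_basis_def orthonormal_def)
  have le: "sum ?f F \<le> (norm v)\<^sup>2" if "finite F" "F \<subseteq> B" for F
    by (rule Bessel_inequality[OF that(1) orthonormal_subset[OF oB that(2)]])
  have bdd: "bdd_above (sum ?f ` {F. F \<subseteq> B \<and> finite F})"
    using le by (intro bdd_aboveI2[where M = "(norm v)\<^sup>2"]) auto
  define y where "y = (SUP F\<in>{F. finite F \<and> F \<subseteq> B}. sum ?f F)"
  have hs: "(?f has_sum y) B"
    unfolding y_def using bdd by (intro nonneg_bdd_above_has_sum) auto
  have y: "sum ?f F \<le> y" if "F \<in> {F. finite F \<and> F \<subseteq> B}" for F
    unfolding y_def using that bdd by (intro cSUP_upper) (auto simp: conj_commute)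
  have "y = (norm v)\<^sup>2"
  proof (rule antisym)
    show "y \<le> (norm v)\<^sup>2"
      unfolding y_def using le by (intro cSUP_least) auto
    show "(norm v)\<^sup>2 \<le> y"
    proof (rule field_le_epsilon)
      fix e :: real assume e: "e > 0"
      have "v \<in> closure (span {scaleC c x |c x. x \<in> B})"
        using B by (simp add: orthonormal_basis_def)
      then obtain z where z: "z \<in> span {scaleC c x |c x. x \<in> B}" "dist z v < sqrt e"
        using e by (meson closure_approachable real_sqrt_gt_zero)
      have "\<exists>F. finite F \<and> F \<subseteq> B \<and> ortho_proj F z = z"
        using z(1)
      proof (induction rule: span_induct_alt)
        case base
        show ?case by (intro exI[of _ "{}"]) (simp add: ortho_proj_def)
      next
        case (step r a y)
        then obtain F c x where F: "finite F" "F \<subseteq> B" "ortho_proj F y = y" "a = scaleC c x" "x \<in> B"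
          by blast
        have ox: "orthonormal (insert x F)" using oB F by (auto intro: orthonormal_subset)
        have "ortho_proj {x} a = a"
          using F oB by (simp add: ortho_proj_def cinner_scaleC_left orthonormalD)
        then have "ortho_proj (insert x F) a = a"
          by (rule ortho_proj_superset[of "insert x F" "{x}", rotated 3]) (use F ox in auto)
        moreover have "ortho_proj (insert x F) y = y"
          using F(3) by (rule ortho_proj_superset[of "insert x F" F, rotated 3]) (use F ox in auto)
        ultimately have "ortho_proj (insert x F) (r *\<^sub>R a + y) = r *\<^sub>R a + y"
          unfolding ortho_proj_def
          by (simp add: cinner_add_left cinner.scaleR_left scaleC_add_left scaleC.scaleR_left sum.distrib
              flip: scaleR_sum_right)
        then show ?case using F by (intro exI[of _ "insert x F"]) auto
      qed
      then obtain F where F: "finite F" "F \<subseteq> B" "ortho_proj F z = z" by blast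
      have oF: "orthonormal F" using oB F(2) by (rule orthonormal_subset)
      have lin: "ortho_proj F (v - z) = ortho_proj F v - z"
        using F(3) unfolding ortho_proj_def
        by (simp add: cinner.diff_left scaleC.diff_left sum_subtractf)
      have "(norm v)\<^sup>2 - sum ?f F = (norm (v - ortho_proj F v))\<^sup>2"
        by (rule norm_diff_ortho_proj[OF F(1) oF, symmetric])
      \<comment> \<open>The projection fixes z, so the error of v equals that of v - z and is at
        most |v - z|.\<close>
      also have "v - ortho_proj F v = (v - z) - ortho_proj F (v - z)"
        by (simp add: lin)
      also have "(norm \<dots>)\<^sup>2 \<le> (norm (v - z))\<^sup>2"
        unfolding norm_diff_ortho_proj[OF F(1) oF] by (simp add: sum_nonneg)
      also have "\<dots> \<le> (sqrt e)\<^sup>2"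
        using z(2) by (intro power_mono) (simp_all add: dist_norm norm_minus_commute)
      finally show "(norm v)\<^sup>2 \<le> y + e"
        using y[of F] F e by simp
    qed
  qed
  with hs show ?thesis by simp
qed

section \<open>The trace of the cut-off of a quadratic form\<close>

text \<open>For a positive operator \<open>A\<close> and \<open>q(e) = \<langle>Ae, e\<rangle>\<close>, this is the trace of \<open>(A - \<epsilon>)\<^sub>+\<close>, by the
  variational principle.\<close>

definition cut_trace :: "real \<Rightarrow> ('h::complex_hilbert_space \<Rightarrow> real) \<Rightarrow> ennreal" where
  "cut_trace \<epsilon> q = (SUP S\<in>{S. finite S \<and> orthonormal S}. ennreal (\<Sum>e\<in>S. q e - \<epsilon>))"

text \<open>If S lies in the span of U, then U carries at least as much of q: the property of forms
  of positive operators on which superadditivity rests. Stated for arbitrary q, it passes to sums at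
  once.\<close>

definition trace_monotone :: "('h::complex_hilbert_space \<Rightarrow> real) \<Rightarrow> bool" where
  "trace_monotone q \<longleftrightarrow> (\<forall>U S. finite U \<and> orthonormal U \<and> finite S \<and> orthonormal S \<and>
    (\<forall>s\<in>S. ortho_proj U s = s) \<longrightarrow> sum q S \<le> sum q U)"

definition complex_linear ::
    "('h::complex_hilbert_space \<Rightarrow> 'k::complex_hilbert_space) \<Rightarrow> bool" where
  "complex_linear R \<longleftrightarrow> (\<forall>x y. R (x + y) = R x + R y) \<and> (\<forall>c x. R (scaleC c x) = scaleC c (R x))"

lemma complex_linear_sum:
  assumes "complex_linear R" shows "R (sum f A) = (\<Sum>x\<in>A. R (f x))"
proof -
  have "R 0 = 0" using assms unfolding complex_linear_def by (metis add_cancel_right_left add_0)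
  then show ?thesis
    using assms by (induction A rule: infinite_finite_induct) (auto simp: complex_linear_def)
qed

lemma trace_monotoneD:
  "trace_monotone q \<Longrightarrow> finite U \<Longrightarrow> orthonormal U \<Longrightarrow> finite S \<Longrightarrow> orthonormal S \<Longrightarrow>
    (\<And>s. s \<in> S \<Longrightarrow> ortho_proj U s = s) \<Longrightarrow> sum q S \<le> sum q U"
  unfolding trace_monotone_def by blast

lemma trace_monotone_add: "trace_monotone q \<Longrightarrow> trace_monotone r \<Longrightarrow> trace_monotone (\<lambda>e. q e + r e)"
  unfolding trace_monotone_def by (auto simp: sum.distrib intro!: add_mono)

lemma trace_monotone_sum:
  "(\<And>i. i \<in> I \<Longrightarrow> trace_monotone (q i)) \<Longrightarrow> trace_monotone (\<lambda>e. \<Sum>i\<in>I. q i e)"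
proof (induction I rule: infinite_finite_induct)
  case (insert i I)
  then have "trace_monotone (\<lambda>e. q i e + (\<Sum>i\<in>I. q i e))"
    by (intro trace_monotone_add) auto
  then show ?case using insert by simp
qed (auto simp: trace_monotone_def)

text \<open>Parseval over W turns both sides into sums over w of squared products with one vector z
  w of the span of U. Over S these squares are bounded by |z w|^2 through Bessel, over U they add up
  to it.\<close>

lemma trace_monotone_norm_square:
  fixes R :: "'h::complex_hilbert_space \<Rightarrow> 'k::complex_hilbert_space"
  assumes R: "complex_linear R"
  shows "trace_monotone (\<lambda>e. (norm (R e))\<^sup>2)"
  unfolding trace_monotone_def
proof (intro allI impI, elim conjE)
  fix U S :: "'h set"
  assume U: "finite U" "orthonormal U" and S: "finite S" "orthonormal S"
    and US: "\<forall>s\<in>S. ortho_proj U s = s"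
  have "finite (R ` (U \<union> S))" using U S by auto
  then obtain W where W: "finite W" "orthonormal W" "\<And>v. v \<in> R ` (U \<union> S) \<Longrightarrow> ortho_proj W v = v"
    using Gram_Schmidt[OF finite.emptyI orthonormal_empty] by metis
  have pars: "(norm (R v))\<^sup>2 = (\<Sum>w\<in>W. (cmod (cinner (R v) w))\<^sup>2)" if "v \<in> U \<union> S" for v
    using W that by (intro Parseval_finite) auto
  \<comment> \<open>The adjoint of the restriction of R to the span of U, applied to w; in finite
    dimension it exists for every complex linear R.\<close>
  define z where "z w = (\<Sum>u\<in>U. scaleC (cnj (cinner (R u) w)) u)" for w
  have zu: "cinner u (z w) = cinner (R u) w" if "u \<in> U" for u w
  proof -
    have "cinner u (z w) = (\<Sum>v\<in>U. cinner (R v) w * (if u = v then 1 else 0))"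
      unfolding z_def cinner.sum_right cinner_scaleC_right
      using U that by (intro sum.cong) (auto simp: orthonormalD)
    also have "\<dots> = cinner (R u) w"
      using U that by (simp add: if_distrib[of "(*) _"] sum.delta' cong: if_cong)
    finally show ?thesis .
  qed
  have zs: "cinner s (z w) = cinner (R s) w" if "s \<in> S" for s w
  proof -
    have s: "s = (\<Sum>u\<in>U. scaleC (cinner s u) u)"
      using US that by (simp add: ortho_proj_def)
    have "cinner s (z w) = (\<Sum>u\<in>U. cinner s u * cinner u (z w))"
      by (subst s) (simp add: cinner.sum_left cinner_scaleC_left)
    also have "\<dots> = (\<Sum>u\<in>U. cinner s u * cinner (R u) w)"
      by (intro sum.cong) (simp_all add: zu)
    also have "\<dots> = cinner (\<Sum>u\<in>U. R (scaleC (cinner s u) u)) w"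
      using R by (simp add: cinner.sum_left cinner_scaleC_left complex_linear_def)
    also have "\<dots> = cinner (R s) w"
      unfolding complex_linear_sum[OF R, symmetric] s[symmetric] ..
    finally show ?thesis .
  qed
  have nz: "(norm (z w))\<^sup>2 = (\<Sum>u\<in>U. (cmod (cinner (R u) w))\<^sup>2)" for w
  proof -
    have "ortho_proj U (z w) = z w"
    proof -
      have "ortho_proj U (z w) = (\<Sum>u\<in>U. scaleC (cnj (cinner u (z w))) u)"
        unfolding ortho_proj_def by (simp add: cinner_commute[of _ "z w"])
      also have "\<dots> = z w"
        unfolding z_def[of w] by (intro sum.cong refl) (simp only: zu flip: z_def)
      finally show ?thesis .
    qed
    then have "(norm (z w))\<^sup>2 = (\<Sum>u\<in>U. (cmod (cinner (z w) u))\<^sup>2)"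
      by (rule Parseval_finite[OF U])
    also have "\<dots> = (\<Sum>u\<in>U. (cmod (cinner u (z w)))\<^sup>2)"
      by (intro sum.cong) (simp_all add: cinner_commute[of _ "z w"])
    also have "\<dots> = (\<Sum>u\<in>U. (cmod (cinner (R u) w))\<^sup>2)"
      by (intro sum.cong) (simp_all add: zu)
    finally show ?thesis .
  qed
  have "(\<Sum>s\<in>S. (norm (R s))\<^sup>2) = (\<Sum>w\<in>W. \<Sum>s\<in>S. (cmod (cinner s (z w)))\<^sup>2)"
    by (subst sum.swap) (intro sum.cong, simp_all add: pars zs)
  also have "\<dots> \<le> (\<Sum>w\<in>W. (norm (z w))\<^sup>2)"
    using Bessel_inequality[OF S]
    by (intro sum_mono) (simp add: cinner_commute[of _ "z _"])
  also have "\<dots> = (\<Sum>u\<in>U. (norm (R u))\<^sup>2)"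
    unfolding nz by (subst sum.swap) (intro sum.cong, simp_all add: pars)
  finally show "(\<Sum>s\<in>S. (norm (R s))\<^sup>2) \<le> (\<Sum>u\<in>U. (norm (R u))\<^sup>2)" .
qed

section \<open>Order, additivity and scaling of the cut-off trace\<close>

lemma cut_trace_upper:
  "finite S \<Longrightarrow> orthonormal S \<Longrightarrow> ennreal (\<Sum>e\<in>S. q e - \<epsilon>) \<le> cut_trace \<epsilon> q"
  unfolding cut_trace_def by (rule SUP_upper) auto

lemma cut_trace_least:
  "(\<And>S :: 'h::complex_hilbert_space set.
    finite S \<Longrightarrow> orthonormal S \<Longrightarrow> ennreal (\<Sum>e\<in>S. q e - \<epsilon>) \<le> x) \<Longrightarrow> cut_trace \<epsilon> q \<le> x"
  unfolding cut_trace_def by (rule SUP_least) auto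

lemma cut_trace_mono:
  assumes "\<And>e. norm e = 1 \<Longrightarrow> q e - \<epsilon> \<le> r e - \<delta>"
  shows "cut_trace \<epsilon> q \<le> cut_trace \<delta> r"
proof (rule cut_trace_least)
  fix S :: "'a set" assume S: "finite S" "orthonormal S"
  have "ennreal (\<Sum>e\<in>S. q e - \<epsilon>) \<le> ennreal (\<Sum>e\<in>S. r e - \<delta>)"
    using S(2) by (intro ennreal_leI sum_mono assms) (rule orthonormal_norm)
  also have "\<dots> \<le> cut_trace \<delta> r" by (rule cut_trace_upper[OF S])
  finally show "ennreal (\<Sum>e\<in>S. q e - \<epsilon>) \<le> cut_trace \<delta> r" .
qed

lemma cut_trace_antimono: "\<delta> \<le> \<epsilon> \<Longrightarrow> cut_trace \<epsilon> q \<le> cut_trace \<delta> q"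
  by (rule cut_trace_mono) simp

lemma ennreal_add_le: "ennreal (x + y) \<le> ennreal x + ennreal y"
  by (cases "0 \<le> x"; cases "0 \<le> y") (auto simp: ennreal_neg ennreal_leI simp flip: ennreal_plus)

text \<open>One orthonormal set serves both terms. As \<open>ennreal\<close> sends negative sums to
  0, the estimate is the subadditivity of positive parts of real numbers.\<close>

lemma cut_trace_subadditive:
  "cut_trace (\<epsilon> + \<delta>) (\<lambda>e. q e + r e) \<le> cut_trace \<epsilon> q + cut_trace \<delta> r"
proof (rule cut_trace_least)
  fix S :: "'a set" assume S: "finite S" "orthonormal S"
  have "(\<Sum>e\<in>S. q e + r e - (\<epsilon> + \<delta>)) = (\<Sum>e\<in>S. q e - \<epsilon>) + (\<Sum>e\<in>S. r e - \<delta>)"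
    unfolding sum.distrib[symmetric] by (intro sum.cong) auto
  then have "ennreal (\<Sum>e\<in>S. q e + r e - (\<epsilon> + \<delta>)) \<le>
      ennreal (\<Sum>e\<in>S. q e - \<epsilon>) + ennreal (\<Sum>e\<in>S. r e - \<delta>)"
    by (simp only: ennreal_add_le)
  also have "\<dots> \<le> cut_trace \<epsilon> q + cut_trace \<delta> r"
    by (intro add_mono cut_trace_upper S)
  finally show "ennreal (\<Sum>e\<in>S. q e + r e - (\<epsilon> + \<delta>)) \<le> cut_trace \<epsilon> q + cut_trace \<delta> r" .
qed

lemma cut_trace_sum_le:
  assumes "finite I" "0 \<le> \<epsilon>"
  shows "cut_trace (real (card I) * \<epsilon>) (\<lambda>e. \<Sum>i\<in>I. q i e) \<le> (\<Sum>i\<in>I. cut_trace \<epsilon> (q i))"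
  using assms(1)
proof (induction I rule: finite_induct)
  case empty
  show ?case by (rule cut_trace_least) simp
next
  case (insert i I)
  have "cut_trace (real (card (insert i I)) * \<epsilon>) (\<lambda>e. \<Sum>i\<in>insert i I. q i e) =
      cut_trace (\<epsilon> + real (card I) * \<epsilon>) (\<lambda>e. q i e + (\<Sum>i\<in>I. q i e))"
    using insert by (simp add: algebra_simps)
  also have "\<dots> \<le> cut_trace \<epsilon> (q i) + cut_trace (real (card I) * \<epsilon>) (\<lambda>e. \<Sum>i\<in>I. q i e)"
    by (rule cut_trace_subadditive)
  also have "\<dots> \<le> (\<Sum>i\<in>insert i I. cut_trace \<epsilon> (q i))"
    using insert by (simp add: add_left_mono)
  finally show ?case .
qed

text \<open>An orthonormal basis of the span of two orthonormal sets has at most as many elements as the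
  two sets together, so no \<open>\<epsilon>\<close> is lost here.\<close>

lemma cut_trace_superadditive:
  fixes q r :: "'h::complex_hilbert_space \<Rightarrow> real"
  assumes q: "trace_monotone q" and r: "trace_monotone r" and \<epsilon>: "0 \<le> \<epsilon>"
  shows "cut_trace \<epsilon> q + cut_trace \<epsilon> r \<le> cut_trace \<epsilon> (\<lambda>e. q e + r e)"
proof -
  have main: "ennreal (\<Sum>e\<in>S. q e - \<epsilon>) + ennreal (\<Sum>e\<in>T. r e - \<epsilon>) \<le> cut_trace \<epsilon> (\<lambda>e. q e + r e)"
    if S: "finite S" "orthonormal S" and T: "finite T" "orthonormal T" for S T :: "'h set"
  proof -
    \<comment> \<open>A set with negative sum contributes 0 and is replaced by the empty set, so
      that both real sums are nonnegative and \<open>ennreal\<close> is additive on them.\<close>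
    define S' T' where "S' = (if 0 \<le> (\<Sum>e\<in>S. q e - \<epsilon>) then S else {})"
      and "T' = (if 0 \<le> (\<Sum>e\<in>T. r e - \<epsilon>) then T else {})"
    have S': "finite S'" "orthonormal S'" "0 \<le> (\<Sum>e\<in>S'. q e - \<epsilon>)"
      "ennreal (\<Sum>e\<in>S. q e - \<epsilon>) = ennreal (\<Sum>e\<in>S'. q e - \<epsilon>)"
      using S by (auto simp: S'_def orthonormal_empty ennreal_neg)
    have T': "finite T'" "orthonormal T'" "0 \<le> (\<Sum>e\<in>T'. r e - \<epsilon>)"
      "ennreal (\<Sum>e\<in>T. r e - \<epsilon>) = ennreal (\<Sum>e\<in>T'. r e - \<epsilon>)"
      using T by (auto simp: T'_def orthonormal_empty ennreal_neg)
    obtain W where W: "finite W" "orthonormal W" "S' \<subseteq> W" "card W \<le> card S' + card T'"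
      "\<And>v. v \<in> T' \<Longrightarrow> ortho_proj W v = v"
      using Gram_Schmidt[OF S'(1,2) T'(1)] by metis
    have "ortho_proj W v = v" if "v \<in> S'" for v
    proof (rule ortho_proj_superset[OF W(1,2)])
      show "{v} \<subseteq> W" using that W(3) by auto
      show "ortho_proj {v} v = v"
        using orthonormalD[OF S'(2) that that] by (simp add: ortho_proj_def)
    qed
    then have 1: "sum q S' \<le> sum q W"
      by (intro trace_monotoneD[OF q W(1,2) S'(1,2)])
    have 2: "sum r T' \<le> sum r W"
      by (intro trace_monotoneD[OF r W(1,2) T'(1,2)] W(5))
    have "real (card W) * \<epsilon> \<le> (real (card S') + real (card T')) * \<epsilon>"
      using W(4) \<epsilon> by (intro mult_right_mono) auto
    with 1 2 have "(\<Sum>e\<in>S'. q e - \<epsilon>) + (\<Sum>e\<in>T'. r e - \<epsilon>) \<le> (\<Sum>e\<in>W. q e + r e - \<epsilon>)"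
      by (simp add: sum.distrib sum_subtractf algebra_simps)
    then have "ennreal (\<Sum>e\<in>S. q e - \<epsilon>) + ennreal (\<Sum>e\<in>T. r e - \<epsilon>) \<le> ennreal (\<Sum>e\<in>W. q e + r e - \<epsilon>)"
      unfolding S'(4) T'(4) using S'(3) T'(3) by (simp add: ennreal_leI flip: ennreal_plus)
    also have "\<dots> \<le> cut_trace \<epsilon> (\<lambda>e. q e + r e)"
      by (rule cut_trace_upper[OF W(1,2)])
    finally show ?thesis .
  qed
  have ne: "{S :: 'h set. finite S \<and> orthonormal S} \<noteq> {}"
    using orthonormal_empty by blast
  show ?thesis
    unfolding cut_trace_def[of _ q] cut_trace_def[of _ r]
    unfolding ennreal_SUP_add_left[OF ne, symmetric]
  proof (rule SUP_least)
    fix S :: "'h set" assume S: "S \<in> {S. finite S \<and> orthonormal S}"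
    have "ennreal (\<Sum>e\<in>S. q e - \<epsilon>) + (SUP T\<in>{T. finite T \<and> orthonormal T}. ennreal (\<Sum>e\<in>T. r e - \<epsilon>)) =
        (SUP T\<in>{T. finite T \<and> orthonormal T}. ennreal (\<Sum>e\<in>S. q e - \<epsilon>) + ennreal (\<Sum>e\<in>T. r e - \<epsilon>))"
      by (rule ennreal_SUP_add_right[OF ne])
    also have "\<dots> \<le> cut_trace \<epsilon> (\<lambda>e. q e + r e)"
      using S by (intro SUP_least main) auto
    finally show "ennreal (\<Sum>e\<in>S. q e - \<epsilon>) +
        (SUP T\<in>{T. finite T \<and> orthonormal T}. ennreal (\<Sum>e\<in>T. r e - \<epsilon>)) \<le> \<dots>" .
  qed
qed

lemma cut_trace_sum_ge:
  assumes "\<And>i. i \<in> I \<Longrightarrow> trace_monotone (q i)" "0 \<le> \<epsilon>"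
  shows "(\<Sum>i\<in>I. cut_trace \<epsilon> (q i)) \<le> cut_trace \<epsilon> (\<lambda>e. \<Sum>i\<in>I. q i e)"
  using assms(1)
proof (induction I rule: infinite_finite_induct)
  case (insert i I)
  have "(\<Sum>i\<in>insert i I. cut_trace \<epsilon> (q i)) \<le> cut_trace \<epsilon> (q i) + cut_trace \<epsilon> (\<lambda>e. \<Sum>i\<in>I. q i e)"
    using insert by (simp add: add_left_mono)
  also have "\<dots> \<le> cut_trace \<epsilon> (\<lambda>e. q i e + (\<Sum>i\<in>I. q i e))"
    using insert assms(2) by (intro cut_trace_superadditive trace_monotone_sum) auto
  finally show ?case using insert by simp
qed auto

lemma cut_trace_scale:
  assumes r: "0 < r"
  shows "cut_trace (r * \<epsilon>) (\<lambda>e. r * q e) = ennreal r * cut_trace \<epsilon> q"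
  unfolding cut_trace_def SUP_mult_left_ennreal
  using r by (intro SUP_cong) (simp_all add: ennreal_mult'[symmetric] sum_distrib_left right_diff_distrib)

text \<open>Choose an orthonormal U, no larger than S, whose span contains X(S). Parseval over U and
  then Bessel over S move the sum from X to Y, and no more multiples of \<epsilon> are subtracted
  than before. With X and Y exchanged this is the trace property for a single matrix entry.\<close>

lemma cut_trace_adjoint_le:
  fixes X Y :: "'h::complex_hilbert_space \<Rightarrow> 'h"
  assumes adj: "\<And>e f. cinner (X e) f = cinner e (Y f)" and \<epsilon>: "0 \<le> \<epsilon>"
  shows "cut_trace \<epsilon> (\<lambda>e. (norm (X e))\<^sup>2) \<le> cut_trace \<epsilon> (\<lambda>e. (norm (Y e))\<^sup>2)"
proof (rule cut_trace_least)
  fix S :: "'h set" assume S: "finite S" "orthonormal S"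
  obtain U where U: "finite U" "orthonormal U" "card U \<le> card (X ` S)"
    "\<And>v. v \<in> X ` S \<Longrightarrow> ortho_proj U v = v"
    using Gram_Schmidt[OF finite.emptyI orthonormal_empty finite_imageI[OF S(1)], of X] by auto
  have card: "card U \<le> card S"
    using U(3) card_image_le[OF S(1), of X] by simp
  have "(\<Sum>e\<in>S. (norm (X e))\<^sup>2) = (\<Sum>e\<in>S. \<Sum>u\<in>U. (cmod (cinner (X e) u))\<^sup>2)"
    using U by (intro sum.cong) (auto intro: Parseval_finite)
  also have "\<dots> = (\<Sum>u\<in>U. \<Sum>e\<in>S. (cmod (cinner (Y u) e))\<^sup>2)"
    by (subst sum.swap) (simp add: adj cinner_commute[of _ "Y _"])
  also have "\<dots> \<le> (\<Sum>u\<in>U. (norm (Y u))\<^sup>2)"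
    by (intro sum_mono Bessel_inequality S)
  finally have "(\<Sum>e\<in>S. (norm (X e))\<^sup>2 - \<epsilon>) \<le> (\<Sum>u\<in>U. (norm (Y u))\<^sup>2 - \<epsilon>)"
    using mult_right_mono[of "real (card U)" "real (card S)" \<epsilon>] card \<epsilon>
    by (simp add: sum_subtractf)
  then have "ennreal (\<Sum>e\<in>S. (norm (X e))\<^sup>2 - \<epsilon>) \<le> ennreal (\<Sum>u\<in>U. (norm (Y u))\<^sup>2 - \<epsilon>)"
    by (rule ennreal_leI)
  also have "\<dots> \<le> cut_trace \<epsilon> (\<lambda>e. (norm (Y e))\<^sup>2)"
    by (rule cut_trace_upper[OF U(1,2)])
  finally show "ennreal (\<Sum>e\<in>S. (norm (X e))\<^sup>2 - \<epsilon>) \<le> cut_trace \<epsilon> (\<lambda>e. (norm (Y e))\<^sup>2)" .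
qed

section \<open>Adjoints and positive parts\<close>

text \<open>A relation, because \<open>adjoint_op\<close> is a definite description that means
  nothing before existence is known; the relation passes to sums, differences and products
  directly.\<close>

definition adjoint_pair ::
    "('h::complex_hilbert_space \<Rightarrow>\<^sub>L 'h) \<Rightarrow> ('h \<Rightarrow>\<^sub>L 'h) \<Rightarrow> bool" where
  "adjoint_pair x y \<longleftrightarrow> (\<forall>u v. cinner (x u) v = cinner u (y v))"

lemma adjoint_pairD: "adjoint_pair x y \<Longrightarrow> cinner (x u) v = cinner u (y v)"
  by (simp add: adjoint_pair_def)

lemma adjoint_pair_sym: "adjoint_pair x y \<Longrightarrow> adjoint_pair y x"
  unfolding adjoint_pair_def by (metis cinner_commute)

lemma adjoint_pair_diff: "adjoint_pair x y \<Longrightarrow> adjoint_pair x' y' \<Longrightarrow> adjoint_pair (x - x') (y - y')"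
  unfolding adjoint_pair_def by (simp add: blinfun.diff_left cinner.diff_left cinner.diff_right)

lemma adjoint_pair_compose:
  "adjoint_pair x y \<Longrightarrow> adjoint_pair x' y' \<Longrightarrow> adjoint_pair (x o\<^sub>L x') (y' o\<^sub>L y)"
  unfolding adjoint_pair_def by simp

lemma adjoint_pair_sum:
  "(\<And>i. i \<in> I \<Longrightarrow> adjoint_pair (x i) (y i)) \<Longrightarrow> adjoint_pair (\<Sum>i\<in>I. x i) (\<Sum>i\<in>I. y i)"
  unfolding adjoint_pair_def
  by (simp add: blinfun.sum_left cinner.sum_left cinner.sum_right)

lemma cinner_right_eqI:
  fixes x y :: "'h::complex_hilbert_space"
  assumes "\<And>u. cinner u x = cinner u y" shows "x = y"
proof -
  have "cinner (x - y) (x - y) = 0"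
    using assms[of "x - y"] by (simp add: cinner.diff_right)
  then show ?thesis by (simp add: cinner_self)
qed

lemma adjoint_op_eq:
  assumes "adjoint_pair x y" shows "adjoint_op x = y"
  unfolding adjoint_op_def
proof (rule the_equality)
  show y: "\<forall>u v. cinner (y u) v = cinner u (x v)"
    using adjoint_pair_sym[OF assms] by (simp add: adjoint_pair_def)
  fix S assume "\<forall>u v. cinner (blinfun_apply S u) v = cinner u (x v)"
  with y have "cinner v (S u) = cinner v (y u)" for u v
    by (metis cinner_commute)
  then show "S = y"
    by (intro blinfun_eqI cinner_right_eqI)
qed

lemma norm_adjoint_pair_le:
  assumes "adjoint_pair x y" shows "norm y \<le> norm x"
proof (rule norm_blinfun_bound)
  fix v
  have "(norm (y v))\<^sup>2 = cmod (cinner (x (y v)) v)"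
    using adjoint_pairD[OF assms, of "y v" v]
    by (simp add: cinner_self norm_power del: of_real_power)
  also have "\<dots> \<le> norm (x (y v)) * norm v" by (rule cmod_cinner_le)
  also have "\<dots> \<le> (norm x * norm (y v)) * norm v"
    by (intro mult_right_mono norm_blinfun norm_ge_zero)
  finally have "norm (y v) * norm (y v) \<le> (norm x * norm v) * norm (y v)"
    by (simp add: power2_eq_square algebra_simps)
  then show "norm (y v) \<le> norm x * norm v"
    by (cases "y v = 0") (auto simp: mult_le_cancel_right)
qed simp

section \<open>Existence of adjoints, and complex linearity as a commutation relation\<close>

lemma clinear_opD: "clinear_op T \<Longrightarrow> T (scaleC c x) = scaleC c (T x)"
  by (simp add: clinear_op_def)

text \<open>Riesz representation gives the adjoint for the real inner product, that is, for real
  parts. Testing at i u as well yields the imaginary parts, by complex linearity of x.\<close>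

lemma adjoint_pair_exists:
  fixes x :: "'h::complex_hilbert_space \<Rightarrow>\<^sub>L 'h"
  assumes x: "clinear_op x"
  shows "\<exists>y. adjoint_pair x y"
proof -
  have "\<exists>z. \<forall>u. inner (x u) v = inner z u" for v
  proof -
    have "bounded_linear (\<lambda>u. inner (x u) v)"
      by (intro bounded_linear_inner_left_comp blinfun.bounded_linear_right)
    then obtain z where "\<And>u. inner (x u) v = inner z u"
      by (rule Riesz_representation) blast
    then show ?thesis by blast
  qed
  then obtain Y where Y: "\<And>u v. inner (x u) v = inner (Y v) u" by metis
  have eqI: "a = b" if "\<And>u. inner a u = inner b u" for a b :: 'h
    using that[of "a - b"] by (metis inner_diff_left inner_eq_zero_iff right_minus_eq)
  have "bounded_linear Y"
  proof (rule bounded_linear_intro[where K = "norm x"])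
    fix v w r
    show "Y (v + w) = Y v + Y w" by (rule eqI) (simp add: inner_add_left inner_add_right flip: Y)
    show "Y (r *\<^sub>R v) = r *\<^sub>R Y v" by (rule eqI) (simp flip: Y)
    have "norm (Y v) * norm (Y v) = inner (x (Y v)) v"
      by (simp add: Y dot_square_norm power2_eq_square)
    also have "\<dots> \<le> norm (x (Y v)) * norm v" by (rule norm_cauchy_schwarz)
    also have "\<dots> \<le> (norm x * norm (Y v)) * norm v"
      by (intro mult_right_mono norm_blinfun norm_ge_zero)
    finally have "norm (Y v) * norm (Y v) \<le> (norm v * norm x) * norm (Y v)"
      by (simp add: algebra_simps)
    then show "norm (Y v) \<le> norm v * norm x"
      by (cases "Y v = 0") (auto simp: mult_le_cancel_right)
  qed
  then have app: "blinfun_apply (Blinfun Y) = Y" by (rule bounded_linear_Blinfun_apply)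
  have Re: "Re (cinner (x u) v) = Re (cinner u (Y v))" for u v
    using Y[of u v] by (simp add: Re_cinner inner_commute)
  have "cinner (x u) v = cinner u (Y v)" for u v
    using Re[of u v] Re[of "scaleC \<i> u" v]
    by (simp add: clinear_opD[OF x] cinner_scaleC_left complex_eq_iff)
  then have "adjoint_pair x (Blinfun Y)"
    by (simp add: adjoint_pair_def app)
  then show ?thesis ..
qed

lemma adjoint_pair_adjoint_op: "clinear_op x \<Longrightarrow> adjoint_pair x (adjoint_op x)"
  using adjoint_pair_exists adjoint_op_eq by blast

text \<open>Makes complex linearity a commutation relation, so that the commutant clauses for square
  roots and positive parts hand it on.\<close>

definition imaginary_unit_op :: "'h::complex_hilbert_space \<Rightarrow>\<^sub>L 'h" where
  "imaginary_unit_op = Blinfun (scaleC \<i>)"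

lemma imaginary_unit_op_apply [simp]: "imaginary_unit_op x = scaleC \<i> x"
  unfolding imaginary_unit_op_def
  by (simp add: bounded_linear_Blinfun_apply scaleC.bounded_linear_right)

lemma clinear_op_iff_commute:
  "clinear_op T \<longleftrightarrow> imaginary_unit_op o\<^sub>L T = T o\<^sub>L imaginary_unit_op"
proof
  assume "clinear_op T"
  then show "imaginary_unit_op o\<^sub>L T = T o\<^sub>L imaginary_unit_op"
    by (intro blinfun_eqI) (simp add: clinear_opD)
next
  assume T: "imaginary_unit_op o\<^sub>L T = T o\<^sub>L imaginary_unit_op"
  have i: "T (scaleC \<i> x) = scaleC \<i> (T x)" for x
    using arg_cong[OF T, of "\<lambda>S. blinfun_apply S x"] by simp
  have split: "scaleC c y = Re c *\<^sub>R y + Im c *\<^sub>R scaleC \<i> y" for c and y :: 'a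
  proof -
    have "scaleC c y = scaleC (complex_of_real (Re c) + complex_of_real (Im c) * \<i>) y"
      by (metis complex_eq mult.commute)
    then show ?thesis
      by (simp add: scaleC_add_left scaleC_of_real flip: scaleC_scaleC)
  qed
  show "clinear_op T"
    unfolding clinear_op_def
  proof (intro allI)
    fix c x
    show "T (scaleC c x) = scaleC c (T x)"
      unfolding split[of c x] split[of c "T x"]
      by (simp add: blinfun.add_right blinfun.scaleR_right i)
  qed
qed

lemma positive_op_clinear: "positive_op a \<Longrightarrow> clinear_op a"
  by (simp add: positive_op_def)

lemma positive_op_psd:
  assumes a: "positive_op a" shows "psd a"
  unfolding psd_def
proof (intro conjI allI)
  fix x y
  note lin = clinear_opD[OF positive_op_clinear[OF a]]
  have im: "Im (cinner (a z) z) = 0" and re: "0 \<le> Re (cinner (a z) z)" for z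
    using a by (auto simp: positive_op_def complex_nonneg_Reals_iff)
  show "0 \<le> inner (a x) x" using re[of x] by (simp add: Re_cinner)
  \<comment> \<open>Polarisation: the form is real at x + i y, x and y, and its imaginary part at x
    + i y measures exactly the failure of symmetry.\<close>
  have "Im (cinner (a (x + scaleC \<i> y)) (x + scaleC \<i> y)) = Re (cinner (a y) x) - Re (cinner (a x) y)"
    using im[of x] im[of y]
    by (simp add: blinfun.add_right lin cinner_add_left cinner_add_right cinner_scaleC_left
        cinner_scaleC_right)
  then show "inner (a x) y = inner x (a y)"
    unfolding im by (simp add: Re_cinner inner_commute)
qed

lemma positive_opI:
  assumes a: "psd a" and lin: "clinear_op a" shows "positive_op a"
  unfolding positive_op_def
proof (intro conjI allI lin)
  fix x
  have "Im (cinner (a x) x) = inner (a x) (scaleC \<i> x)"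
    by (simp add: Re_cinner[symmetric] cinner_scaleC_right)
  also have "\<dots> = inner x (a (scaleC \<i> x))" by (rule psd_sym[OF a])
  also have "\<dots> = Im (cinner x (a x))"
    by (simp add: Re_cinner[symmetric] clinear_opD[OF lin] cinner_scaleC_right)
  also have "\<dots> = - Im (cinner (a x) x)" by (subst cinner_commute) simp
  finally show "cinner (a x) x \<in> \<real>\<^sub>\<ge>\<^sub>0"
    using psd_nonneg[OF a, of x] by (simp add: complex_nonneg_Reals_iff Re_cinner)
qed

lemma positive_op_sqrt:
  assumes "positive_op a"
  obtains s where "clinear_op s" "\<And>x. inner (a x) x = (norm (s x))\<^sup>2"
proof -
  obtain s where s: "psd s" "s o\<^sub>L s = a" "\<And>k. k o\<^sub>L a = a o\<^sub>L k \<Longrightarrow> k o\<^sub>L s = s o\<^sub>L k"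
    by (rule psd_sqrt[OF positive_op_psd[OF assms]]) blast
  have "clinear_op s"
    using s(3) positive_op_clinear[OF assms] by (simp add: clinear_op_iff_commute)
  moreover have "inner (a x) x = (norm (s x))\<^sup>2" for x
    using psd_sym[OF s(1), of "s x" x] by (simp flip: s(2) add: dot_square_norm)
  ultimately show thesis using that by blast
qed

text \<open>Write a - \<epsilon> = p - d with p d = 0. The lower bound is positivity of d. On the
  range of d the operator a acts as \<epsilon> - d, so positivity of a gives d \<le> \<epsilon>
  there; \<open>norm_psd_apply_le\<close> extends this to all vectors, and p = a - \<epsilon> + d
  \<le> a.\<close>

lemma positive_part_bounds:
  assumes a: "positive_op a" and \<epsilon>: "0 \<le> \<epsilon>"
  defines "c \<equiv> positive_part (a - \<epsilon> *\<^sub>R id_blinfun)"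
  shows "positive_op c" "inner (a x) x - \<epsilon> * (norm x)\<^sup>2 \<le> inner (c x) x" "inner (c x) x \<le> inner (a x) x"
proof -
  note psda = positive_op_psd[OF a]
  define b where "b = a - \<epsilon> *\<^sub>R id_blinfun"
  have sym: "inner (b u) v = inner u (b v)" for u v
    using psd_sym[OF psda, of u v]
    by (simp add: b_def blinfun.diff_left blinfun.scaleR_left inner_diff_left inner_diff_right)
  obtain p d where p: "psd p" "psd d" "b = p - d" "p o\<^sub>L d = 0"
    "\<And>k. k o\<^sub>L b = b o\<^sub>L k \<Longrightarrow> k o\<^sub>L p = p o\<^sub>L k \<and> k o\<^sub>L d = d o\<^sub>L k"
    and unique: "\<And>c' d'. psd c' \<Longrightarrow> psd d' \<Longrightarrow> b = c' - d' \<Longrightarrow> c' o\<^sub>L d' = 0 \<Longrightarrow> c' = p"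
    using positive_part_exists[OF sym] by metis
  have "imaginary_unit_op o\<^sub>L b = b o\<^sub>L imaginary_unit_op"
    using positive_op_clinear[OF a]
    by (intro blinfun_eqI) (simp add: b_def blinfun.diff_left blinfun.scaleR_left clinear_opD
        scaleC.diff_right scaleC.scaleR_right)
  then have pos: "positive_op p" "positive_op d"
    using p(5) by (auto intro!: positive_opI p(1,2) simp: clinear_op_iff_commute)
  have "positive_part b = p"
    unfolding positive_part_def
  proof (rule the_equality)
    show "positive_op p \<and> (\<exists>d. positive_op d \<and> b = p - d \<and> p o\<^sub>L d = 0)"
      using pos p(3,4) by blast
  next
    fix c' assume "positive_op c' \<and> (\<exists>d. positive_op d \<and> b = c' - d \<and> c' o\<^sub>L d = 0)"
    then show "c' = p" by (metis unique positive_op_psd)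
  qed
  then have c: "c = p" by (simp add: c_def b_def)
  then show "positive_op c" using pos by simp
  have ax: "a u = p u - d u + \<epsilon> *\<^sub>R u" for u
    using arg_cong[OF p(3), of "\<lambda>S. blinfun_apply S u"]
    by (simp add: b_def blinfun.diff_left blinfun.scaleR_left algebra_simps)
  show "inner (a x) x - \<epsilon> * (norm x)\<^sup>2 \<le> inner (c x) x"
    using psd_nonneg[OF p(2), of x]
    by (simp add: ax c inner_add_left inner_diff_left dot_square_norm)
  have "inner (d (d y)) (d y) \<le> \<epsilon> * (norm (d y))\<^sup>2" for y
  proof -
    have "p (d y) = 0"
      using arg_cong[OF p(4), of "\<lambda>S. blinfun_apply S y"] by simp
    then show ?thesis
      using psd_nonneg[OF psda, of "d y"]
      by (simp add: ax inner_add_left inner_diff_left dot_square_norm)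
  qed
  then have le: "(norm (d x))\<^sup>2 \<le> \<epsilon> * inner (d x) x"
    by (rule norm_psd_apply_le[OF p(2)])
  have "inner (d x) x \<le> \<epsilon> * (norm x)\<^sup>2"
  proof -
    have "norm (d x) * norm (d x) \<le> \<epsilon> * (norm (d x) * norm x)"
      using le mult_left_mono[OF norm_cauchy_schwarz[of "d x" x] \<epsilon>] by (simp add: power2_eq_square)
    then have "norm (d x) \<le> \<epsilon> * norm x"
      using \<epsilon> by (cases "d x = 0") (auto simp: mult_le_cancel_right algebra_simps)
    then have "norm (d x) * norm x \<le> \<epsilon> * norm x * norm x"
      by (rule mult_right_mono) simp
    then show ?thesis
      using norm_cauchy_schwarz[of "d x" x] by (simp add: power2_eq_square algebra_simps)
  qed
  then show "inner (c x) x \<le> inner (a x) x"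
    by (simp add: ax c inner_add_left inner_diff_left dot_square_norm)
qed

section \<open>Compact projections\<close>

text \<open>By Parseval each s in S contributes |s|^2 = 1 to the sum over the basis, whichever basis
  \<open>Tr\<close> has chosen.\<close>

lemma Tr_eq_dimension:
  fixes p :: "'h::complex_hilbert_space \<Rightarrow>\<^sub>L 'h"
  assumes S: "finite S" "orthonormal S"
    and p: "\<And>x. Re (cinner (p x) x) = (\<Sum>s\<in>S. (cmod (cinner s x))\<^sup>2)"
  shows "Tr p = of_nat (card S)"
proof -
  define B :: "'h set" where "B = (SOME B. orthonormal_basis B)"
  have B: "orthonormal_basis B"
    unfolding B_def using orthonormal_basis_exists by (rule someI_ex)
  have "((\<lambda>b. \<Sum>s\<in>S. (cmod (cinner s b))\<^sup>2) has_sum (\<Sum>s\<in>S. (norm s)\<^sup>2)) B"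
    using S(1)
  proof (induction S rule: finite_induct)
    case (insert s S)
    then show ?case
      using has_sum_add[OF Parseval[OF B, of s] insert(3)] by simp
  qed simp
  moreover have "(\<Sum>s\<in>S. (norm s)\<^sup>2) = real (card S)"
    using orthonormal_norm[OF S(2)] by simp
  ultimately have hs: "((\<lambda>b. Re (cinner (p b) b)) has_sum real (card S)) B"
    by (simp add: p)
  have nn: "0 \<le> Re (cinner (p b) b)" for b by (simp add: p sum_nonneg)
  have "Tr p = (SUP F\<in>{F. finite F \<and> F \<subseteq> B}. \<Sum>b\<in>F. ennreal (Re (cinner (p b) b)))"
    unfolding Tr_def B_def[symmetric] by (rule nonneg_infsum_complete) simp
  also have "\<dots> = (SUP F\<in>{F. finite F \<and> F \<subseteq> B}. ennreal (\<Sum>b\<in>F. Re (cinner (p b) b)))"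
    using nn by (intro SUP_cong) (auto simp: sum_ennreal)
  also have "\<dots> = ennreal (infsum (\<lambda>b. Re (cinner (p b) b)) B)"
    using hs nn by (intro infsum_nonneg_is_SUPREMUM_ennreal[symmetric]) (auto simp: has_sum_imp_summable)
  also have "\<dots> = of_nat (card S)"
    using infsumI[OF hs] by (simp add: ennreal_of_nat_eq_real_of_nat)
  finally show ?thesis .
qed

text \<open>Distinct orthonormal vectors are at distance sqrt 2, so a ball of radius 1/2 holds at
  most one of them.\<close>

lemma compact_orthonormal_card_bound:
  assumes K: "compact K"
  obtains N where "\<And>S :: 'h::complex_hilbert_space set. finite S \<Longrightarrow> orthonormal S \<Longrightarrow> S \<subseteq> K \<Longrightarrow> card S \<le> N"
proof -
  have "\<exists>k. finite k \<and> K \<subseteq> (\<Union>x\<in>k. ball x (1/2))"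
    using K unfolding compact_eq_totally_bounded by simp
  then obtain k where k: "finite k" "K \<subseteq> (\<Union>x\<in>k. ball x (1/2))" by blast
  have "card S \<le> card k" if S: "finite S" "orthonormal S" "S \<subseteq> K" for S
  proof -
    have "\<forall>s\<in>S. \<exists>x\<in>k. dist x s < 1/2"
      using S(3) k(2) by fastforce
    then obtain c where c: "\<And>s. s \<in> S \<Longrightarrow> c s \<in> k" "\<And>s. s \<in> S \<Longrightarrow> dist (c s) s < 1/2"
      by metis
    have "inj_on c S"
    proof (rule inj_onI, rule ccontr)
      fix x y assume xy: "x \<in> S" "y \<in> S" "c x = c y" "x \<noteq> y"
      have "dist x y \<le> dist (c x) x + dist (c y) y"
        using xy(3) by (metis dist_commute dist_triangle2 add.commute)
      then have "norm (x - y) < 1"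
        using c(2)[OF xy(1)] c(2)[OF xy(2)] by (simp add: dist_norm)
      then have "(norm (x - y))\<^sup>2 < 1" by (simp add: abs_square_less_1)
      moreover have "(norm (x - y))\<^sup>2 = 2"
      proof -
        have "inner x y = 0"
          using orthonormalD[OF S(2) xy(1,2)] xy(4) by (simp flip: Re_cinner)
        then show ?thesis
          using orthonormal_norm[OF S(2) xy(1)] orthonormal_norm[OF S(2) xy(2)] dot_norm_neg[of x y]
          by simp
      qed
      ultimately show False by simp
    qed
    then show ?thesis
      using c(1) k(1) by (intro card_inj_on_le) auto
  qed
  then show thesis using that by blast
qed

text \<open>n is the rank of the projection p, whose cut-off trace is (1 - \<epsilon>) n for
  \<epsilon> in (0, 1]. The two bounds bracket it closely enough for \<epsilon> tending to
  0.\<close>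

definition cut_dimension :: "('h::complex_hilbert_space \<Rightarrow>\<^sub>L 'h) \<Rightarrow> nat \<Rightarrow> bool" where
  "cut_dimension p n \<longleftrightarrow> Tr p = of_nat n \<and> (p \<noteq> 0 \<longrightarrow> 0 < n) \<and>
    (\<forall>\<epsilon>>0. cut_trace \<epsilon> (\<lambda>e. inner (p e) e) \<le> of_nat n) \<and>
    (\<forall>\<epsilon>\<le>1. ennreal (1 - \<epsilon>) * of_nat n \<le> cut_trace \<epsilon> (\<lambda>e. inner (p e) e))"

text \<open>Orthonormal vectors fixed by p lie in the image of the unit ball, whose closure is
  compact, so their number is bounded. A largest such family spans the range of p, and p is the
  projection onto its span.\<close>

lemma compact_projection_dimension:
  fixes p :: "'h::complex_hilbert_space \<Rightarrow>\<^sub>L 'h"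
  assumes cp: "p \<in> compact_ops" and pp: "p o\<^sub>L p = p" and adj: "adjoint_op p = p"
  shows "\<exists>n. cut_dimension p n"
proof -
  have sa: "cinner (p x) y = cinner x (p y)" for x y
    using adjoint_pairD[OF adjoint_pair_adjoint_op, of p] cp adj by (simp add: compact_ops_def)
  have idem: "p (p x) = p x" for x
    using arg_cong[OF pp, of "\<lambda>S. blinfun_apply S x"] by simp
  have lin: "p (scaleC c x) = scaleC c (p x)" for c x
    using cp by (simp add: compact_ops_def clinear_opD)
  define P where "P n \<longleftrightarrow> (\<exists>S. finite S \<and> orthonormal S \<and> (\<forall>s\<in>S. p s = s) \<and> card S = n)" for n
  obtain N where N: "\<And>S. finite S \<Longrightarrow> orthonormal S \<Longrightarrow>
      S \<subseteq> closure (blinfun_apply p ` cball 0 1) \<Longrightarrow> card S \<le> N"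
    using compact_orthonormal_card_bound cp by (metis (no_types, lifting) compact_ops_def mem_Collect_eq)
  have "n \<le> N" if n: "P n" for n
  proof -
    obtain S where S: "finite S" "orthonormal S" "\<And>s. s \<in> S \<Longrightarrow> p s = s" "card S = n"
      using n unfolding P_def by blast
    have "S \<subseteq> blinfun_apply p ` cball 0 1"
    proof
      fix s assume s: "s \<in> S"
      then have "s \<in> cball 0 1" using orthonormal_norm[OF S(2)] by simp
      then show "s \<in> blinfun_apply p ` cball 0 1" using S(3)[OF s] by (metis imageI)
    qed
    then have "S \<subseteq> closure (blinfun_apply p ` cball 0 1)" using closure_subset by blast
    then show ?thesis using N[OF S(1,2)] S(4) by simp
  qed
  moreover have "P 0" unfolding P_def by (intro exI[of _ "{}"]) (simp add: orthonormal_empty)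
  ultimately obtain n where n: "P n" "\<And>m. P m \<Longrightarrow> m \<le> n"
    using Nat.ex_has_greatest_nat[of P 0 N] by blast
  then obtain S where S: "finite S" "orthonormal S" "\<And>s. s \<in> S \<Longrightarrow> p s = s" "card S = n"
    unfolding P_def by blast
  have full: "ortho_proj S v = v" if v: "p v = v" for v
  proof (rule ccontr)
    assume "ortho_proj S v \<noteq> v"
    note ext = orthonormal_extend[OF S(1,2) this]
    let ?w = "(1 / norm (v - ortho_proj S v)) *\<^sub>R (v - ortho_proj S v)"
    have "p (ortho_proj S v) = ortho_proj S v"
      unfolding ortho_proj_def blinfun.sum_right by (intro sum.cong) (simp_all add: lin S(3))
    then have "p ?w = ?w"
      using v by (simp add: blinfun.scaleR_right blinfun.diff_right)
    then have "P (Suc n)"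
      unfolding P_def using S ext by (intro exI[of _ "insert ?w S"]) auto
    then show False using n(2) by fastforce
  qed
  have npx: "(norm (p x))\<^sup>2 = (\<Sum>s\<in>S. (cmod (cinner s x))\<^sup>2)" for x
  proof -
    have "(norm (p x))\<^sup>2 = (\<Sum>s\<in>S. (cmod (cinner (p x) s))\<^sup>2)"
      by (rule Parseval_finite[OF S(1,2) full[OF idem]])
    also have "\<dots> = (\<Sum>s\<in>S. (cmod (cinner s x))\<^sup>2)"
      by (intro sum.cong refl) (simp add: sa S(3) cinner_commute[of x])
    finally show ?thesis .
  qed
  have q: "inner (p x) x = (norm (p x))\<^sup>2" for x
    using sa[of "p x" x] by (simp add: idem cinner_self flip: Re_cinner)
  have "cut_dimension p n"
    unfolding cut_dimension_def
  proof (intro conjI allI impI)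
    show "Tr p = of_nat n"
      using Tr_eq_dimension[OF S(1,2), of p] S(4) by (simp add: Re_cinner q npx)
    show "0 < n" if "p \<noteq> 0"
    proof (rule ccontr)
      assume "\<not> 0 < n"
      then have "S = {}" using S by simp
      then have "p x = 0" for x using npx[of x] by simp
      then show False using that by (metis blinfun_eqI blinfun.zero_left)
    qed
    show "cut_trace \<epsilon> (\<lambda>e. inner (p e) e) \<le> of_nat n" if "0 < \<epsilon>" for \<epsilon>
    proof (rule cut_trace_least)
      fix T :: "'h set" assume T: "finite T" "orthonormal T"
      have "(\<Sum>e\<in>T. inner (p e) e - \<epsilon>) \<le> (\<Sum>e\<in>T. (norm (p e))\<^sup>2)"
        using that by (intro sum_mono) (simp add: q)
      also have "\<dots> = (\<Sum>s\<in>S. \<Sum>e\<in>T. (cmod (cinner s e))\<^sup>2)"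
        unfolding npx by (rule sum.swap)
      also have "\<dots> \<le> (\<Sum>s\<in>S. (norm s)\<^sup>2)"
        by (intro sum_mono Bessel_inequality T)
      also have "\<dots> = real n"
        using orthonormal_norm[OF S(2)] S(4) by simp
      finally show "ennreal (\<Sum>e\<in>T. inner (p e) e - \<epsilon>) \<le> of_nat n"
        by (simp add: ennreal_of_nat_eq_real_of_nat ennreal_leI)
    qed
    show "ennreal (1 - \<epsilon>) * of_nat n \<le> cut_trace \<epsilon> (\<lambda>e. inner (p e) e)" if "\<epsilon> \<le> 1" for \<epsilon>
    proof -
      have "(\<Sum>e\<in>S. inner (p e) e - \<epsilon>) = (1 - \<epsilon>) * real n"
        using orthonormal_norm[OF S(2)] S(3,4) by (simp add: dot_square_norm algebra_simps)
      then have "ennreal (1 - \<epsilon>) * of_nat n = ennreal (\<Sum>e\<in>S. inner (p e) e - \<epsilon>)"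
        using that by (simp add: ennreal_of_nat_eq_real_of_nat ennreal_mult)
      also have "\<dots> \<le> cut_trace \<epsilon> (\<lambda>e. inner (p e) e)"
        by (rule cut_trace_upper[OF S(1,2)])
      finally show ?thesis .
    qed
  qed
  then show ?thesis ..
qed

section \<open>Traces from invariant functionals\<close>

text \<open>An invariant integral for all functions on G with values in [0, infinity], additive in
  the finite sense only.\<close>

locale invariant_functional =
  fixes c :: "('g::group_add \<Rightarrow> ennreal) \<Rightarrow> ennreal"
  assumes mono: "(\<And>g. F g \<le> F' g) \<Longrightarrow> c F \<le> c F'"
    and add: "c (\<lambda>g. F g + F' g) = c F + c F'"
    and scale: "0 \<le> r \<Longrightarrow> c (\<lambda>g. ennreal r * F g) = ennreal r * c F"
    and invariant: "c (\<lambda>g. F (s + g)) = c F"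
begin

lemma zero: "c (\<lambda>_. 0) = 0"
  using scale[of 0 "\<lambda>_. 0"] by simp

lemma sum: "finite I \<Longrightarrow> c (\<lambda>g. \<Sum>i\<in>I. F i g) = (\<Sum>i\<in>I. c (F i))"
  by (induction I rule: finite_induct) (simp_all add: zero add)

text \<open>The supremum stands outside \<open>c\<close>, as the axioms do not let \<open>c\<close>
  pass to increasing limits. Since the cut-off trace grows as \<epsilon> decreases, it is the limit
  for \<epsilon> tending to 0.\<close>

definition form_trace :: "('g \<Rightarrow> 'h::complex_hilbert_space \<Rightarrow> real) \<Rightarrow> ennreal" where
  "form_trace q = (SUP \<epsilon>\<in>{0<..}. c (\<lambda>g. cut_trace \<epsilon> (q g)))"

lemma form_trace_upper: "0 < \<epsilon> \<Longrightarrow> c (\<lambda>g. cut_trace \<epsilon> (q g)) \<le> form_trace q"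
  unfolding form_trace_def by (rule SUP_upper) simp

lemma form_trace_least: "(\<And>\<epsilon>. 0 < \<epsilon> \<Longrightarrow> c (\<lambda>g. cut_trace \<epsilon> (q g)) \<le> x) \<Longrightarrow> form_trace q \<le> x"
  unfolding form_trace_def by (rule SUP_least) simp

lemma form_trace_mono:
  assumes "\<And>g e. norm e = 1 \<Longrightarrow> q g e \<le> r g e"
  shows "form_trace q \<le> form_trace r"
  unfolding form_trace_def
  using assms by (intro SUP_mono' mono cut_trace_mono) simp

lemma form_trace_add:
  assumes q: "\<And>g. trace_monotone (q g)" and r: "\<And>g. trace_monotone (r g)"
  shows "form_trace (\<lambda>g e. q g e + r g e) = form_trace q + form_trace r"
proof (rule antisym)
  show "form_trace (\<lambda>g e. q g e + r g e) \<le> form_trace q + form_trace r"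
  proof (rule form_trace_least)
    fix \<epsilon> :: real assume \<epsilon>: "0 < \<epsilon>"
    have "c (\<lambda>g. cut_trace \<epsilon> (\<lambda>e. q g e + r g e)) \<le>
        c (\<lambda>g. cut_trace (\<epsilon> / 2) (q g) + cut_trace (\<epsilon> / 2) (r g))"
      using cut_trace_subadditive[of "\<epsilon> / 2" "\<epsilon> / 2"] by (intro mono) simp
    also have "\<dots> \<le> form_trace q + form_trace r"
      unfolding add using \<epsilon> by (intro add_mono form_trace_upper) auto
    finally show "c (\<lambda>g. cut_trace \<epsilon> (\<lambda>e. q g e + r g e)) \<le> form_trace q + form_trace r" .
  qed
  \<comment> \<open>Both terms grow as \<epsilon> decreases, so the minimum of two cut levels serves
    for both and the suprema can be joined.\<close>
  have "form_trace q + form_trace r =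
      (SUP \<epsilon>\<in>{0<..}. c (\<lambda>g. cut_trace \<epsilon> (q g)) + c (\<lambda>g. cut_trace \<epsilon> (r g)))"
    unfolding form_trace_def
  proof (rule SUP_add_directed_ennreal[symmetric])
    fix i j :: real assume "i \<in> {0<..}" "j \<in> {0<..}"
    then show "\<exists>k\<in>{0<..}. c (\<lambda>g. cut_trace i (q g)) + c (\<lambda>g. cut_trace j (r g)) \<le>
        c (\<lambda>g. cut_trace k (q g)) + c (\<lambda>g. cut_trace k (r g))"
      by (intro bexI[of _ "min i j"] add_mono mono cut_trace_antimono) auto
  qed
  also have "\<dots> \<le> form_trace (\<lambda>g e. q g e + r g e)"
  proof (rule SUP_least)
    fix \<epsilon> :: real assume \<epsilon>: "\<epsilon> \<in> {0<..}"
    have "c (\<lambda>g. cut_trace \<epsilon> (q g)) + c (\<lambda>g. cut_trace \<epsilon> (r g)) \<le>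
        c (\<lambda>g. cut_trace \<epsilon> (\<lambda>e. q g e + r g e))"
      unfolding add[symmetric] using \<epsilon> by (intro mono cut_trace_superadditive q r) auto
    also have "\<dots> \<le> form_trace (\<lambda>g e. q g e + r g e)"
      using \<epsilon> by (intro form_trace_upper) auto
    finally show "c (\<lambda>g. cut_trace \<epsilon> (q g)) + c (\<lambda>g. cut_trace \<epsilon> (r g)) \<le>
      form_trace (\<lambda>g e. q g e + r g e)" .
  qed
  finally show "form_trace q + form_trace r \<le> form_trace (\<lambda>g e. q g e + r g e)" .
qed

lemma form_trace_scale:
  fixes q :: "'g \<Rightarrow> 'h::complex_hilbert_space \<Rightarrow> real"
  assumes "0 \<le> r"
  shows "form_trace (\<lambda>g e. r * q g e) = ennreal r * form_trace q"
proof (cases "r = 0")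
  case True
  have "cut_trace \<epsilon> (\<lambda>_ :: 'h. 0) = 0" if "0 < \<epsilon>" for \<epsilon>
  proof -
    have "cut_trace \<epsilon> (\<lambda>_ :: 'h. 0) \<le> 0"
      using that by (intro cut_trace_least) (simp add: ennreal_neg)
    then show ?thesis by simp
  qed
  then have "form_trace (\<lambda>_ (_ :: 'h). 0) \<le> 0"
    by (intro form_trace_least) (simp add: zero)
  then show ?thesis using True by simp
next
  case False
  then have r: "0 < r" using assms by simp
  \<comment> \<open>One inequality for every r and q; the reverse one follows from it with 1/r and r
    q.\<close>
  have le: "form_trace (\<lambda>g e. r * q g e) \<le> ennreal r * form_trace q"
    if r: "0 < r" for r and q :: "'g \<Rightarrow> 'h \<Rightarrow> real"
  proof (rule form_trace_least)
    fix \<epsilon> :: real assume \<epsilon>: "0 < \<epsilon>"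
    have "cut_trace \<epsilon> (\<lambda>e. r * q g e) = ennreal r * cut_trace (\<epsilon> / r) (q g)" for g
      using cut_trace_scale[OF r, of "\<epsilon> / r" "q g"] r by simp
    then have "c (\<lambda>g. cut_trace \<epsilon> (\<lambda>e. r * q g e)) = ennreal r * c (\<lambda>g. cut_trace (\<epsilon> / r) (q g))"
      using r by (simp add: scale)
    also have "\<dots> \<le> ennreal r * form_trace q"
      using \<epsilon> r by (intro mult_left_mono form_trace_upper) auto
    finally show "c (\<lambda>g. cut_trace \<epsilon> (\<lambda>e. r * q g e)) \<le> ennreal r * form_trace q" .
  qed
  have "ennreal r * form_trace q = ennreal r * form_trace (\<lambda>g e. (1 / r) * (r * q g e))"
    using r by simp
  also have "\<dots> \<le> ennreal r * (ennreal (1 / r) * form_trace (\<lambda>g e. r * q g e))"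
    using r by (intro mult_left_mono le) auto
  also have "\<dots> = form_trace (\<lambda>g e. r * q g e)"
    using r by (simp add: mult.assoc[symmetric] ennreal_mult[symmetric])
  finally show ?thesis using le[OF r, of q] by (rule antisym[rotated])
qed

lemma form_trace_lower_semicontinuous:
  assumes "\<And>\<epsilon> g e. 0 < \<epsilon> \<Longrightarrow> norm e = 1 \<Longrightarrow> q g e - \<epsilon> \<le> r \<epsilon> g e"
    and "\<And>\<epsilon> g e. 0 < \<epsilon> \<Longrightarrow> norm e = 1 \<Longrightarrow> r \<epsilon> g e \<le> q g e"
  shows "form_trace q = (SUP \<epsilon>\<in>{0<..}. form_trace (r \<epsilon>))"
proof (rule antisym)
  show "(SUP \<epsilon>\<in>{0<..}. form_trace (r \<epsilon>)) \<le> form_trace q"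
    using assms(2) by (intro SUP_least form_trace_mono) auto
  show "form_trace q \<le> (SUP \<epsilon>\<in>{0<..}. form_trace (r \<epsilon>))"
  proof (rule form_trace_least)
    fix \<epsilon> :: real assume \<epsilon>: "0 < \<epsilon>"
    \<comment> \<open>One half of \<epsilon> pays for the passage from q to r, the other half
      remains as cut level.\<close>
    have "q g e - \<epsilon> \<le> r (\<epsilon> / 2) g e - \<epsilon> / 2" if "norm e = 1" for g e
      using assms(1)[of "\<epsilon> / 2" e g] \<epsilon> that by simp
    then have "c (\<lambda>g. cut_trace \<epsilon> (q g)) \<le> c (\<lambda>g. cut_trace (\<epsilon> / 2) (r (\<epsilon> / 2) g))"
      by (intro mono cut_trace_mono)
    also have "\<dots> \<le> form_trace (r (\<epsilon> / 2))"
      using \<epsilon> by (intro form_trace_upper) auto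
    also have "\<dots> \<le> (SUP \<epsilon>\<in>{0<..}. form_trace (r \<epsilon>))"
      using \<epsilon> by (intro SUP_upper) auto
    finally show "c (\<lambda>g. cut_trace \<epsilon> (q g)) \<le> (SUP \<epsilon>\<in>{0<..}. form_trace (r \<epsilon>))" .
  qed
qed

text \<open>\<open>X g h\<close> and \<open>Y h g\<close> are the matrix entries of an operator and of its adjoint, and \<open>A\<close> and
  \<open>B\<close> are the diagonals of the two products. By the first assumption the columns of \<open>X\<close> are
  uniformly concentrated near the diagonal.\<close>

lemma form_trace_matrix_le:
  fixes X Y :: "'g \<Rightarrow> 'g \<Rightarrow> 'h::complex_hilbert_space \<Rightarrow> 'h"
  assumes adj: "\<And>g h e f. cinner (X g h e) f = cinner e (Y h g f)"
    and lin: "\<And>g h. complex_linear (Y g h)"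
    and A: "\<And>\<delta>. 0 < \<delta> \<Longrightarrow> \<exists>F. finite F \<and>
      (\<forall>h e. norm e = 1 \<longrightarrow> A h e \<le> (\<Sum>s\<in>F. (norm (X (s + h) h e))\<^sup>2) + \<delta>)"
    and B: "\<And>F g e. finite F \<Longrightarrow> (\<Sum>s\<in>F. (norm (Y (- s + g) g e))\<^sup>2) \<le> B g e"
  shows "form_trace A \<le> form_trace B"
proof (rule form_trace_least)
  fix \<epsilon> :: real assume \<epsilon>: "0 < \<epsilon>"
  then obtain F where F: "finite F"
    "\<And>h e. norm e = 1 \<Longrightarrow> A h e \<le> (\<Sum>s\<in>F. (norm (X (s + h) h e))\<^sup>2) + \<epsilon> / 2"
    using A[of "\<epsilon> / 2"] by (auto simp del: less_divide_eq_numeral1)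
  \<comment> \<open>Half of \<epsilon> is spent on the tail of the column, the other half is shared
    among the terms of F; the summand 1 avoids division by 0 for empty F.\<close>
  define \<eta> where "\<eta> = \<epsilon> / (2 * (real (card F) + 1))"
  have \<eta>: "0 < \<eta>" "real (card F) * \<eta> \<le> \<epsilon> / 2"
    using \<epsilon> by (auto simp: \<eta>_def field_simps)
  have "cut_trace \<epsilon> (A h) \<le> (\<Sum>s\<in>F. cut_trace \<eta> (\<lambda>e. (norm (Y h (s + h) e))\<^sup>2))" for h
  proof -
    have "A h e - \<epsilon> \<le> (\<Sum>s\<in>F. (norm (X (s + h) h e))\<^sup>2) - real (card F) * \<eta>" if "norm e = 1" for e
      using F(2)[OF that, of h] \<eta>(2) by (simp add: field_simps)
    then have "cut_trace \<epsilon> (A h) \<le>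
        cut_trace (real (card F) * \<eta>) (\<lambda>e. \<Sum>s\<in>F. (norm (X (s + h) h e))\<^sup>2)"
      by (rule cut_trace_mono)
    also have "\<dots> \<le> (\<Sum>s\<in>F. cut_trace \<eta> (\<lambda>e. (norm (X (s + h) h e))\<^sup>2))"
      using F(1) \<eta>(1) by (intro cut_trace_sum_le) auto
    also have "\<dots> \<le> (\<Sum>s\<in>F. cut_trace \<eta> (\<lambda>e. (norm (Y h (s + h) e))\<^sup>2))"
      using \<eta>(1) by (intro sum_mono cut_trace_adjoint_le adj) auto
    finally show ?thesis .
  qed
  then have "c (\<lambda>h. cut_trace \<epsilon> (A h)) \<le> c (\<lambda>h. \<Sum>s\<in>F. cut_trace \<eta> (\<lambda>e. (norm (Y h (s + h) e))\<^sup>2))"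
    by (rule mono)
  also have "\<dots> = (\<Sum>s\<in>F. c (\<lambda>h. cut_trace \<eta> (\<lambda>e. (norm (Y h (s + h) e))\<^sup>2)))"
    by (rule sum[OF F(1)])
  \<comment> \<open>Left invariance for each fixed s: the row index g = s + h replaces the column
    index h as the variable.\<close>
  also have "\<dots> = (\<Sum>s\<in>F. c (\<lambda>g. cut_trace \<eta> (\<lambda>e. (norm (Y (- s + g) g e))\<^sup>2)))"
  proof (intro sum.cong refl)
    fix s
    show "c (\<lambda>h. cut_trace \<eta> (\<lambda>e. (norm (Y h (s + h) e))\<^sup>2)) =
        c (\<lambda>g. cut_trace \<eta> (\<lambda>e. (norm (Y (- s + g) g e))\<^sup>2))"
      using invariant[of "\<lambda>g. cut_trace \<eta> (\<lambda>e. (norm (Y (- s + g) g e))\<^sup>2)" s]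
      by (simp add: add.assoc[symmetric])
  qed
  also have "\<dots> = c (\<lambda>g. \<Sum>s\<in>F. cut_trace \<eta> (\<lambda>e. (norm (Y (- s + g) g e))\<^sup>2))"
    by (rule sum[OF F(1), symmetric])
  also have "\<dots> \<le> c (\<lambda>g. cut_trace \<eta> (B g))"
  proof (rule mono)
    fix g
    have "(\<Sum>s\<in>F. cut_trace \<eta> (\<lambda>e. (norm (Y (- s + g) g e))\<^sup>2)) \<le>
        cut_trace \<eta> (\<lambda>e. \<Sum>s\<in>F. (norm (Y (- s + g) g e))\<^sup>2)"
      using \<eta>(1) by (intro cut_trace_sum_ge trace_monotone_norm_square lin) auto
    also have "\<dots> \<le> cut_trace \<eta> (B g)"
      using B[OF F(1)] by (intro cut_trace_mono) simp
    finally show "(\<Sum>s\<in>F. cut_trace \<eta> (\<lambda>e. (norm (Y (- s + g) g e))\<^sup>2)) \<le> cut_trace \<eta> (B g)" .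
  qed
  also have "\<dots> \<le> form_trace B"
    by (rule form_trace_upper[OF \<eta>(1)])
  finally show "c (\<lambda>h. cut_trace \<epsilon> (A h)) \<le> form_trace B" .
qed

end

text \<open>The operators \<open>C g \<circ> x \<circ> V h\<close> are the matrix entries of an operator \<open>x\<close> on \<open>'k\<close>. For the Roe
  algebra, \<open>V g\<close> is the embedding of \<open>H\<close> at the point \<open>(g, 0)\<close> of \<open>G \<times> G\<close>: the algebra leaves
  the subspace over \<open>G \<times> {0}\<close> invariant, and there it acts as on \<open>\<ell>\<^sup>2(G, H)\<close>.\<close>

locale fibration =
  fixes V :: "'g::group_add \<Rightarrow> 'h::complex_hilbert_space \<Rightarrow> 'k::complex_hilbert_space"
    and C :: "'g \<Rightarrow> 'k \<Rightarrow> 'h"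
  assumes V_linear: "complex_linear (V g)"
    and C_linear: "complex_linear (C g)"
    and V_C: "cinner (V g e) \<xi> = cinner e (C g \<xi>)"
    and C_V: "C g (V h e) = (if g = h then e else 0)"
begin

lemma C_V_adjoint: "cinner (C g \<xi>) e = cinner \<xi> (V g e)"
  by (metis V_C cinner_commute)

lemma inner_V: "inner (V g e) \<xi> = inner e (C g \<xi>)"
  using V_C[of g e \<xi>] by (simp flip: Re_cinner)

lemma norm_V: "norm (V g e) = norm e"
proof -
  have "(norm (V g e))\<^sup>2 = (norm e)\<^sup>2"
    unfolding power2_norm_eq_inner inner_V C_V by simp
  then show ?thesis by simp
qed

text \<open>Completing squares over orthogonal fibres: the coordinates of \<xi> are the best choice
  of b. With that choice it yields Bessel's inequality; for other b it bounds the tail of \<xi> by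
  its distance to any vector supported on F.\<close>

lemma norm_diff_sum_V:
  assumes F: "finite F"
  shows "(norm (\<xi> - (\<Sum>g\<in>F. V g (b g))))\<^sup>2 =
    (norm \<xi>)\<^sup>2 - (\<Sum>g\<in>F. (norm (C g \<xi>))\<^sup>2) + (\<Sum>g\<in>F. (norm (b g - C g \<xi>))\<^sup>2)"
proof -
  let ?s = "\<Sum>g\<in>F. V g (b g)"
  have 1: "inner ?s \<xi> = (\<Sum>g\<in>F. inner (b g) (C g \<xi>))"
    by (simp add: inner_sum_left inner_V)
  have "inner ?s ?s = (\<Sum>g\<in>F. inner (b g) (C g ?s))"
    by (simp add: inner_sum_left inner_V)
  also have "\<dots> = (\<Sum>g\<in>F. inner (b g) (b g))"
  proof (intro sum.cong refl)
    fix g assume "g \<in> F"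
    then show "inner (b g) (C g ?s) = inner (b g) (b g)"
      using F by (simp add: complex_linear_sum[OF C_linear] C_V sum.delta)
  qed
  finally have 2: "inner ?s ?s = (\<Sum>g\<in>F. inner (b g) (b g))" .
  have "(\<Sum>g\<in>F. (norm (b g - C g \<xi>))\<^sup>2) =
      (\<Sum>g\<in>F. inner (b g) (b g)) - 2 * (\<Sum>g\<in>F. inner (b g) (C g \<xi>)) + (\<Sum>g\<in>F. (norm (C g \<xi>))\<^sup>2)"
    unfolding power2_norm_eq_inner
    by (simp add: inner_diff_left inner_diff_right inner_commute sum.distrib sum_subtractf
        sum_distrib_left)
  moreover have "(norm (\<xi> - ?s))\<^sup>2 = (norm \<xi>)\<^sup>2 - 2 * inner ?s \<xi> + inner ?s ?s"
    unfolding power2_norm_eq_inner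
    by (simp add: inner_diff_left inner_diff_right inner_commute)
  ultimately show ?thesis by (simp add: 1 2)
qed

lemma sum_norm_C_le:
  assumes "finite F" shows "(\<Sum>g\<in>F. (norm (C g \<xi>))\<^sup>2) \<le> (norm \<xi>)\<^sup>2"
  using norm_diff_sum_V[OF assms, of \<xi> "\<lambda>g. C g \<xi>"]
    zero_le_power2[of "norm (\<xi> - (\<Sum>g\<in>F. V g (C g \<xi>)))"] by simp

text \<open>Finite propagation, tested on the columns over the fibres only. For the Roe algebra the
  fibres do not fill the space, and the condition then also says that their images stay in the span
  of the fibres.\<close>

definition banded :: "'g set \<Rightarrow> ('k \<Rightarrow>\<^sub>L 'k) \<Rightarrow> bool" where
  "banded F z \<longleftrightarrow> finite F \<and> (\<forall>h e. \<exists>b. blinfun_apply z (V h e) = (\<Sum>s\<in>F. V (s + h) (b s)))"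

lemma bandedI:
  assumes "finite F" "\<And>h e. blinfun_apply z (V h e) = (\<Sum>s\<in>F. V (s + h) (b s h e))"
  shows "banded F z"
  unfolding banded_def using assms by (intro conjI allI exI[of _ "\<lambda>s. b s _ _"])

definition band_dominated :: "('k \<Rightarrow>\<^sub>L 'k) \<Rightarrow> bool" where
  "band_dominated x \<longleftrightarrow> (\<forall>\<delta>>0. \<exists>F z. banded F z \<and> norm (x - z) \<le> \<delta>)"

text \<open>The part of a column of x outside F + h is no larger than the distance from x to an
  operator banded by F, a bound uniform in h and e.\<close>

lemma band_dominated_columns:
  assumes x: "band_dominated x" and \<delta>: "0 < \<delta>"
  shows "\<exists>F. finite F \<and> (\<forall>h e. norm e = 1 \<longrightarrow>
    (norm (x (V h e)))\<^sup>2 \<le> (\<Sum>s\<in>F. (norm (C (s + h) (x (V h e))))\<^sup>2) + \<delta>)"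
proof -
  \<comment> \<open>The claim concerns squared norms, hence the accuracy sqrt \<delta>.\<close>
  obtain F z where F: "finite F" "norm (x - z) \<le> sqrt \<delta>"
    and z: "\<And>h e. \<exists>b. blinfun_apply z (V h e) = (\<Sum>s\<in>F. V (s + h) (b s))"
    using x \<delta> unfolding band_dominated_def banded_def by (meson real_sqrt_gt_zero)
  have "(norm (x (V h e)))\<^sup>2 \<le> (\<Sum>s\<in>F. (norm (C (s + h) (x (V h e))))\<^sup>2) + \<delta>"
    if e: "norm e = 1" for h e
  proof -
    have inj: "inj_on (\<lambda>s. s + h) F" by simp
    obtain b where b: "z (V h e) = (\<Sum>s\<in>F. V (s + h) (b s))" using z by blast
    define b' where "b' g = b (g - h)" for g
    have zb: "z (V h e) = (\<Sum>g\<in>(\<lambda>s. s + h) ` F. V g (b' g))"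
      unfolding b by (simp add: sum.reindex[OF inj] b'_def)
    have "norm ((x - z) (V h e)) \<le> norm (x - z) * norm (V h e)" by (rule norm_blinfun)
    also have "\<dots> \<le> sqrt \<delta>" using F(2) e by (simp add: norm_V)
    finally have "(norm (x (V h e) - z (V h e)))\<^sup>2 \<le> (sqrt \<delta>)\<^sup>2"
      by (intro power_mono) (simp_all add: blinfun.diff_left)
    then have "(norm (x (V h e) - (\<Sum>g\<in>(\<lambda>s. s + h) ` F. V g (b' g))))\<^sup>2 \<le> \<delta>"
      using \<delta> by (simp add: zb)
    moreover have "0 \<le> (\<Sum>g\<in>(\<lambda>s. s + h) ` F. (norm (b' g - C g (x (V h e))))\<^sup>2)"
      by (rule sum_nonneg) simp
    ultimately have "(norm (x (V h e)))\<^sup>2 \<le> (\<Sum>g\<in>(\<lambda>s. s + h) ` F. (norm (C g (x (V h e))))\<^sup>2) + \<delta>"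
      using norm_diff_sum_V[of "(\<lambda>s. s + h) ` F" "x (V h e)" b'] F(1) by simp
    then show ?thesis by (simp add: sum.reindex[OF inj])
  qed
  then show ?thesis using F(1) by blast
qed

end

locale invariant_fibration = invariant_functional c + fibration V C
  for c :: "('g::group_add \<Rightarrow> ennreal) \<Rightarrow> ennreal"
    and V :: "'g \<Rightarrow> 'h::complex_hilbert_space \<Rightarrow> 'k::complex_hilbert_space" and C
begin

text \<open>The g-th form belongs to the diagonal entry \<open>C g\<close> a \<open>V g\<close>, so
  that passing to this family is the conditional expectation onto the diagonal.\<close>

definition op_trace :: "('k \<Rightarrow>\<^sub>L 'k) \<Rightarrow> ennreal" where
  "op_trace a = form_trace (\<lambda>g e. inner (a (V g e)) (V g e))"

lemma trace_monotone_positive_op: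
  assumes a: "positive_op a"
  shows "trace_monotone (\<lambda>e. inner (a (V g e)) (V g e))"
proof -
  obtain s where s: "clinear_op s" "\<And>x. inner (a x) x = (norm (s x))\<^sup>2"
    by (rule positive_op_sqrt[OF a]) blast
  have "complex_linear (\<lambda>e. s (V g e))"
    using V_linear[of g] by (simp add: complex_linear_def blinfun.add_right clinear_opD[OF s(1)])
  then show ?thesis
    unfolding s(2) by (rule trace_monotone_norm_square)
qed

text \<open>The forms of y x and x y at \<xi> are |x \<xi>|^2 and |y \<xi>|^2, so the matrix
  inequality applies. Used a second time with x and y exchanged it gives the trace property.\<close>

lemma op_trace_adjoint_le:
  assumes adj: "adjoint_pair x y" and x: "band_dominated x" and y: "clinear_op y"
  shows "op_trace (y o\<^sub>L x) \<le> op_trace (x o\<^sub>L y)"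
proof -
  have 1: "inner ((y o\<^sub>L x) \<xi>) \<xi> = (norm (x \<xi>))\<^sup>2" for \<xi>
    using adjoint_pairD[OF adjoint_pair_sym[OF adj], of "x \<xi>" \<xi>]
    by (simp add: cinner_self flip: Re_cinner)
  have 2: "inner ((x o\<^sub>L y) \<xi>) \<xi> = (norm (y \<xi>))\<^sup>2" for \<xi>
    using adjoint_pairD[OF adj, of "y \<xi>" \<xi>] by (simp add: cinner_self flip: Re_cinner)
  show ?thesis
    unfolding op_trace_def 1 2
  proof (rule form_trace_matrix_le[where X = "\<lambda>g h e. C g (x (V h e))" and Y = "\<lambda>h g e. C h (y (V g e))"])
    fix g h e f
    show "cinner (C g (x (V h e))) f = cinner e (C h (y (V g f)))"
      by (simp add: C_V_adjoint adjoint_pairD[OF adj] V_C)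
    show "complex_linear (\<lambda>e. C g (y (V h e)))"
      using C_linear[of g] V_linear[of h]
      by (simp add: complex_linear_def blinfun.add_right clinear_opD[OF y])
  next
    fix \<delta> :: real assume "0 < \<delta>"
    then show "\<exists>F. finite F \<and> (\<forall>h e. norm e = 1 \<longrightarrow>
        (norm (x (V h e)))\<^sup>2 \<le> (\<Sum>s\<in>F. (norm (C (s + h) (x (V h e))))\<^sup>2) + \<delta>)"
      by (rule band_dominated_columns[OF x])
  next
    fix F g e assume F: "finite (F :: 'g set)"
    have inj: "inj_on (\<lambda>s. - s + g) F" by (auto intro: inj_onI)
    show "(\<Sum>s\<in>F. (norm (C (- s + g) (y (V g e))))\<^sup>2) \<le> (norm (y (V g e)))\<^sup>2"
      using sum_norm_C_le[of "(\<lambda>s. - s + g) ` F" "y (V g e)"] F by (simp add: sum.reindex[OF inj])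
  qed
qed

text \<open>In place of closure of A under adjoints, an adjoint is only required to have the
  properties that \<open>op_trace_adjoint_le\<close> uses.\<close>

lemma trace_on_op_trace:
  assumes "\<And>x. x \<in> A \<Longrightarrow> clinear_op x \<and> band_dominated x"
    and "\<And>x y. x \<in> A \<Longrightarrow> adjoint_pair x y \<Longrightarrow> clinear_op y \<and> band_dominated y"
  shows "trace_on A op_trace"
  unfolding trace_on_def
proof (intro conjI ballI allI impI)
  fix a b assume "a \<in> positive_cone A" "b \<in> positive_cone A"
  then have "positive_op a" "positive_op b" by (auto simp: positive_cone_def)
  then show "op_trace (a + b) = op_trace a + op_trace b"
    by (simp add: op_trace_def blinfun.add_left inner_add_left form_trace_add trace_monotone_positive_op)
next
  fix a and r :: real assume "0 \<le> r"
  then show "op_trace (r *\<^sub>R a) = ennreal r * op_trace a"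
    by (simp add: op_trace_def blinfun.scaleR_left form_trace_scale)
next
  fix x assume x: "x \<in> A"
  then obtain y where y: "adjoint_pair x y"
    using adjoint_pair_exists assms(1) by blast
  then show "op_trace (adjoint_op x o\<^sub>L x) = op_trace (x o\<^sub>L adjoint_op x)"
    using assms x unfolding adjoint_op_eq[OF y]
    by (intro antisym op_trace_adjoint_le) (auto intro: adjoint_pair_sym)
qed

lemma lower_semicontinuous_op_trace: "lower_semicontinuous A op_trace"
  unfolding lower_semicontinuous_def
proof
  fix a assume "a \<in> positive_cone A"
  then have a: "positive_op a" by (simp add: positive_cone_def)
  show "op_trace a = (SUP \<epsilon>\<in>{0<..}. op_trace (positive_part (a - \<epsilon> *\<^sub>R id_blinfun)))"
    unfolding op_trace_def
  proof (rule form_trace_lower_semicontinuous)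
    fix \<epsilon> :: real and g e assume "0 < \<epsilon>" "norm (e :: 'h) = 1"
    then show
      "inner (a (V g e)) (V g e) - \<epsilon> \<le>
        inner (positive_part (a - \<epsilon> *\<^sub>R id_blinfun) (V g e)) (V g e)"
      "inner (positive_part (a - \<epsilon> *\<^sub>R id_blinfun) (V g e)) (V g e) \<le> inner (a (V g e)) (V g e)"
      using positive_part_bounds(2,3)[OF a, of \<epsilon> "V g e"] by (simp_all add: norm_V)
  qed
qed

end

section \<open>Diagonal operators and the Roe algebra\<close>

definition delta :: "'g \<Rightarrow> 'h::complex_hilbert_space \<Rightarrow> ('g, 'h) ell2" where
  "delta g e = Ell2 (\<lambda>t. if t = g then e else 0)"

lemma ell2_apply_delta [simp]: "ell2_apply (delta g e) t = (if t = g then e else 0)"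
proof -
  have "(\<Sum>t\<in>F. (norm (if t = g then e else 0))\<^sup>2) \<le> (norm e)\<^sup>2" if "finite F" for F
    using that by (simp add: if_distrib[of norm] if_distrib[of "\<lambda>x. x\<^sup>2"] sum.delta cong: if_cong)
  then have "square_summable (\<lambda>t. if t = g then e else 0)"
    by (rule square_summable_bdd)
  then show ?thesis by (simp add: delta_def Ell2_inverse)
qed

lemma cinner_delta: "cinner (delta g e) \<xi> = cinner e (ell2_apply \<xi> g)"
proof -
  have "cinner (delta g e) \<xi> = (\<Sum>\<^sub>\<infinity>t. cinner (if t = g then e else 0) (ell2_apply \<xi> t))"
    by (simp add: cinner_ell2.rep_eq)
  also have "\<dots> = (\<Sum>\<^sub>\<infinity>t\<in>{g}. cinner e (ell2_apply \<xi> t))"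
    by (rule infsum_cong_neutral) (auto simp: cinner.zero_left)
  finally show ?thesis by simp
qed

lemma complex_linear_delta: "complex_linear (delta g)"
  unfolding complex_linear_def
  by (auto intro!: ell2_eqI simp: plus_ell2.rep_eq scaleC_ell2.rep_eq scaleC.zero_right)

lemma complex_linear_ell2_apply: "complex_linear (\<lambda>\<xi>. ell2_apply \<xi> g)"
  unfolding complex_linear_def by (simp add: plus_ell2.rep_eq scaleC_ell2.rep_eq)

lemma complex_linear_compose:
  "complex_linear R \<Longrightarrow> complex_linear S \<Longrightarrow> complex_linear (\<lambda>x. R (S x))"
  unfolding complex_linear_def by simp

interpretation linf: fibration
  "delta :: 'g::group_add \<Rightarrow> 'h::complex_hilbert_space \<Rightarrow> _" "\<lambda>g \<xi>. ell2_apply \<xi> g"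
  by standard (simp_all add: complex_linear_delta complex_linear_ell2_apply cinner_delta)

interpretation roe: fibration
  "\<lambda>(g :: 'g::group_add) (e :: 'h::complex_hilbert_space). delta g (delta (0 :: 'g) e)"
  "\<lambda>g \<xi>. ell2_apply (ell2_apply \<xi> g) 0"
  by standard (simp_all add: complex_linear_delta complex_linear_ell2_apply cinner_delta
      complex_linear_compose[of "delta _"] complex_linear_compose[of "\<lambda>\<xi>. ell2_apply \<xi> _"]
      zero_ell2.rep_eq)

section \<open>Columns, norms and adjoints of diagonal and shift operators\<close>

lemma diag_op_delta: "bounded (range a) \<Longrightarrow> diag_op a (delta g e) = delta g (a g e)"
  by (rule ell2_eqI) (simp add: diag_op_apply blinfun.zero_right)

lemma shift_op_delta: "shift_op s (delta h e) = delta (s + h) e"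
proof -
  have "- s + t = h \<longleftrightarrow> t = s + h" for t
    by (metis add.assoc add.left_inverse add.right_inverse add_0)
  then show ?thesis by (intro ell2_eqI) (simp add: shift_op_apply)
qed

text \<open>The bound makes the family of operators under the outer \<open>diag_op\<close> of
  \<open>regular_rep\<close> bounded, so that \<open>diag_op_apply\<close> becomes applicable to
  it.\<close>

lemma norm_diag_op_le:
  assumes le: "\<And>t. norm (a t) \<le> M"
  shows "norm (diag_op a) \<le> M"
proof -
  have M: "0 \<le> M" using le[of undefined] norm_ge_zero order.trans by blast
  have bdd: "bounded (range a)" using le by (auto simp: bounded_iff)
  show ?thesis
  proof (rule norm_blinfun_bound[OF M], rule norm_ell2_le)
    fix \<xi> :: "('a, 'b) ell2" and F :: "'a set" assume F: "finite F"
    have "norm (a t (ell2_apply \<xi> t)) \<le> M * norm (ell2_apply \<xi> t)" for t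
      using norm_blinfun[of "a t"] mult_right_mono[OF le[of t] norm_ge_zero] by (rule order.trans)
    then have "(\<Sum>t\<in>F. (norm (a t (ell2_apply \<xi> t)))\<^sup>2) \<le> (\<Sum>t\<in>F. (M * norm (ell2_apply \<xi> t))\<^sup>2)"
      by (intro sum_mono power_mono) auto
    also have "\<dots> = M\<^sup>2 * (\<Sum>t\<in>F. (norm (ell2_apply \<xi> t))\<^sup>2)"
      by (simp add: power_mult_distrib sum_distrib_left)
    also have "\<dots> \<le> M\<^sup>2 * (norm \<xi>)\<^sup>2"
      by (intro mult_left_mono sum_le_norm_ell2 F) simp
    finally show "(\<Sum>t\<in>F. (norm (ell2_apply (diag_op a \<xi>) t))\<^sup>2) \<le> (M * norm \<xi>)\<^sup>2"
      by (simp add: diag_op_apply[OF bdd] power_mult_distrib)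
  qed (use M in simp)
qed

lemma adjoint_pair_diag_op:
  assumes "\<And>t. adjoint_pair (a t) (b t)" and a: "bounded (range a)"
  shows "adjoint_pair (diag_op a) (diag_op b)"
proof -
  obtain M where "\<And>t. norm (a t) \<le> M" using a by (auto simp: bounded_iff)
  then have "norm (b t) \<le> M" for t
    using norm_adjoint_pair_le[OF assms(1)[of t]] order.trans by blast
  then have b: "bounded (range b)" by (auto simp: bounded_iff)
  show ?thesis
    unfolding adjoint_pair_def
    by (simp add: cinner_ell2.rep_eq diag_op_apply a b adjoint_pairD[OF assms(1)])
qed

lemma adjoint_pair_shift_op: "adjoint_pair (shift_op s) (shift_op (- s))"
  unfolding adjoint_pair_def
proof (intro allI)
  fix \<xi> \<eta> :: "('a, 'b) ell2"
  have bij: "bij_betw (\<lambda>t. - s + t) UNIV UNIV"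
    by (rule bij_betwI[where g = "\<lambda>t. s + t"]) (auto simp: add.assoc[symmetric])
  have "cinner (shift_op s \<xi>) \<eta> = (\<Sum>\<^sub>\<infinity>t. cinner (ell2_apply \<xi> (- s + t)) (ell2_apply \<eta> (s + (- s + t))))"
    by (simp add: cinner_ell2.rep_eq shift_op_apply add.assoc[symmetric])
  also have "\<dots> = (\<Sum>\<^sub>\<infinity>t. cinner (ell2_apply \<xi> t) (ell2_apply \<eta> (s + t)))"
    by (rule infsum_reindex_bij_betw[OF bij])
  also have "\<dots> = cinner \<xi> (shift_op (- s) \<eta>)"
    by (simp add: cinner_ell2.rep_eq shift_op_apply)
  finally show "cinner (shift_op s \<xi>) \<eta> = cinner \<xi> (shift_op (- s) \<eta>)" .
qed

text \<open>Conjugate linearity of the second slot forces linearity of y. Complex linearity of an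
  operator is thus shown by exhibiting it as an adjoint.\<close>

lemma adjoint_pair_clinear: "adjoint_pair x y \<Longrightarrow> clinear_op y"
  unfolding clinear_op_def
  by (intro allI cinner_right_eqI) (simp add: cinner_scaleC_right flip: adjoint_pairD)

lemma adjoint_pair_unique: "adjoint_pair x y \<Longrightarrow> adjoint_pair x z \<Longrightarrow> y = z"
  using adjoint_op_eq by blast

lemma linf_compact_adjoint:
  fixes a :: "'g \<Rightarrow> 'h::complex_hilbert_space \<Rightarrow>\<^sub>L 'h"
  assumes "a \<in> linf_compact"
  shows "bounded (range a)" "\<And>t. adjoint_pair (a t) (adjoint_op (a t))"
    "bounded (range (\<lambda>t. adjoint_op (a t)))"
proof -
  show a: "bounded (range a)" using assms by (simp add: linf_compact_def)
  show adj: "adjoint_pair (a t) (adjoint_op (a t))" for t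
    using assms by (intro adjoint_pair_adjoint_op) (auto simp: linf_compact_def compact_ops_def)
  obtain M where "\<And>t. norm (a t) \<le> M" using a by (auto simp: bounded_iff)
  then have "norm (adjoint_op (a t)) \<le> M" for t
    using norm_adjoint_pair_le[OF adj] order.trans by blast
  then show "bounded (range (\<lambda>t. adjoint_op (a t)))" by (auto simp: bounded_iff)
qed

lemma band_dominated_diag_op:
  assumes "bounded (range a)" shows "linf.band_dominated (diag_op a)"
proof -
  have "linf.banded {0} (diag_op a)"
    by (rule linf.bandedI[where b = "\<lambda>s. a"]) (simp_all add: diag_op_delta[OF assms])
  then show ?thesis
    unfolding linf.band_dominated_def by (metis diff_self less_imp_le norm_zero)
qed

lemma linf_algebra_band_dominated:
  assumes "x \<in> linf_algebra"
  shows "clinear_op x \<and> linf.band_dominated x"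
    and "adjoint_pair x y \<Longrightarrow> clinear_op y \<and> linf.band_dominated y"
proof -
  obtain a where a: "a \<in> linf_compact" "x = diag_op a"
    using assms by (auto simp: linf_algebra_def)
  note adj = linf_compact_adjoint[OF a(1)]
  have pair: "adjoint_pair x (diag_op (\<lambda>t. adjoint_op (a t)))"
    unfolding a(2) by (intro adjoint_pair_diag_op adj)
  show "clinear_op x \<and> linf.band_dominated x"
    using adjoint_pair_clinear[OF adjoint_pair_sym[OF pair]] band_dominated_diag_op[OF adj(1)]
    by (simp add: a(2))
  assume "adjoint_pair x y"
  then show "clinear_op y \<and> linf.band_dominated y"
    using adjoint_pair_clinear[OF pair] band_dominated_diag_op[OF adj(3)] adjoint_pair_unique pair
    by blast
qed

text \<open>The operator over g is \<open>diag_op (left_translate (- g) a)\<close>, and this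
  translate takes the value a g at 0. Hence 0 is the base point of the fibres.\<close>

lemma regular_rep_delta:
  fixes a :: "'g::group_add \<Rightarrow> 'h::complex_hilbert_space \<Rightarrow>\<^sub>L 'h"
  assumes a: "bounded (range a)"
  shows "regular_rep diag_op left_translate a (delta g (delta 0 e)) = delta g (delta 0 (a g e))"
proof -
  obtain M where M: "\<And>t. norm (a t) \<le> M" using a by (auto simp: bounded_iff)
  have bdd: "bounded (range (left_translate s a))" for s
    using M by (auto simp: bounded_iff left_translate_def)
  have "norm (diag_op (left_translate s a)) \<le> M" for s
    using M by (intro norm_diag_op_le) (simp add: left_translate_def)
  then have "bounded (range (\<lambda>t. diag_op (left_translate (- t) a)))"
    by (auto simp: bounded_iff)
  then show ?thesis
    by (simp only: regular_rep_def diag_op_delta bdd) (simp add: left_translate_def)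
qed

lemma adjoint_pair_regular_rep:
  fixes a b :: "'g::group_add \<Rightarrow> 'h::complex_hilbert_space \<Rightarrow>\<^sub>L 'h"
  assumes a: "bounded (range a)" and adj: "\<And>t. adjoint_pair (a t) (b t)"
  shows "adjoint_pair (regular_rep diag_op left_translate a) (regular_rep diag_op left_translate b)"
proof -
  obtain M where M: "\<And>t. norm (a t) \<le> M" using a by (auto simp: bounded_iff)
  have bdd: "bounded (range (left_translate s a))" for s
    using M by (auto simp: bounded_iff left_translate_def)
  have "norm (diag_op (left_translate s a)) \<le> M" for s
    using M by (intro norm_diag_op_le) (simp add: left_translate_def)
  then have "bounded (range (\<lambda>t. diag_op (left_translate (- t) a)))"
    by (auto simp: bounded_iff)
  moreover have "adjoint_pair (left_translate s a t) (left_translate s b t)" for s t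
    by (simp add: left_translate_def adj)
  ultimately show ?thesis
    unfolding regular_rep_def by (intro adjoint_pair_diag_op bdd)
qed

text \<open>The adjoint is written out with \<open>shift_op (- s)\<close> to the left of the adjoint
  coefficient; in this form it visibly moves columns by - s and is banded as well.\<close>

lemma crossed_product_sum_band:
  fixes a :: "'g::group_add \<Rightarrow> 'g \<Rightarrow> 'h::complex_hilbert_space \<Rightarrow>\<^sub>L 'h"
  assumes F: "finite F" and a: "\<And>s. s \<in> F \<Longrightarrow> a s \<in> linf_compact"
  defines "x \<equiv> \<Sum>s\<in>F. regular_rep diag_op left_translate (a s) o\<^sub>L shift_op s"
  shows "\<exists>x' F'. adjoint_pair x x' \<and> roe.banded F x \<and> roe.banded F' x'"
proof -
  define b where "b s t = adjoint_op (a s t)" for s t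
  define x' where "x' = (\<Sum>s\<in>F. shift_op (- s) o\<^sub>L regular_rep diag_op left_translate (b s))"
  have "adjoint_pair x x'"
    unfolding x_def x'_def using linf_compact_adjoint[OF a]
    by (intro adjoint_pair_sum adjoint_pair_compose adjoint_pair_shift_op adjoint_pair_regular_rep)
      (auto simp: b_def)
  moreover have "x (delta h (delta 0 e)) = (\<Sum>s\<in>F. delta (s + h) (delta 0 (a s (s + h) e)))" for h e
    unfolding x_def using linf_compact_adjoint(1)[OF a]
    by (simp add: blinfun.sum_left shift_op_delta regular_rep_delta)
  then have "roe.banded F x"
    by (rule roe.bandedI[OF F, where b = "\<lambda>s h. a s (s + h)"])
  moreover have "x' (delta h (delta 0 e)) =
      (\<Sum>s\<in>uminus ` F. delta (s + h) (delta 0 (b (- s) h e)))" for h e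
  proof -
    have "x' (delta h (delta 0 e)) = (\<Sum>s\<in>F. delta (- s + h) (delta 0 (b s h e)))"
      unfolding x'_def using linf_compact_adjoint(3)[OF a]
      by (simp add: blinfun.sum_left shift_op_delta regular_rep_delta b_def)
    then show ?thesis by (simp add: sum.reindex)
  qed
  then have "roe.banded (uminus ` F) x'"
    by (rule roe.bandedI[OF finite_imageI[OF F], where b = "\<lambda>s. b (- s)"])
  ultimately show ?thesis by blast
qed

section \<open>Elements of the Roe algebra as limits of banded operators\<close>

lemma closed_clinear_op: "closed {x. clinear_op x}"
proof -
  have "closed {x. blinfun_apply x (scaleC c \<xi>) = scaleC c (blinfun_apply x \<xi>)}"
    for c and \<xi> :: "'a::complex_hilbert_space"
    by (intro closed_Collect_eq continuous_intros
        bounded_linear.continuous_on[OF scaleC.bounded_linear_right])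
  then show ?thesis
    unfolding clinear_op_def by (intro closed_Collect_all)
qed

text \<open>The approximants come with banded adjoints because these approximate the adjoint of x
  with the same error.\<close>

lemma roe_algebra_approx:
  fixes x :: "('g::group_add, ('g, 'h::complex_hilbert_space) ell2) ell2 \<Rightarrow>\<^sub>L ('g, ('g, 'h) ell2) ell2"
  assumes x: "x \<in> roe_algebra" and \<delta>: "0 < \<delta>"
  shows "\<exists>z z' F F'. norm (x - z) \<le> \<delta> \<and> adjoint_pair z z' \<and> roe.banded F z \<and> roe.banded F' z'"
proof -
  obtain z where z: "dist z x < \<delta>"
    "z \<in> {\<Sum>s\<in>F. regular_rep diag_op left_translate (a s) o\<^sub>L shift_op s |F a.
      finite F \<and> (\<forall>s\<in>F. a s \<in> linf_compact)}"
    using x \<delta> unfolding roe_algebra_def reduced_crossed_product_def closure_approachable by blast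
  then obtain F a where F: "finite F" "\<And>s. s \<in> F \<Longrightarrow> a s \<in> linf_compact"
    and za: "z = (\<Sum>s\<in>F. regular_rep diag_op left_translate (a s) o\<^sub>L shift_op s)"
    by blast
  have "norm (x - z) \<le> \<delta>" using z(1) by (simp add: dist_norm norm_minus_commute)
  then show ?thesis
    using crossed_product_sum_band[of F a, OF F] unfolding za[symmetric] by blast
qed

lemma roe_algebra_band_dominated:
  fixes x y :: "('g::group_add, ('g, 'h::complex_hilbert_space) ell2) ell2 \<Rightarrow>\<^sub>L ('g, ('g, 'h) ell2) ell2"
  assumes x: "x \<in> roe_algebra"
  shows "clinear_op x \<and> roe.band_dominated x"
    and "adjoint_pair x y \<Longrightarrow> clinear_op y \<and> roe.band_dominated y"
proof -
  have "x \<in> {x. clinear_op x}"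
    using x unfolding roe_algebra_def reduced_crossed_product_def
  proof (rule subsetD[OF closure_minimal[OF _ closed_clinear_op], rotated])
    show "{\<Sum>s\<in>F. regular_rep diag_op left_translate (a s) o\<^sub>L shift_op s |F a.
        finite F \<and> (\<forall>s\<in>F. (a :: 'g \<Rightarrow> 'g \<Rightarrow> 'h \<Rightarrow>\<^sub>L 'h) s \<in> linf_compact)} \<subseteq> {x. clinear_op x}"
    proof clarify
      fix F and a :: "'g \<Rightarrow> 'g \<Rightarrow> 'h \<Rightarrow>\<^sub>L 'h"
      assume F: "finite F" "\<forall>s\<in>F. a s \<in> linf_compact"
      then obtain x' where
        "adjoint_pair (\<Sum>s\<in>F. regular_rep diag_op left_translate (a s) o\<^sub>L shift_op s) x'"
        using crossed_product_sum_band[OF F(1), of a] by blast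
      then show "clinear_op (\<Sum>s\<in>F. regular_rep diag_op left_translate (a s) o\<^sub>L shift_op s)"
        by (intro adjoint_pair_clinear[OF adjoint_pair_sym])
    qed
  qed
  moreover have "roe.band_dominated x"
    unfolding roe.band_dominated_def using roe_algebra_approx[OF x] by blast
  ultimately show "clinear_op x \<and> roe.band_dominated x" by simp
  assume y: "adjoint_pair x y"
  have "\<exists>F z. roe.banded F z \<and> norm (y - z) \<le> \<delta>" if \<delta>: "0 < \<delta>" for \<delta>
  proof -
    obtain z z' F' where z: "norm (x - z) \<le> \<delta>" "adjoint_pair z z'" "roe.banded F' z'"
      using roe_algebra_approx[OF x \<delta>] by blast
    have "norm (y - z') \<le> \<delta>"
      using norm_adjoint_pair_le[OF adjoint_pair_diff[OF y z(2)]] z(1) by simp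
    then show ?thesis using z(3) by blast
  qed
  then show "clinear_op y \<and> roe.band_dominated y"
    using adjoint_pair_clinear[OF y] by (simp add: roe.band_dominated_def)
qed

section \<open>The two traces and their common value on a projection\<close>

context invariant_functional
begin

text \<open>On the embedded copies both traces see the forms of p(g) fibre by fibre, so a single
  normalisation serves for \<open>diag_op p\<close> and \<open>roe_embedding p\<close>.\<close>

lemma traces_from_functional:
  fixes p :: "'g \<Rightarrow> 'h::complex_hilbert_space \<Rightarrow>\<^sub>L 'h"
  assumes p: "p \<in> linf_compact"
  shows "\<exists>\<tau>. trace_on linf_algebra \<tau> \<and> lower_semicontinuous linf_algebra \<tau> \<and>
      invariant_on_linf \<tau> \<and> \<tau> (diag_op p) = form_trace (\<lambda>g e. inner (p g e) e)"
    and "\<exists>\<tau>. trace_on roe_algebra \<tau> \<and> lower_semicontinuous roe_algebra \<tau> \<and>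
      \<tau> (roe_embedding p) = form_trace (\<lambda>g e. inner (p g e) e)"
proof -
  interpret L: invariant_fibration c "delta :: 'g \<Rightarrow> 'h \<Rightarrow> _" "\<lambda>g \<xi>. ell2_apply \<xi> g"
    by unfold_locales
  interpret R: invariant_fibration c "\<lambda>(g :: 'g) (e :: 'h). delta g (delta (0 :: 'g) e)"
    "\<lambda>g \<xi>. ell2_apply (ell2_apply \<xi> g) 0"
    by unfold_locales
  have val: "L.op_trace (diag_op a) = form_trace (\<lambda>g e. inner (a g e) e)"
    if "a \<in> linf_compact" for a
    by (simp add: L.op_trace_def diag_op_delta[OF linf_compact_adjoint(1)[OF that]] linf.inner_V)
  have inv: "form_trace (\<lambda>g. q (s + g)) = form_trace q" for q :: "'g \<Rightarrow> 'h \<Rightarrow> real" and s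
    unfolding form_trace_def using invariant[of "\<lambda>g. cut_trace _ (q g)" s] by simp
  have "left_translate s a \<in> linf_compact" if "a \<in> linf_compact" for s and a :: "'g \<Rightarrow> 'h \<Rightarrow>\<^sub>L 'h"
    using that bounded_subset[of "range a" "range (left_translate s a)"]
    by (auto simp: linf_compact_def left_translate_def)
  then have "invariant_on_linf L.op_trace"
    unfolding invariant_on_linf_def
    using inv by (auto simp: val left_translate_def)
  moreover have "trace_on linf_algebra L.op_trace"
    by (rule L.trace_on_op_trace) (use linf_algebra_band_dominated in blast)+
  ultimately show "\<exists>\<tau>. trace_on linf_algebra \<tau> \<and> lower_semicontinuous linf_algebra \<tau> \<and>
      invariant_on_linf \<tau> \<and> \<tau> (diag_op p) = form_trace (\<lambda>g e. inner (p g e) e)"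
    using L.lower_semicontinuous_op_trace val[OF p] by blast
  have "R.op_trace (roe_embedding p) = form_trace (\<lambda>g e. inner (p g e) e)"
    by (simp add: R.op_trace_def roe_embedding_def regular_rep_delta[OF linf_compact_adjoint(1)[OF p]]
        roe.inner_V)
  moreover have "trace_on roe_algebra R.op_trace"
    by (rule R.trace_on_op_trace) (use roe_algebra_band_dominated in blast)+
  ultimately show "\<exists>\<tau>. trace_on roe_algebra \<tau> \<and> lower_semicontinuous roe_algebra \<tau> \<and>
      \<tau> (roe_embedding p) = form_trace (\<lambda>g e. inner (p g e) e)"
    using R.lower_semicontinuous_op_trace by blast
qed

lemma form_trace_eq_1:
  assumes f: "c (\<lambda>g. of_nat (f g)) = 1"
    and upper: "\<And>\<epsilon> g. 0 < \<epsilon> \<Longrightarrow> cut_trace \<epsilon> (q g) \<le> of_nat (f g)"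
    and lower: "\<And>\<epsilon> g. \<epsilon> \<le> 1 \<Longrightarrow> ennreal (1 - \<epsilon>) * of_nat (f g) \<le> cut_trace \<epsilon> (q g)"
  shows "form_trace q = 1"
proof (rule antisym)
  show "form_trace q \<le> 1"
    unfolding f[symmetric] by (intro form_trace_least mono upper)
  have le: "ennreal (1 - \<epsilon>) \<le> form_trace q" if "0 < \<epsilon>" "\<epsilon> \<le> 1" for \<epsilon>
  proof -
    have "ennreal (1 - \<epsilon>) = c (\<lambda>g. ennreal (1 - \<epsilon>) * of_nat (f g))"
      using that f by (simp add: scale)
    also have "\<dots> \<le> c (\<lambda>g. cut_trace \<epsilon> (q g))" by (intro mono lower that)
    also have "\<dots> \<le> form_trace q" by (rule form_trace_upper[OF that(1)])
    finally show ?thesis .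
  qed
  show "1 \<le> form_trace q"
  proof (cases "form_trace q")
    case (real r)
    have "1 \<le> r"
    proof (rule field_le_epsilon)
      fix e :: real assume e: "0 < e"
      \<comment> \<open>The lower bound is available for \<epsilon> at most 1, hence the
        minimum.\<close>
      then have "ennreal (1 - min e 1) \<le> ennreal r" using le[of "min e 1"] real by simp
      then have "1 - min e 1 \<le> r" using real(1) by (simp add: ennreal_le_iff)
      then show "1 \<le> r + e" by linarith
    qed
    then show ?thesis using real ennreal_leI[of 1 r] by simp
  qed simp
qed

end

section \<open>The space of all real functions with the topology of pointwise convergence\<close>

abbreviation pointwise_topology :: "('i \<Rightarrow> real) topology" where
  "pointwise_topology \<equiv> product_topology (\<lambda>_. euclideanreal) UNIV"

lemma openin_coordinate_box:
  assumes "finite K"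
  shows "openin pointwise_topology {x :: 'i \<Rightarrow> real. \<forall>i\<in>K. \<bar>x i\<bar> < e}"
  using product_topology_basis'[OF assms, of "\<lambda>_. {-e<..<e}" "\<lambda>i. i"]
  by (simp add: euclidean_product_topology abs_less_iff minus_less_iff conj_commute)

lemma pointwise_neighbourhood:
  assumes U: "openin pointwise_topology (U :: ('i \<Rightarrow> real) set)" "(\<lambda>_. 0) \<in> U"
  obtains K e where "finite K" "0 < e" "{x. \<forall>i\<in>K. \<bar>x i\<bar> < e} \<subseteq> U"
proof -
  obtain X where X: "(\<lambda>_. 0) \<in> (\<Pi>\<^sub>E i\<in>UNIV. X i)" "\<And>i :: 'i. open (X i :: real set)"
    "finite {i. X i \<noteq> UNIV}" "(\<Pi>\<^sub>E i\<in>UNIV. X i) \<subseteq> U"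
    using product_topology_open_contains_basis[OF U] by auto
  let ?K = "{i. X i \<noteq> UNIV}"
  have "\<exists>e>0. \<forall>y. \<bar>y\<bar> < e \<longrightarrow> y \<in> X i" for i
  proof -
    have "0 \<in> X i" using X(1) by auto
    then obtain e where "0 < e" "ball 0 e \<subseteq> X i"
      using X(2) open_contains_ball by blast
    then show ?thesis by (intro exI[of _ e]) auto
  qed
  then obtain r where r: "\<And>i. 0 < r i" "\<And>i y. \<bar>y\<bar> < r i \<Longrightarrow> y \<in> X i" by metis
  define e where "e = Min (insert 1 (r ` ?K))"
  have "0 < e" "\<And>i. i \<in> ?K \<Longrightarrow> e \<le> r i"
    using X(3) r(1) by (auto simp: e_def)
  then have "{x. \<forall>i\<in>?K. \<bar>x i\<bar> < e} \<subseteq> (\<Pi>\<^sub>E i\<in>UNIV. X i)"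
    using r(2) by (fastforce simp: PiE_def)
  then show thesis using that[OF X(3) \<open>0 < e\<close>] X(4) by blast
qed

lemma continuous_map_coordinate: "continuous_map pointwise_topology euclideanreal (\<lambda>x. x i)"
  by (rule continuous_map_product_projection) simp

interpretation pointwise: locally_convex_space
  "pointwise_topology :: ('i \<Rightarrow> real) topology" "\<lambda>x y i. x i + y i" "\<lambda>_. 0" "\<lambda>r x i. r * x i"
proof
  show "continuous_map (prod_topology pointwise_topology pointwise_topology) pointwise_topology
      (\<lambda>(x, y) (i :: 'i). x i + y i)"
    unfolding continuous_map_componentwise_UNIV case_prod_unfold
    by (intro allI continuous_map_add continuous_map_compose[OF continuous_map_fst
        continuous_map_coordinate, unfolded o_def] continuous_map_compose[OF continuous_map_snd
        continuous_map_coordinate, unfolded o_def])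
  show "continuous_map (prod_topology euclideanreal pointwise_topology) pointwise_topology
      (\<lambda>(r, x) (i :: 'i). r * x i)"
    unfolding continuous_map_componentwise_UNIV case_prod_unfold
    by (intro allI continuous_map_real_mult continuous_map_fst continuous_map_compose[OF
        continuous_map_snd continuous_map_coordinate, unfolded o_def])
  show "Hausdorff_space (pointwise_topology :: ('i \<Rightarrow> real) topology)"
    by (simp add: Hausdorff_space_product_topology)
next
  fix U :: "('i \<Rightarrow> real) set"
  assume "openin pointwise_topology U" "(\<lambda>_. 0) \<in> U"
  then obtain K e where K: "finite K" "0 < e" "{x. \<forall>i\<in>K. \<bar>x i\<bar> < e} \<subseteq> U"
    by (rule pointwise_neighbourhood)
  have conv: "\<bar>(1 - r) * a + r * b\<bar> < e" if "\<bar>a\<bar> < e" "\<bar>b\<bar> < e" "0 \<le> r" "r \<le> 1" for a b r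
  proof -
    have "(1 - r) *\<^sub>R a + r *\<^sub>R b \<in> {-e<..<e}"
      using that by (intro convexD_alt convex_real_interval) auto
    then show ?thesis by auto
  qed
  show "\<exists>W. openin pointwise_topology W \<and> (\<lambda>_. 0) \<in> W \<and> W \<subseteq> U \<and>
      (\<forall>x\<in>W. \<forall>y\<in>W. \<forall>r. 0 \<le> r \<and> r \<le> 1 \<longrightarrow> (\<lambda>i. (1 - r) * x i + r * y i) \<in> W)"
    using K conv openin_coordinate_box[OF K(1), of e]
    by (intro exI[of _ "{x. \<forall>i\<in>K. \<bar>x i\<bar> < e}"]) simp
qed (auto simp: algebra_simps)

lemma coordinate_in_dual: "(\<lambda>x. x i) \<in> pointwise.dual"
  by (simp add: pointwise.dual_def continuous_map_coordinate)

text \<open>Continuity bounds the functional by 1 on a box over finitely many coordinates K. By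
  scaling it vanishes at every function that is 0 on K, so only the coordinates in K count.\<close>

lemma pointwise_dual_finite_sum:
  assumes \<phi>: "\<phi> \<in> pointwise.dual"
  shows "\<exists>K a. finite K \<and> \<phi> = (\<lambda>x. \<Sum>i\<in>K. a i * x i)"
proof -
  have cont: "continuous_map pointwise_topology euclideanreal \<phi>"
    and add: "\<And>x y. \<phi> (\<lambda>i. x i + y i) = \<phi> x + \<phi> y"
    and scale: "\<And>r x. \<phi> (\<lambda>i. r * x i) = r * \<phi> x"
    using \<phi> by (auto simp: pointwise.dual_def)
  have zero: "\<phi> (\<lambda>_. 0) = 0" using scale[of 0] by simp
  have "openin pointwise_topology {x \<in> topspace pointwise_topology. \<phi> x \<in> {-1<..<1}}"
    by (rule openin_continuous_map_preimage[OF cont]) simp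
  then obtain K e where K: "finite K" "0 < e"
    "{x. \<forall>i\<in>K. \<bar>x i\<bar> < e} \<subseteq> {x \<in> topspace pointwise_topology. \<phi> x \<in> {-1<..<1}}"
    by (rule pointwise_neighbourhood) (simp add: zero)
  have vanish: "\<phi> x = 0" if x: "\<And>i. i \<in> K \<Longrightarrow> x i = 0" for x
  proof (rule ccontr)
    assume "\<phi> x \<noteq> 0"
    then have "\<phi> (\<lambda>i. (1 / \<phi> x) * x i) = 1" unfolding scale by simp
    moreover have "(\<lambda>i. (1 / \<phi> x) * x i) \<in> {x. \<forall>i\<in>K. \<bar>x i\<bar> < e}"
      using x K(2) by simp
    ultimately show False using subsetD[OF K(3)] by fastforce
  qed
  have sum: "\<phi> (\<lambda>i. \<Sum>k\<in>L. y k i) = (\<Sum>k\<in>L. \<phi> (y k))" for y and L :: "'i set"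
    by (induction L rule: infinite_finite_induct) (simp_all add: zero add)
  have "\<phi> x = (\<Sum>k\<in>K. \<phi> (\<lambda>i. if i = k then 1 else 0) * x k)" for x
  proof -
    let ?e = "\<lambda>k i. if i = k then 1 else 0 :: real"
    have "\<phi> x = \<phi> (\<lambda>i. (x i + (-1) * (\<Sum>k\<in>K. x k * ?e k i)) + (\<Sum>k\<in>K. x k * ?e k i))"
      by simp
    also have "\<dots> = \<phi> (\<lambda>i. x i + (-1) * (\<Sum>k\<in>K. x k * ?e k i)) + (\<Sum>k\<in>K. \<phi> (\<lambda>i. x k * ?e k i))"
      unfolding add sum ..
    also have "\<phi> (\<lambda>i. x i + (-1) * (\<Sum>k\<in>K. x k * ?e k i)) = 0"
      using K(1) by (intro vanish) (simp add: if_distrib[of "(*) _"] cong: if_cong)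
    finally show ?thesis
      by (simp only: scale add_0 mult.commute)
  qed
  then show ?thesis
    using K(1) by (intro exI[of _ K] exI[of _ "\<lambda>k. \<phi> (\<lambda>i. if i = k then 1 else 0)"] conjI ext)
qed

section \<open>Invariant functionals from the fixed-point property\<close>

text \<open>Lists allow repetitions, so integer multiples of translates are included and no scalar
  factor appears; this is also the shape of the bound in \<open>cobounded_type\<close>.\<close>

definition dominated :: "('g::group_add \<Rightarrow> real) \<Rightarrow> ('g \<Rightarrow> real) set" where
  "dominated f = {h. \<exists>ts. \<forall>x. \<bar>h x\<bar> \<le> (\<Sum>t\<leftarrow>ts. left_translate t f x)}"

lemma dominatedI: "(\<And>x. \<bar>h x\<bar> \<le> (\<Sum>t\<leftarrow>ts. left_translate t f x)) \<Longrightarrow> h \<in> dominated f"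
  by (auto simp: dominated_def)

lemma left_translate_zero [simp]: "left_translate 0 f = f"
  by (simp add: left_translate_def)

lemma left_translate_translate: "left_translate s (left_translate t f) = left_translate (s + t) f"
  by (simp add: left_translate_def minus_add add.assoc del: add_uminus_conv_diff)

lemma dominated_mono: "k \<in> dominated f \<Longrightarrow> (\<And>x. \<bar>h x\<bar> \<le> \<bar>k x\<bar>) \<Longrightarrow> h \<in> dominated f"
  unfolding dominated_def by (blast intro: order.trans)

lemma dominated_add:
  assumes "h \<in> dominated f" "k \<in> dominated f" shows "(\<lambda>x. h x + k x) \<in> dominated f"
proof -
  obtain ss ts where "\<And>x. \<bar>h x\<bar> \<le> (\<Sum>t\<leftarrow>ss. left_translate t f x)"
    "\<And>x. \<bar>k x\<bar> \<le> (\<Sum>t\<leftarrow>ts. left_translate t f x)"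
    using assms by (auto simp: dominated_def)
  then show ?thesis
    by (intro dominatedI[where ts = "ss @ ts"]) (simp add: order.trans[OF abs_triangle_ineq] add_mono)
qed

lemma dominated_scale:
  assumes "h \<in> dominated f" shows "(\<lambda>x. r * h x) \<in> dominated f"
proof -
  have nat: "(\<lambda>x. real n * h x) \<in> dominated f" for n
  proof (induction n)
    case 0
    show ?case using assms by (rule dominated_mono) simp
  next
    case (Suc n)
    show ?case using dominated_add[OF Suc assms] by (simp add: algebra_simps)
  qed
  obtain n where "\<bar>r\<bar> \<le> real n" using real_arch_simple by blast
  then show ?thesis
    by (intro dominated_mono[OF nat[of n]]) (simp add: abs_mult mult_right_mono)
qed

lemma dominated_translate:
  assumes "h \<in> dominated f" shows "left_translate s h \<in> dominated f"
proof -
  obtain ts where ts: "\<And>x. \<bar>h x\<bar> \<le> (\<Sum>t\<leftarrow>ts. left_translate t f x)"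
    using assms by (auto simp: dominated_def)
  have "\<bar>left_translate s h x\<bar> \<le> (\<Sum>t\<leftarrow>map ((+) s) ts. left_translate t f x)" for x
    using ts[of "- s + x"]
    by (simp add: left_translate_def minus_add add.assoc o_def del: add_uminus_conv_diff)
  then show ?thesis by (rule dominatedI)
qed

locale growth =
  fixes f :: "'g::group_add \<Rightarrow> real"
  assumes nonneg: "0 \<le> f g"
begin

abbreviation E :: "('g \<Rightarrow> real) set" where "E \<equiv> dominated f"

lemma f_in_E: "f \<in> E"
  using nonneg by (intro dominatedI[where ts = "[0]"]) simp

lemma zero_in_E: "(\<lambda>_. 0) \<in> E"
  using f_in_E by (rule dominated_mono) simp

text \<open>Positive functionals on \<open>E\<close>, extended by \<open>0\<close>. They are regarded as elements of the space of all
  functions on \<open>'g \<Rightarrow> real\<close>, linear or not, because the dual of that space consists of the finite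
  linear combinations of coordinates.\<close>

definition cone :: "(('g \<Rightarrow> real) \<Rightarrow> real) set" where
  "cone = {x. (\<forall>h. h \<notin> E \<longrightarrow> x h = 0) \<and>
    (\<forall>h\<in>E. \<forall>k\<in>E. x (\<lambda>g. h g + k g) = x h + x k) \<and>
    (\<forall>r. \<forall>h\<in>E. x (\<lambda>g. r * h g) = r * x h) \<and>
    (\<forall>h\<in>E. (\<forall>g. 0 \<le> h g) \<longrightarrow> 0 \<le> x h)}"

definition act :: "'g \<Rightarrow> (('g \<Rightarrow> real) \<Rightarrow> real) \<Rightarrow> ('g \<Rightarrow> real) \<Rightarrow> real" where
  "act t x = (\<lambda>h. x (left_translate (- t) h))"

lemma cone_outside: "x \<in> cone \<Longrightarrow> h \<notin> E \<Longrightarrow> x h = 0"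
  and cone_add: "x \<in> cone \<Longrightarrow> h \<in> E \<Longrightarrow> k \<in> E \<Longrightarrow> x (\<lambda>g. h g + k g) = x h + x k"
  and cone_scale: "x \<in> cone \<Longrightarrow> h \<in> E \<Longrightarrow> x (\<lambda>g. r * h g) = r * x h"
  and cone_nonneg: "x \<in> cone \<Longrightarrow> h \<in> E \<Longrightarrow> (\<And>g. 0 \<le> h g) \<Longrightarrow> 0 \<le> x h"
  by (auto simp: cone_def)

lemma cone_zero: "x \<in> cone \<Longrightarrow> x (\<lambda>_. 0) = 0"
  using cone_scale[OF _ zero_in_E, of x 0] by simp

lemma cone_mono:
  assumes x: "x \<in> cone" and "h \<in> E" "k \<in> E" "\<And>g. h g \<le> k g"
  shows "x h \<le> x k"
proof -
  have d: "(\<lambda>g. k g + (-1) * h g) \<in> E"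
    by (intro dominated_add dominated_scale assms)
  have "x k = x (\<lambda>g. (k g + (-1) * h g) + h g)" by simp
  also have "\<dots> = x (\<lambda>g. k g + (-1) * h g) + x h"
    by (rule cone_add[OF x d assms(2)])
  finally show ?thesis
    using cone_nonneg[OF x d] assms(4) by simp
qed

text \<open>E contains the positive and negative parts of its elements, so the values on nonnegative
  functions determine a functional in the cone.\<close>

lemma cone_eq_zero:
  assumes x: "x \<in> cone" and "\<And>h. h \<in> E \<Longrightarrow> (\<And>g. 0 \<le> h g) \<Longrightarrow> x h = 0"
  shows "x = (\<lambda>_. 0)"
proof
  fix h
  show "x h = 0"
  proof (cases "h \<in> E")
    case True
    have p: "(\<lambda>g. max (h g) 0) \<in> E" and m: "(\<lambda>g. max (- h g) 0) \<in> E"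
      by (rule dominated_mono[OF True], simp add: max_def)+
    have "h = (\<lambda>g. max (h g) 0 + (-1) * max (- h g) 0)"
      by (auto simp: max_def)
    then have "x h = x (\<lambda>g. max (h g) 0 + (-1) * max (- h g) 0)" by (rule arg_cong)
    also have "\<dots> = x (\<lambda>g. max (h g) 0) + (-1) * x (\<lambda>g. max (- h g) 0)"
      unfolding cone_add[OF x p dominated_scale[OF m]] cone_scale[OF x m] ..
    also have "\<dots> = 0" using assms(2) p m by simp
    finally show ?thesis .
  qed (rule cone_outside[OF x])
qed

lemma sum_in_E:
  assumes "finite K" "K \<subseteq> E"
  shows "(\<lambda>g. \<Sum>h\<in>K. a h * h g) \<in> E"
    and "x \<in> cone \<Longrightarrow> x (\<lambda>g. \<Sum>h\<in>K. a h * h g) = (\<Sum>h\<in>K. a h * x h)"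
proof -
  have E: "(\<lambda>g. \<Sum>h\<in>K. a h * h g) \<in> E" if "finite K" "K \<subseteq> E" for K
    using that
    by (induction K rule: finite_induct) (auto intro!: zero_in_E dominated_add dominated_scale)
  then show "(\<lambda>g. \<Sum>h\<in>K. a h * h g) \<in> E" using assms by blast
  assume x: "x \<in> cone"
  show "x (\<lambda>g. \<Sum>h\<in>K. a h * h g) = (\<Sum>h\<in>K. a h * x h)"
    using assms
  proof (induction K rule: finite_induct)
    case (insert h K)
    then show ?case
      using cone_add[OF x dominated_scale E] cone_scale[OF x] by simp
  qed (simp add: cone_zero[OF x])
qed

lemma sum_translates:
  "(\<lambda>g. \<Sum>t\<leftarrow>ts. left_translate t f g) \<in> E"
  "x \<in> cone \<Longrightarrow> x (\<lambda>g. \<Sum>t\<leftarrow>ts. left_translate t f g) = (\<Sum>t\<leftarrow>ts. x (left_translate t f))"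
proof -
  have E: "(\<lambda>g. \<Sum>t\<leftarrow>ts. left_translate t f g) \<in> E" for ts
    by (induction ts) (auto intro!: zero_in_E dominated_add dominated_translate f_in_E)
  then show "(\<lambda>g. \<Sum>t\<leftarrow>ts. left_translate t f g) \<in> E" .
  assume x: "x \<in> cone"
  show "x (\<lambda>g. \<Sum>t\<leftarrow>ts. left_translate t f g) = (\<Sum>t\<leftarrow>ts. x (left_translate t f))"
    by (induction ts)
      (simp_all add: cone_zero[OF x] cone_add[OF x dominated_translate[OF f_in_E] E])
qed

lemma cone_abs_le:
  assumes x: "x \<in> cone" and h: "h \<in> E" and k: "k \<in> E" and le: "\<And>g. \<bar>h g\<bar> \<le> k g"
  shows "\<bar>x h\<bar> \<le> x k"
proof -
  have "x h \<le> x k" by (rule cone_mono[OF x h k]) (meson le abs_le_D1)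
  moreover have "x (\<lambda>g. (-1) * h g) \<le> x k"
    by (rule cone_mono[OF x dominated_scale[OF h] k]) (use le in \<open>simp add: abs_le_iff\<close>)
  ultimately show ?thesis unfolding cone_scale[OF x h] by linarith
qed

lemma act_cone:
  assumes x: "x \<in> cone" shows "act t x \<in> cone"
proof -
  have E: "left_translate (- t) h \<in> E \<longleftrightarrow> h \<in> E" for h
    using dominated_translate[of h f "- t"] dominated_translate[of "left_translate (- t) h" f t]
    by (auto simp: left_translate_translate)
  have lin: "left_translate (- t) (\<lambda>g. h g + k g) = (\<lambda>g. left_translate (- t) h g + left_translate (- t) k g)"
    "left_translate (- t) (\<lambda>g. r * h g) = (\<lambda>g. r * left_translate (- t) h g)" for h k r
    by (simp_all add: left_translate_def)
  show ?thesis
    unfolding cone_def act_def mem_Collect_eq lin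
  proof (intro conjI allI ballI impI)
    fix h assume "h \<in> E" "\<forall>g. 0 \<le> h g"
    then show "0 \<le> x (left_translate (- t) h)"
      using E by (intro cone_nonneg[OF x]) (auto simp: left_translate_def)
  qed (use E cone_outside[OF x] cone_add[OF x] cone_scale[OF x] in auto)
qed

text \<open>All defining conditions of \<open>cone\<close> are closed under pointwise limits. This
  serves weak completeness as well as the cluster point of evaluations.\<close>

lemma cone_limit:
  assumes F: "F \<noteq> bot" and cone: "\<forall>\<^sub>F x in F. x \<in> cone" and lim: "\<And>h. ((\<lambda>x. x h) \<longlongrightarrow> c h) F"
  shows "c \<in> cone"
  unfolding cone_def mem_Collect_eq
proof (intro conjI allI ballI impI)
  fix h assume "h \<notin> E"
  then have "\<forall>\<^sub>F x in F. x h = 0" by (intro eventually_mono[OF cone]) (rule cone_outside)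
  then show "c h = 0"
    using tendsto_unique[OF F lim tendsto_eventually] by blast
next
  fix h k assume hk: "h \<in> E" "k \<in> E"
  have "\<forall>\<^sub>F x in F. x h + x k = x (\<lambda>g. h g + k g)"
    by (intro eventually_mono[OF cone]) (simp add: cone_add hk)
  from Lim_transform_eventually[OF tendsto_add[OF lim lim] this]
  show "c (\<lambda>g. h g + k g) = c h + c k"
    using tendsto_unique[OF F lim] by blast
next
  fix r h assume h: "h \<in> E"
  have "\<forall>\<^sub>F x in F. r * x h = x (\<lambda>g. r * h g)"
    by (intro eventually_mono[OF cone]) (simp add: cone_scale h)
  from Lim_transform_eventually[OF tendsto_mult[OF tendsto_const lim] this]
  show "c (\<lambda>g. r * h g) = r * c h"
    using tendsto_unique[OF F lim] by blast
next
  fix h assume h: "h \<in> E" "\<forall>g. 0 \<le> h g"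
  then have "\<forall>\<^sub>F x in F. 0 \<le> x h"
    by (intro eventually_mono[OF cone]) (simp add: cone_nonneg)
  then show "0 \<le> c h" by (rule tendsto_lowerbound[OF lim _ F])
qed

section \<open>The hypotheses of the fixed-point property for the cone of positive
  functionals\<close>

lemma convex_cone: "pointwise.convex_cone cone"
  unfolding pointwise.convex_cone_def
  by (auto simp: cone_def algebra_simps)

lemma proper_cone: "pointwise.proper_cone cone"
  unfolding pointwise.proper_cone_def
proof (intro equalityI subsetI)
  fix x assume "x \<in> cone \<inter> (\<lambda>x i. - 1 * x i) ` cone"
  then obtain y where x: "x \<in> cone" and y: "y \<in> cone" "x = (\<lambda>i. - 1 * y i)" by blast
  have "x h = 0" if "h \<in> E" "\<And>g. 0 \<le> h g" for h
    using cone_nonneg[OF x that] cone_nonneg[OF y(1) that] y(2) by simp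
  then have "x = (\<lambda>_. 0)" by (rule cone_eq_zero[OF x])
  then show "x \<in> {\<lambda>_. 0}" by simp
next
  fix x :: "('g \<Rightarrow> real) \<Rightarrow> real" assume "x \<in> {\<lambda>_. 0}"
  then have "x = (\<lambda>_. 0)" "x = (\<lambda>i. - 1 * x i)" by auto
  moreover have "(\<lambda>_. 0) \<in> cone" by (simp add: cone_def)
  ultimately show "x \<in> cone \<inter> (\<lambda>x i. - 1 * x i) ` cone" by (metis IntI image_eqI)
qed

text \<open>Coordinates belong to the dual, so a weakly Cauchy filter converges in each coordinate.
  Conversely every element of the dual is a finite combination of coordinates, so this convergence
  is weak convergence.\<close>

lemma weakly_complete: "pointwise.weakly_complete cone"
  unfolding pointwise.weakly_complete_def
proof (intro allI impI, elim conjE)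
  fix F :: "(('g \<Rightarrow> real) \<Rightarrow> real) filter"
  assume F: "F \<noteq> bot" "F \<le> principal cone" and Cauchy: "pointwise.weakly_Cauchy F"
  have "\<exists>l. ((\<lambda>x. x h) \<longlongrightarrow> l) F" for h
  proof -
    have "cauchy_filter (filtermap (\<lambda>x. x h) F)"
      unfolding cauchy_filter_def uniformity_dist
    proof (intro INF_greatest)
      fix e :: real assume "e \<in> {0<..}"
      then have "\<forall>\<^sub>F (x, y) in F \<times>\<^sub>F F. \<bar>x h - y h\<bar> < e"
        using Cauchy coordinate_in_dual[of h] unfolding pointwise.weakly_Cauchy_def by auto
      then show "filtermap (\<lambda>x. x h) F \<times>\<^sub>F filtermap (\<lambda>x. x h) F \<le> principal {(x, y). dist x y < e}"
        by (simp add: le_principal prod_filtermap1 prod_filtermap2 eventually_filtermap dist_real_def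
            case_prod_unfold)
    qed
    then have "\<exists>l. filtermap (\<lambda>x. x h) F \<le> nhds l"
      using F(1) by (intro cauchy_filter_complete_converges[OF _ complete_UNIV])
        (auto simp: filtermap_bot_iff)
    then show ?thesis by (simp add: filterlim_def)
  qed
  then obtain c where c: "\<And>h. ((\<lambda>x. x h) \<longlongrightarrow> c h) F" by metis
  have "c \<in> cone"
    using F c by (intro cone_limit[of F]) (simp_all add: le_principal)
  moreover have "(\<phi> \<longlongrightarrow> \<phi> c) F" if \<phi>: "\<phi> \<in> pointwise.dual" for \<phi>
  proof -
    obtain K a where "\<phi> = (\<lambda>x. \<Sum>i\<in>K. a i * x i)"
      using pointwise_dual_finite_sum[OF \<phi>] by blast
    then show ?thesis by (auto intro!: tendsto_intros c)
  qed
  ultimately show "\<exists>c\<in>cone. \<forall>\<phi>\<in>pointwise.dual. (\<phi> \<longlongrightarrow> \<phi> c) F" by blast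
qed

lemma linear_action: "pointwise.linear_action act"
  unfolding pointwise.linear_action_def pointwise.linear_map_def
proof (intro conjI allI ballI)
  fix t
  show "continuous_map pointwise_topology pointwise_topology (act t)"
    unfolding continuous_map_componentwise_UNIV act_def by (intro allI continuous_map_coordinate)
qed (simp_all add: act_def left_translate_translate minus_add)

text \<open>The functional is evaluation at f. On the cone a finite combination of coordinates is
  evaluation at a function in E, since coordinates outside E vanish there, and that function lies
  below a sum of translates of f.\<close>

lemma cobounded_type: "pointwise.cobounded_type act cone"
  unfolding pointwise.cobounded_type_def
proof (intro bexI[of _ "\<lambda>x. x f"] conjI ballI coordinate_in_dual)
  fix x assume "x \<in> cone"
  then show "0 \<le> x f" using f_in_E nonneg by (rule cone_nonneg)
next
  fix \<psi> :: "(('g \<Rightarrow> real) \<Rightarrow> real) \<Rightarrow> real" assume "\<psi> \<in> pointwise.dual"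
  then obtain K a where K: "finite K" "\<psi> = (\<lambda>x. \<Sum>h\<in>K. a h * x h)"
    using pointwise_dual_finite_sum by blast
  let ?k = "\<lambda>g. \<Sum>h\<in>K \<inter> E. a h * h g"
  have k: "?k \<in> E" using K(1) by (intro sum_in_E) auto
  then obtain ts where ts: "\<And>g. \<bar>?k g\<bar> \<le> (\<Sum>t\<leftarrow>ts. left_translate t f g)"
    by (auto simp: dominated_def)
  \<comment> \<open>The extra 0 makes the list nonempty; it adds x f, which is nonnegative.\<close>
  have "\<psi> x \<le> (\<Sum>t\<leftarrow>0 # ts. act (- t) x f)" if x: "x \<in> cone" for x
  proof -
    have "\<psi> x = (\<Sum>h\<in>K \<inter> E. a h * x h)"
      unfolding K(2) using K(1) cone_outside[OF x] by (intro sum.mono_neutral_right) auto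
    also have "\<dots> = x ?k" using K(1) x by (intro sum_in_E(2)[symmetric]) auto
    also have "\<dots> \<le> x (\<lambda>g. \<Sum>t\<leftarrow>ts. left_translate t f g)"
      by (rule cone_mono[OF x k sum_translates(1)]) (rule abs_le_D1[OF ts])
    also have "\<dots> = (\<Sum>t\<leftarrow>ts. act (- t) x f)"
      by (simp add: sum_translates(2)[OF x] act_def)
    also have "\<dots> \<le> (\<Sum>t\<leftarrow>0 # ts. act (- t) x f)"
      using cone_nonneg[OF x f_in_E nonneg] by (simp add: act_def)
    finally show ?thesis .
  qed
  then show "\<exists>ts. ts \<noteq> [] \<and> (\<forall>c\<in>cone. \<psi> c \<le> (\<Sum>t\<leftarrow>ts. act (- t) c f))"
    by (intro exI[of _ "0 # ts"]) auto
qed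

text \<open>In the pointwise topology a set is bounded if it is bounded in each coordinate. If n
  translates of f dominate h, then every functional in the orbit of b is at most n in absolute value
  at h.\<close>

lemma locally_bounded:
  assumes b: "b \<in> cone" "b f = 1" "\<And>t. b (left_translate t f) \<le> 1"
  shows "pointwise.locally_bounded act cone"
  unfolding pointwise.locally_bounded_def
proof (intro bexI[OF _ b(1)] conjI)
  show "b \<noteq> (\<lambda>_. 0)" using b(2) by auto
  have "\<exists>M. \<forall>t. \<bar>act t b h\<bar> \<le> M" for h
  proof (cases "h \<in> E")
    case True
    then obtain ts where ts: "\<And>g. \<bar>h g\<bar> \<le> (\<Sum>t\<leftarrow>ts. left_translate t f g)"
      by (auto simp: dominated_def)
    have "\<bar>act s b h\<bar> \<le> real (length ts)" for s
    proof -
      have "\<bar>act s b h\<bar> \<le> act s b (\<lambda>g. \<Sum>t\<leftarrow>ts. left_translate t f g)"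
        by (rule cone_abs_le[OF act_cone[OF b(1)] True sum_translates(1) ts])
      also have "\<dots> = (\<Sum>t\<leftarrow>ts. b (left_translate (- s + t) f))"
        unfolding sum_translates(2)[OF act_cone[OF b(1)]] by (simp add: act_def left_translate_translate)
      also have "\<dots> \<le> (\<Sum>t\<leftarrow>ts. 1)"
        by (intro sum_list_mono b(3))
      finally show ?thesis by (simp add: sum_list_triv)
    qed
    then show ?thesis by blast
  next
    case False
    then show ?thesis
      using cone_outside[OF act_cone[OF b(1)]] by (intro exI[of _ 0]) simp
  qed
  then obtain M where M: "\<And>t h. \<bar>act t b h\<bar> \<le> M h" by metis
  show "pointwise.bounded_set (range (\<lambda>t. act t b))"
    unfolding pointwise.bounded_set_def
  proof (intro allI impI, elim conjE)
    fix U :: "(('g \<Rightarrow> real) \<Rightarrow> real) set"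
    assume "openin pointwise_topology U" "(\<lambda>_. 0) \<in> U"
    then obtain K e where K: "finite K" "0 < e" "{x. \<forall>i\<in>K. \<bar>x i\<bar> < e} \<subseteq> U"
      by (rule pointwise_neighbourhood)
    have M0: "0 \<le> M h" for h using M[of 0 h] by linarith
    \<comment> \<open>The summand 1 makes r positive and the bound by r e strict.\<close>
    define r where "r = ((\<Sum>h\<in>K. M h) + 1) / e"
    have r: "0 < r" using K(2) M0 by (simp add: r_def add_nonneg_pos sum_nonneg)
    have "act t b \<in> (\<lambda>x i. r * x i) ` U" for t
    proof (rule image_eqI)
      show "act t b = (\<lambda>i. r * (act t b i / r))" using r by simp
      have "\<bar>act t b h / r\<bar> < e" if "h \<in> K" for h
      proof -
        have "\<bar>act t b h\<bar> \<le> (\<Sum>h\<in>K. M h)"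
          using M[of t h] member_le_sum[of h K M] that M0 K(1) by (meson order.trans)
        also have "\<dots> < r * e" using K(2) by (simp add: r_def)
        finally show ?thesis using r by (simp add: field_simps)
      qed
      then show "(\<lambda>i. act t b i / r) \<in> U" by (intro subsetD[OF K(3)]) simp
    qed
    then show "\<exists>r>0. range (\<lambda>t. act t b) \<subseteq> (\<lambda>x i. r * x i) ` U"
      using r by blast
  qed
qed

text \<open>The functional with bounded orbit is a cluster point of the normalised point evaluations.\<close>

lemma bounded_orbit_exists:
  fixes X :: "nat \<Rightarrow> 'g"
  assumes pos: "\<And>n. 0 < f (X n)"
    and growth: "\<And>t e. 0 < e \<Longrightarrow> \<forall>\<^sub>F n in sequentially. f (t + X n) \<le> (1 + e) * f (X n)"
  obtains b where "b \<in> cone" "b f = 1" "\<And>t. b (left_translate t f) \<le> 1"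
proof -
  \<comment> \<open>Evaluation at \<open>X n\<close>, normalised at f, and set to 0 outside E as
    \<open>cone\<close> demands.\<close>
  define ev where "ev n h = (if h \<in> E then h (X n) / f (X n) else 0)" for n and h :: "'g \<Rightarrow> real"
  have ev_cone: "ev n \<in> cone" for n
    using pos[of n] by (auto simp: cone_def ev_def dominated_add dominated_scale add_divide_distrib)
  have ev_translate: "\<forall>\<^sub>F n in sequentially. ev n (left_translate t f) \<le> 1 + e" if "0 < e" for t e
    using growth[OF that, of "- t"]
  proof (rule eventually_mono)
    fix n assume "f (- t + X n) \<le> (1 + e) * f (X n)"
    then show "ev n (left_translate t f) \<le> 1 + e"
      using pos[of n] dominated_translate[OF f_in_E]
      by (simp add: ev_def left_translate_def field_simps)
  qed
  have "\<exists>M. \<forall>n. \<bar>ev n h\<bar> \<le> M" for h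
  proof (cases "h \<in> E")
    case True
    then obtain ts where ts: "\<And>g. \<bar>h g\<bar> \<le> (\<Sum>t\<leftarrow>ts. left_translate t f g)"
      by (auto simp: dominated_def)
    have "\<forall>\<^sub>F n in sequentially. \<forall>t\<in>set ts. ev n (left_translate t f) \<le> 1 + 1"
      using ev_translate[of 1] by (simp add: eventually_ball_finite_distrib)
    then have "\<forall>\<^sub>F n in sequentially. norm (ev n h) \<le> 2 * real (length ts)"
    proof (rule eventually_mono)
      fix n assume *: "\<forall>t\<in>set ts. ev n (left_translate t f) \<le> 1 + 1"
      have "\<bar>ev n h\<bar> \<le> ev n (\<lambda>g. \<Sum>t\<leftarrow>ts. left_translate t f g)"
        by (rule cone_abs_le[OF ev_cone True sum_translates(1) ts])
      also have "\<dots> \<le> (\<Sum>t\<leftarrow>ts. 2)"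
        unfolding sum_translates(2)[OF ev_cone] using * by (intro sum_list_mono) auto
      finally show "norm (ev n h) \<le> 2 * real (length ts)" by (simp add: sum_list_triv)
    qed
    \<comment> \<open>The estimate holds from some n on; the finitely many earlier values are
      bounded anyway.\<close>
    then have "Bseq (\<lambda>n. ev n h)" by (rule BfunI)
    then show ?thesis by (auto simp: Bseq_def)
  qed (auto simp: ev_def intro!: exI[of _ 0])
  then obtain M where M: "\<And>n h. \<bar>ev n h\<bar> \<le> M h" by metis
  have "compactin pointwise_topology (\<Pi>\<^sub>E h\<in>UNIV. {- M h..M h})"
    by (simp add: compactin_PiE)
  then have "compact (\<Pi>\<^sub>E h\<in>UNIV. {- M h..M h})"
    by (simp add: euclidean_product_topology)
  moreover have "ev n \<in> (\<Pi>\<^sub>E h\<in>UNIV. {- M h..M h})" for n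
    using M by (auto simp: abs_le_iff minus_le_iff)
  \<comment> \<open>There are uncountably many coordinates, so a convergent subsequence need not
    exist; limits are taken along a filter finer than the tails.\<close>
  ultimately obtain b where b: "inf (nhds b) (filtermap ev sequentially) \<noteq> bot"
    unfolding compact_filter by (metis (no_types, lifting) always_eventually eventually_filtermap
      filtermap_bot_iff sequentially_bot)
  define F where "F = inf (nhds b) (filtermap ev sequentially)"
  have F: "F \<noteq> bot" using b by (simp add: F_def)
  have evF: "eventually P F" if "\<forall>\<^sub>F n in sequentially. P (ev n)" for P
    using that filter_leD[of F "filtermap ev sequentially" P] by (simp add: F_def eventually_filtermap)
  have lim: "((\<lambda>x. x h) \<longlongrightarrow> b h) F" for h
  proof (rule tendsto_mono)
    show "F \<le> nhds b" by (simp add: F_def)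
    have "((\<lambda>x. x h) \<longlongrightarrow> b h) (at b)"
      using continuous_on_product_coordinates[of h] unfolding continuous_on_def by blast
    then show "((\<lambda>x. x h) \<longlongrightarrow> b h) (nhds b)"
      using tendsto_at_iff_tendsto_nhds[of "\<lambda>x. x h" b] by simp
  qed
  show thesis
  proof (rule that[of b])
    show "b \<in> cone"
      using ev_cone by (intro cone_limit[OF F _ lim] evF) simp
    have "\<forall>\<^sub>F x in F. x f = 1"
      using pos f_in_E by (intro evF always_eventually) (simp add: ev_def less_imp_neq[THEN not_sym])
    then show "b f = 1"
      using tendsto_unique[OF F lim tendsto_eventually] by blast
    fix t
    show "b (left_translate t f) \<le> 1"
    proof (rule field_le_epsilon)
      fix e :: real assume "0 < e"
      then have "\<forall>\<^sub>F x in F. x (left_translate t f) \<le> 1 + e"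
        by (intro evF ev_translate)
      then show "b (left_translate t f) \<le> 1 + e"
        by (rule tendsto_upperbound[OF lim _ F])
    qed
  qed
qed

text \<open>A fixed point that vanished at f would vanish at all its translates, hence at everything
  they dominate. So the fixed point is positive at f and can be normalised there.\<close>

lemma invariant_element_exists:
  assumes fpp: "fixed_point_property_for_cones TYPE('g) TYPE(('g \<Rightarrow> real) \<Rightarrow> real)"
    and b: "b \<in> cone" "b f = 1" "\<And>t. b (left_translate t f) \<le> 1"
  obtains c where "c \<in> cone" "c f = 1" "\<And>t h. c (left_translate t h) = c h"
proof -
  have "\<exists>x\<in>cone. x \<noteq> (\<lambda>_. 0) \<and> (\<forall>t. act t x = x)"
    using fpp unfolding fixed_point_property_for_cones_def
  proof (elim allE impE)
    show "locally_convex_space pointwise_topology (\<lambda>x y i. x i + y i) (\<lambda>_. 0) (\<lambda>r x i. r * x i) \<and>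
      pointwise.linear_action act \<and> pointwise.convex_cone cone \<and> (\<forall>t. act t ` cone \<subseteq> cone) \<and>
      pointwise.proper_cone cone \<and> pointwise.weakly_complete cone \<and>
      pointwise.cobounded_type act cone \<and> pointwise.locally_bounded act cone"
      using pointwise.locally_convex_space_axioms linear_action convex_cone act_cone proper_cone
        weakly_complete cobounded_type locally_bounded[OF b]
      by (intro conjI allI image_subsetI)
  qed
  then obtain x where x: "x \<in> cone" "x \<noteq> (\<lambda>_. 0)" "\<And>t. act t x = x" by blast
  have inv: "x (left_translate t h) = x h" for t h
    using fun_cong[OF x(3)[of "- t"], of h] by (simp add: act_def)
  have "x f \<noteq> 0"
  proof
    assume 0: "x f = 0"
    have "x h = 0" if h: "h \<in> E" "\<And>g. 0 \<le> h g" for h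
    proof -
      obtain ts where "\<And>g. \<bar>h g\<bar> \<le> (\<Sum>t\<leftarrow>ts. left_translate t f g)"
        using h(1) by (auto simp: dominated_def)
      from cone_abs_le[OF x(1) h(1) sum_translates(1) this]
      show ?thesis by (simp add: sum_translates(2)[OF x(1)] inv 0)
    qed
    then show False using cone_eq_zero[OF x(1)] x(2) by blast
  qed
  then have pos: "0 < x f"
    using cone_nonneg[OF x(1) f_in_E nonneg] by simp
  show thesis
  proof (rule that[of "\<lambda>h. (1 / x f) * x h"])
    show "(\<lambda>h. (1 / x f) * x h) \<in> cone"
    proof -
      have "\<forall>r\<ge>0. \<forall>x\<in>cone. (\<lambda>h. r * x h) \<in> cone"
        using convex_cone unfolding pointwise.convex_cone_def by blast
      then show ?thesis using x(1) pos by (metis less_imp_le zero_le_divide_1_iff)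
    qed
  qed (use pos inv in auto)
qed

text \<open>An extension from below, like a lower integral. It is additive because E is solid: the
  minimum of a nonnegative function in E with any F is again in E.\<close>

definition extended :: "(('g \<Rightarrow> real) \<Rightarrow> real) \<Rightarrow> ('g \<Rightarrow> ennreal) \<Rightarrow> ennreal" where
  "extended c F = (SUP h\<in>{h \<in> E. \<forall>g. 0 \<le> h g \<and> ennreal (h g) \<le> F g}. ennreal (c h))"

lemma extended_upper:
  "h \<in> E \<Longrightarrow> (\<And>g. 0 \<le> h g) \<Longrightarrow> (\<And>g. ennreal (h g) \<le> F g) \<Longrightarrow> ennreal (c h) \<le> extended c F"
  unfolding extended_def by (rule SUP_upper) auto

lemma extended_least:
  "(\<And>h. h \<in> E \<Longrightarrow> (\<And>g. 0 \<le> h g) \<Longrightarrow> (\<And>g. ennreal (h g) \<le> F g) \<Longrightarrow> ennreal (c h) \<le> y) \<Longrightarrow>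
    extended c F \<le> y"
  unfolding extended_def by (rule SUP_least) auto

lemma extended_eq:
  assumes c: "c \<in> cone" and h: "h \<in> E" "\<And>g. 0 \<le> h g"
  shows "extended c (\<lambda>g. ennreal (h g)) = ennreal (c h)"
proof (rule antisym)
  show "extended c (\<lambda>g. ennreal (h g)) \<le> ennreal (c h)"
    using h by (intro extended_least ennreal_leI cone_mono[OF c]) auto
qed (rule extended_upper[OF h], simp)

lemma extended_add:
  assumes c: "c \<in> cone"
  shows "extended c (\<lambda>g. F g + F' g) = extended c F + extended c F'"
proof (rule antisym)
  show "extended c (\<lambda>g. F g + F' g) \<le> extended c F + extended c F'"
  proof (rule extended_least)
    fix h assume h: "h \<in> E" "\<And>g. 0 \<le> h g" "\<And>g. ennreal (h g) \<le> F g + F' g"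
    \<comment> \<open>The part of h below F, finite since h is; the rest h - u lies below
      F'.\<close>
    define u where "u g = enn2real (min (ennreal (h g)) (F g))" for g
    have u_enn: "ennreal (u g) = min (ennreal (h g)) (F g)" for g
      unfolding u_def by (rule ennreal_enn2real) (simp add: min_less_iff_disj)
    have u: "0 \<le> u g" for g by (simp add: u_def)
    have uh: "u g \<le> h g" for g
      using u_enn[of g] h(2)[of g] by (metis ennreal_le_iff min.cobounded1)
    have u_le: "ennreal (u g) \<le> F g" for g by (simp add: u_enn)
    have uE: "u \<in> E"
      by (rule dominated_mono[OF h(1)]) (use u uh h(2) in simp)
    have vE: "(\<lambda>g. h g - u g) \<in> E"
      by (rule dominated_mono[OF h(1)]) (use u uh h(2) in simp)
    have v_le: "ennreal (h g - u g) \<le> F' g" for g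
    proof (cases "ennreal (h g) \<le> F g")
      case True
      then have "ennreal (u g) = ennreal (h g)" by (simp add: u_enn min_def)
      then have "u g = h g" using u h(2) by (simp add: ennreal_inj)
      then show ?thesis by simp
    next
      case False
      then have "F g = ennreal (u g)" by (simp add: u_enn min_def)
      then have "ennreal (u g) + ennreal (h g - u g) \<le> ennreal (u g) + F' g"
        using h(3)[of g] u[of g] uh[of g] by (simp flip: ennreal_plus)
      then show ?thesis by (simp add: ennreal_add_left_cancel_le)
    qed
    have "c h = c (\<lambda>g. u g + (h g - u g))" by simp
    also have "\<dots> = c u + c (\<lambda>g. h g - u g)" by (rule cone_add[OF c uE vE])
    finally have "ennreal (c h) = ennreal (c u) + ennreal (c (\<lambda>g. h g - u g))"
      using cone_nonneg[OF c uE u] cone_nonneg[OF c vE] uh by simp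
    also have "\<dots> \<le> extended c F + extended c F'"
      using uh by (intro add_mono extended_upper uE u u_le vE v_le) simp
    finally show "ennreal (c h) \<le> extended c F + extended c F'" .
  qed
  have ne: "{h \<in> E. \<forall>g. 0 \<le> h g \<and> ennreal (h g) \<le> F g} \<noteq> {}" for F
    using zero_in_E by fastforce
  have sup: "extended c F + extended c F' \<le> y"
    if y: "\<And>h k. \<lbrakk>h \<in> E; \<And>g. 0 \<le> h g; \<And>g. ennreal (h g) \<le> F g;
      k \<in> E; \<And>g. 0 \<le> k g; \<And>g. ennreal (k g) \<le> F' g\<rbrakk> \<Longrightarrow> ennreal (c h) + ennreal (c k) \<le> y" for y
    unfolding extended_def ennreal_SUP_add_left[OF ne, symmetric]
  proof (rule SUP_least)
    fix h assume h: "h \<in> {h \<in> E. \<forall>g. 0 \<le> h g \<and> ennreal (h g) \<le> F g}"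
    show "ennreal (c h) + (SUP k\<in>{h \<in> E. \<forall>g. 0 \<le> h g \<and> ennreal (h g) \<le> F' g}. ennreal (c k)) \<le> y"
      unfolding ennreal_SUP_add_right[OF ne] using h by (intro SUP_least y) auto
  qed
  show "extended c F + extended c F' \<le> extended c (\<lambda>g. F g + F' g)"
  proof (rule sup)
    fix h k assume h: "h \<in> E" "\<And>g. 0 \<le> h g" "\<And>g. ennreal (h g) \<le> F g"
      and k: "k \<in> E" "\<And>g. 0 \<le> k g" "\<And>g. ennreal (k g) \<le> F' g"
    have "ennreal (c h) + ennreal (c k) = ennreal (c (\<lambda>g. h g + k g))"
      using cone_nonneg[OF c h(1,2)] cone_nonneg[OF c k(1,2)]
      by (simp add: cone_add[OF c h(1) k(1)])
    also have "\<dots> \<le> extended c (\<lambda>g. F g + F' g)"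
      using h k by (intro extended_upper dominated_add) (auto simp: add_mono)
    finally show "ennreal (c h) + ennreal (c k) \<le> extended c (\<lambda>g. F g + F' g)" .
  qed
qed

lemma extended_scale_le:
  assumes c: "c \<in> cone" and r: "0 < r"
  shows "extended c (\<lambda>g. ennreal r * F g) \<le> ennreal r * extended c F"
proof (rule extended_least)
  fix h assume h: "h \<in> E" "\<And>g. 0 \<le> h g" "\<And>g. ennreal (h g) \<le> ennreal r * F g"
  let ?k = "\<lambda>g. (1 / r) * h g"
  have k: "?k \<in> E" by (rule dominated_scale[OF h(1)])
  have "ennreal (?k g) \<le> F g" for g
  proof -
    have "ennreal (?k g) = ennreal (1 / r) * ennreal (h g)"
      using r h(2) by (simp only: ennreal_mult zero_le_divide_1_iff less_imp_le)
    also have "\<dots> \<le> ennreal (1 / r) * (ennreal r * F g)"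
      by (intro mult_left_mono h) simp
    also have "\<dots> = F g"
      using r by (simp add: mult.assoc[symmetric] flip: ennreal_mult)
    finally show ?thesis .
  qed
  then have "ennreal r * ennreal (c ?k) \<le> ennreal r * extended c F"
    using r h(2) by (intro mult_left_mono extended_upper k) auto
  moreover have "ennreal r * ennreal (c ?k) = ennreal (c h)"
    unfolding cone_scale[OF c h(1)] using r cone_nonneg[OF c h(1,2)] by (simp flip: ennreal_mult)
  ultimately show "ennreal (c h) \<le> ennreal r * extended c F" by simp
qed

lemma invariant_functional_extended:
  assumes c: "c \<in> cone" and inv: "\<And>t h. c (left_translate t h) = c h"
  shows "invariant_functional (extended c)"
proof
  fix F F' :: "'g \<Rightarrow> ennreal" and r :: real and s
  show "extended c F \<le> extended c F'" if "\<And>g. F g \<le> F' g"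
    using that by (intro extended_least extended_upper) (auto intro: order.trans)
  show "extended c (\<lambda>g. F g + F' g) = extended c F + extended c F'"
    by (rule extended_add[OF c])
  show "extended c (\<lambda>g. ennreal r * F g) = ennreal r * extended c F" if "0 \<le> r"
  proof (cases "r = 0")
    case True
    then show ?thesis
      using extended_eq[OF c zero_in_E] cone_zero[OF c] by simp
  next
    case False
    then have r: "0 < r" using that by simp
    have "ennreal r * extended c F = ennreal r * extended c (\<lambda>g. ennreal (1 / r) * (ennreal r * F g))"
      using r by (simp add: mult.assoc[symmetric] flip: ennreal_mult)
    also have "\<dots> \<le> ennreal r * (ennreal (1 / r) * extended c (\<lambda>g. ennreal r * F g))"
      using r by (intro mult_left_mono extended_scale_le[OF c]) auto
    also have "\<dots> = extended c (\<lambda>g. ennreal r * F g)"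
      using r by (simp add: mult.assoc[symmetric] flip: ennreal_mult)
    finally show ?thesis using extended_scale_le[OF c r, of F] by (rule antisym[rotated])
  qed
  \<comment> \<open>One inequality for all F and s; translating back by - s gives the other.\<close>
  have le: "extended c (\<lambda>g. F (s + g)) \<le> extended c F" for F s
  proof (rule extended_least)
    fix h assume h: "h \<in> E" "\<And>g. 0 \<le> h g" "\<And>g. ennreal (h g) \<le> F (s + g)"
    have "ennreal (left_translate s h g) \<le> F g" for g
      using h(3)[of "- s + g"] by (simp add: left_translate_def add.assoc[symmetric])
    then have "ennreal (c (left_translate s h)) \<le> extended c F"
      using h by (intro extended_upper dominated_translate) (auto simp: left_translate_def)
    then show "ennreal (c h) \<le> extended c F" by (simp add: inv)
  qed
  show "extended c (\<lambda>g. F (s + g)) = extended c F"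
    using le[of F s] le[of "\<lambda>g. F (s + g)" "- s"] by (intro antisym) (simp_all add: add.assoc[symmetric])
qed

end

text \<open>If no n had \<alpha>(n + m) at most (1 + 1/(m+1)) \<alpha>(n) with \<alpha>(n) > 0, the
  liminf for m would exceed 1. So such an n exists for each m, and X m is a point of length at most
  n where \<alpha>(n) is attained. The index m serves as radius and as accuracy at once: t + X m has
  length at most n + m as soon as l t \<le> m.\<close>

lemma subexponential_growth_points:
  fixes N :: "'g::group_add \<Rightarrow> nat"
  assumes l: "proper_length_function l" and dim: "\<And>t. Tr (p t) = of_nat (N t)"
    and lim: "\<And>m. liminf (\<lambda>n. max_dim l p (n + m) / max_dim l p n) = 1"
    and t0: "0 < N t0"
  obtains X :: "nat \<Rightarrow> 'g" where "\<And>n. 0 < N (X n)"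
    "\<And>t e. 0 < e \<Longrightarrow> \<forall>\<^sub>F n in sequentially. real (N (t + X n)) \<le> (1 + e) * real (N (X n))"
proof -
  define \<alpha> where "\<alpha> n = Max (N ` {t. l t \<le> n})" for n
  have fin: "finite {t. l t \<le> n}" and ne: "{t. l t \<le> n} \<noteq> {}" for n
  proof -
    show "finite {t. l t \<le> n}" using l by (simp add: proper_length_function_def)
    have "l 0 = 0" using l unfolding proper_length_function_def by blast
    then have "0 \<in> {t. l t \<le> n}" by simp
    then show "{t. l t \<le> n} \<noteq> {}" by blast
  qed
  have N_le: "N t \<le> \<alpha> n" if "l t \<le> n" for t n
    unfolding \<alpha>_def using fin that by (intro Max_ge) auto
  have \<alpha>_att: "\<exists>t. l t \<le> n \<and> N t = \<alpha> n" for n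
  proof -
    have "\<alpha> n \<in> N ` {t. l t \<le> n}"
      unfolding \<alpha>_def using fin[of n] ne[of n] by (intro Max_in) simp_all
    then show ?thesis by (auto simp: image_iff)
  qed
  have max_dim: "max_dim l p n = ennreal (real (\<alpha> n))" for n
  proof -
    have "max_dim l p n = Max ((\<lambda>k. ennreal (real k)) ` (N ` {t. l t \<le> n}))"
      by (simp add: max_dim_def dim image_image ennreal_of_nat_eq_real_of_nat)
    also have "\<dots> = ennreal (real (\<alpha> n))"
      unfolding \<alpha>_def using fin ne
      by (intro mono_Max_commute[symmetric]) (auto intro!: monoI ennreal_leI)
    finally show ?thesis .
  qed
  have "\<exists>n. 0 < \<alpha> n \<and> real (\<alpha> (n + m)) \<le> (1 + 1 / real (Suc m)) * real (\<alpha> n)" for m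
  proof (rule ccontr)
    assume "\<not> ?thesis"
    then have *: "(1 + 1 / real (Suc m)) * real (\<alpha> n) < real (\<alpha> (n + m))" if "0 < \<alpha> n" for n
      using that by (meson not_le)
    have "\<forall>\<^sub>F n in sequentially.
        ennreal (1 + 1 / real (Suc m)) \<le> max_dim l p (n + m) / max_dim l p n"
    proof (rule eventually_sequentiallyI)
      \<comment> \<open>From the length of t0 on the denominators are positive, so these are genuine
        quotients of real numbers.\<close>
      fix n assume "l t0 \<le> n"
      then have pos: "0 < \<alpha> n" using N_le[of t0 n] t0 by linarith
      then have "1 + 1 / real (Suc m) \<le> real (\<alpha> (n + m)) / real (\<alpha> n)"
        using *[OF pos] by (simp add: pos_le_divide_eq del: of_nat_Suc)
      moreover have "max_dim l p (n + m) / max_dim l p n = ennreal (real (\<alpha> (n + m)) / real (\<alpha> n))"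
        using pos by (simp add: max_dim divide_ennreal)
      ultimately show "ennreal (1 + 1 / real (Suc m)) \<le> max_dim l p (n + m) / max_dim l p n"
        by (simp only: ennreal_leI)
    qed
    from Liminf_bounded[OF this] have "ennreal (1 + 1 / real (Suc m)) \<le> ennreal 1"
      by (simp only: lim ennreal_1)
    then show False by (subst (asm) ennreal_le_iff) auto
  qed
  then obtain n where n: "\<And>m. 0 < \<alpha> (n m)"
    "\<And>m. real (\<alpha> (n m + m)) \<le> (1 + 1 / real (Suc m)) * real (\<alpha> (n m))"
    by metis
  define X where "X m = (SOME t. l t \<le> n m \<and> N t = \<alpha> (n m))" for m
  have "l (X m) \<le> n m \<and> N (X m) = \<alpha> (n m)" for m
    unfolding X_def by (rule someI_ex[OF \<alpha>_att])
  then have X: "\<And>m. l (X m) \<le> n m" "\<And>m. N (X m) = \<alpha> (n m)" by blast+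
  show thesis
  proof (rule that[of X])
    show "0 < N (X m)" for m using n(1) X(2) by simp
    fix t and e :: real assume e: "0 < e"
    have "\<forall>\<^sub>F m in sequentially. l t \<le> m" by (rule eventually_ge_at_top)
    moreover have "\<forall>\<^sub>F m in sequentially. inverse (real (Suc m)) < e"
      using order_tendstoD(2)[OF LIMSEQ_inverse_real_of_nat e] .
    ultimately show "\<forall>\<^sub>F m in sequentially. real (N (t + X m)) \<le> (1 + e) * real (N (X m))"
    proof eventually_elim
      fix m assume m: "l t \<le> m" "inverse (real (Suc m)) < e"
      have "l (t + X m) \<le> l t + l (X m)" using l by (simp add: proper_length_function_def)
      then have "l (t + X m) \<le> n m + m" using m(1) X(1)[of m] by linarith
      then have "real (N (t + X m)) \<le> real (\<alpha> (n m + m))" using N_le by simp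
      also have "\<dots> \<le> (1 + 1 / real (Suc m)) * real (\<alpha> (n m))" by (rule n(2))
      also have "\<dots> \<le> (1 + e) * real (\<alpha> (n m))"
        using m(2) by (intro mult_right_mono) (simp_all add: inverse_eq_divide)
      finally show "real (N (t + X m)) \<le> (1 + e) * real (N (X m))" by (simp add: X(2))
    qed
  qed
qed

theorem theorem5p8:
  fixes p :: "'g::group_add \<Rightarrow> ('h::complex_hilbert_space \<Rightarrow>\<^sub>L 'h)"
  assumes "separable_space (euclidean :: 'h topology)"
    and "\<not> (\<exists>B :: 'h set. finite B \<and> span B = UNIV)"
    and "countable (UNIV :: 'g set)"
    and "infinite (UNIV :: 'g set)"
    and "fixed_point_property_for_cones TYPE('g) TYPE(('g \<Rightarrow> real) \<Rightarrow> real)"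
    and "linf_projection p"
    and "subexponentially_growing_dimension p"
  shows "(\<exists>\<tau>. trace_on linf_algebra \<tau> \<and> lower_semicontinuous linf_algebra \<tau> \<and>
        invariant_on_linf \<tau> \<and> \<tau> (diag_op p) = 1) \<and>
    (\<exists>\<tau>'. trace_on roe_algebra \<tau>' \<and> lower_semicontinuous roe_algebra \<tau>' \<and>
        \<tau>' (roe_embedding p) = 1)"
proof -
  have p: "p \<in> linf_compact" "\<And>t. p t \<in> compact_ops" "\<And>t. p t o\<^sub>L p t = p t"
    "\<And>t. adjoint_op (p t) = p t"
    using assms(6) by (auto simp: linf_projection_def linf_compact_def)
  have "\<exists>n. cut_dimension (p t) n" for t
    by (rule compact_projection_dimension[OF p(2,3,4)])
  then obtain N where "\<And>t. cut_dimension (p t) (N t)" by metis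
  then have N: "\<And>t. Tr (p t) = of_nat (N t)" "\<And>t. p t \<noteq> 0 \<Longrightarrow> 0 < N t"
    "\<And>t \<epsilon>. 0 < \<epsilon> \<Longrightarrow> cut_trace \<epsilon> (\<lambda>e. inner (p t e) e) \<le> of_nat (N t)"
    "\<And>t \<epsilon>. \<epsilon> \<le> 1 \<Longrightarrow> ennreal (1 - \<epsilon>) * of_nat (N t) \<le> cut_trace \<epsilon> (\<lambda>e. inner (p t e) e)"
    by (simp_all add: cut_dimension_def)
  obtain t0 where "p t0 \<noteq> 0"
    using assms(7) by (auto simp: subexponentially_growing_dimension_def)
  then have t0: "0 < N t0" by (rule N(2))
  obtain l where "proper_length_function l"
    "\<And>m. liminf (\<lambda>n. max_dim l p (n + m) / max_dim l p n) = 1"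
    using assms(7) by (auto simp: subexponentially_growing_dimension_def)
  then obtain X :: "nat \<Rightarrow> 'g" where X: "\<And>n. 0 < N (X n)"
    "\<And>t e. 0 < e \<Longrightarrow> \<forall>\<^sub>F n in sequentially. real (N (t + X n)) \<le> (1 + e) * real (N (X n))"
    using subexponential_growth_points[of l p N t0] N(1) t0 by blast
  interpret growth "\<lambda>t. real (N t)" by standard simp
  have pos: "0 < real (N (X n))" for n using X(1) by simp
  obtain b where "b \<in> cone" "b (\<lambda>t. real (N t)) = 1"
    "\<And>t. b (left_translate t (\<lambda>t. real (N t))) \<le> 1"
    using bounded_orbit_exists[OF pos X(2)] by metis
  then obtain c where c: "c \<in> cone" "c (\<lambda>t. real (N t)) = 1" "\<And>t h. c (left_translate t h) = c h"
    using invariant_element_exists[OF assms(5)] by metis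
  interpret invariant_functional "extended c"
    by (rule invariant_functional_extended[OF c(1,3)])
  \<comment> \<open>The dimension function itself belongs to E, where the extension agrees with
    c.\<close>
  have "extended c (\<lambda>g. of_nat (N g)) = 1"
    using extended_eq[OF c(1) f_in_E] c(2) by (simp add: ennreal_of_nat_eq_real_of_nat)
  then have "form_trace (\<lambda>g e. inner (p g e) e) = 1"
    by (rule form_trace_eq_1) (use N in auto)
  then show ?thesis
    using traces_from_functional[OF p(1)] by simp
qed

end
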